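(* Consider the initial-boundary value problem (P) described in the context. Assume that $\lambda_i$ and $f_i$ are continuous, $\lambda_i$ and $\varphi_i$ are $C^1$-smooth in $x$, $f_i$ are $C^1$-smooth in $x$ and $u$, and $h_i$ are $C^1$-smooth in both arguments $(t,v)$, for all $1\le i\le n$. Suppose that for each $T>0$ there exist $C_f>0$ and $C_h>0$ such that $$\|\nabla_yf(x,t,y)\|\le C_f\bigl(\log\log F(x,t,\|y\|)\bigr)^{1/4}\quad\text{for all }(x,t)\in\overline{\Pi^T},\ y\in\mathbb{R}^n,$$ $$\|\nabla_zh(t,z)\|\le C_h\bigl(\log\log H(t,\|z\|)\bigr)^{1/4}\quad\text{for all }t\in[0,T],\ z\in\mathbb{R}^n,$$ where $F$ is a polynomial in $\|y\|$ with coefficients in $C^1(\overline{\Pi^T})$ and $H$ is a polynomial in $\|z\|$ with coefficients in $C^1[0,T]$. If the zero-order compatibility conditions and the first-order compatibility conditions (both stated in the context) are fulfilled, then problem (P) has a unique classical solution in $\Pi$.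
   Context: Let $\Pi=\{(x,t)\mid 0<x<1,\ t>0\}$ and, for $T>0$, $\Pi^T=\{(x,t)\mid 0<x<1,\ 0<t<T\}$. Let $n\ge 1$ and $1\le k\le n$ be integers. The data are: real functions $\lambda_1,\dots,\lambda_n$ on $\overline{\Pi}$ with $\lambda_1,\dots,\lambda_k<0$ and $\lambda_{k+1},\dots,\lambda_n>0$ on $\overline{\Pi}$, and $\Lambda=\mathrm{diag}(\lambda_1,\dots,\lambda_n)$; a function $f=(f_1,\dots,f_n):\overline{\Pi}\times\mathbb{R}^n\to\mathbb{R}^n$; a function $\varphi=(\varphi_1,\dots,\varphi_n):[0,1]\to\mathbb{R}^n$; and a function $h=(h_1,\dots,h_n):[0,\infty)\times\mathbb{R}^n\to\mathbb{R}^n$. Problem (P): find $u=(u_1,\dots,u_n)$ with $$(\partial_t+\Lambda(x,t)\partial_x)u=f(x,t,u),\quad (x,t)\in\Pi,$$ $$u(x,0)=\varphi(x),\quad x\in(0,1),$$ $$u_i(0,t)=h_i(t,v(t)),\quad k+1\le i\le n,\ t\in(0,\infty),$$ $$u_i(1,t)=h_i(t,v(t)),\quad 1\le i\le k,\ t\in(0,\infty),$$ where $v(t)=(u_1(0,t),\dots,u_k(0,t),u_{k+1}(1,t),\dots,u_n(1,t))$. A classical solution in $\Pi$ is a function $u$ that is $C^1$ in both variables (up to the boundary, i.e. on $\overline{\Pi}$) and satisfies all equations of (P). "$C^1$-smooth in" certain variables means that the corresponding first-order partial derivatives exist and are continuous functions of all arguments, up to the boundary. $\|\cdot\|$ is the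 Euclidean norm (for the Jacobian matrices, the corresponding norm; the choice only affects $C_f,C_h$). $\nabla_y f(x,t,y)$ and $\nabla_z h(t,z)$ denote the derivatives of $f$ and $h$ in their $\mathbb{R}^n$-argument; likewise $\nabla_v h_i$ is the gradient of $h_i$ in its second argument. The polynomials $F,H$ may depend on $T$, and are such that the right-hand sides of the growth conditions are well defined, i.e. $F\ge e$ and $H\ge e$ for the arguments in question. The dot $\cdot$ is the scalar product in $\mathbb{R}^n$. Put $v(0)=(\varphi_1(0),\dots,\varphi_k(0),\varphi_{k+1}(1),\dots,\varphi_n(1))$, and let $v'(0)\in\mathbb{R}^n$ be the vector whose $i$-th component is $f_i(0,0,\varphi(0))-\lambda_i(0,0)\varphi_i'(0)$ for $1\le i\le k$ and $f_i(1,0,\varphi(1))-\lambda_i(1,0)\varphi_i'(1)$ for $k+1\le i\le n$. Zero-order compatibility conditions: $\varphi_i(0)=h_i(0,v(0))$ for $k+1\le i\le n$, and $\varphi_i(1)=h_i(0,v(0))$ for $1\le i\le k$. First-order compatibility conditions: $f_i(0,0,\varphi(0))-\lambda_i(0,0)\varphi_i'(0)=\partial_t h_i(0,v(0))+\nabla_v h_i(0,v(0))\cdot v'(0)$ for $k+1\le i\le n$, and $f_i(1,0,\varphi(1))-\lambda_i(1,0)\varphi_i'(1)=\partial_t h_i(0,v(0))+\nabla_v h_i(0,v(0))\cdot v'(0)$ for $1\le i\le k$. *)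

theory Defs
  imports "HOL-Analysis.Analysis"
begin

(* The coordinates 1, ..., n of R^n are the elements of the finite linearly ordered index type,
   taken in increasing order; idx i is the number of the coordinate i. *)
definition idx :: "'n::{finite,linorder} \<Rightarrow> nat" where
  "idx i = card {j. j \<le> i}"

lemma bij_betw_idx: "bij_betw (idx :: 'n::{finite,linorder} \<Rightarrow> nat) UNIV {1..CARD('n)}"
proof -
  have "inj (idx :: 'n \<Rightarrow> nat)"
  proof (rule linorder_injI)
    fix i j :: 'n
    assume "i < j"
    then have "{l. l \<le> i} \<subset> {l. l \<le> j}"
      by (auto dest: order.strict_trans1)
    then have "idx i < idx j"
      unfolding idx_def by (intro psubset_card_mono) auto
    then show "idx i \<noteq> idx j" by simp
  qed
  moreover have "range (idx :: 'n \<Rightarrow> nat) \<subseteq> {1..CARD('n)}"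
  proof -
    have "1 \<le> idx i" for i :: 'n
      unfolding idx_def by (auto simp: Suc_le_eq card_gt_0_iff)
    moreover have "idx i \<le> CARD('n)" for i :: 'n
      unfolding idx_def by (intro card_mono) auto
    ultimately show ?thesis by auto
  qed
  ultimately show ?thesis
    by (simp add: bij_betw_def card_image card_subset_eq)
qed

definition diag :: "real ^ 'n \<Rightarrow> real ^ 'n ^ 'n" where
  "diag l = (\<chi> i j. if i = j then l $ i else 0)"

(* All derivatives are taken within the (closed) domain, so they are one-sided at boundary points.
   The library predicate C1_differentiable_on is not suitable, since it differentiates
   at x without restriction to the domain. *)

definition C1_within :: "real set \<Rightarrow> (real \<Rightarrow> 'a::real_normed_vector) \<Rightarrow> bool" where
  "C1_within A g \<longleftrightarrow>
     (\<forall>x\<in>A. g differentiable (at x within A)) \<and>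
     continuous_on A (\<lambda>x. vector_derivative g (at x within A))"

definition deriv1 :: "real set \<Rightarrow> (real \<Rightarrow> 'b \<Rightarrow> 'a::real_normed_vector) \<Rightarrow> real \<Rightarrow> 'b \<Rightarrow> 'a" where
  "deriv1 A w x y = vector_derivative (\<lambda>\<xi>. w \<xi> y) (at x within A)"

definition deriv2 :: "real set \<Rightarrow> ('b \<Rightarrow> real \<Rightarrow> 'a::real_normed_vector) \<Rightarrow> 'b \<Rightarrow> real \<Rightarrow> 'a" where
  "deriv2 B w y t = vector_derivative (\<lambda>\<tau>. w y \<tau>) (at t within B)"

definition C1_in_1st ::
    "real set \<Rightarrow> 'b::topological_space set \<Rightarrow> (real \<Rightarrow> 'b \<Rightarrow> 'a::real_normed_vector) \<Rightarrow> bool" where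
  "C1_in_1st A B w \<longleftrightarrow>
     (\<forall>x\<in>A. \<forall>y\<in>B. (\<lambda>\<xi>. w \<xi> y) differentiable (at x within A)) \<and>
     continuous_on (A \<times> B) (\<lambda>(x, y). deriv1 A w x y)"

definition C1_in_2nd ::
    "'b::topological_space set \<Rightarrow> real set \<Rightarrow> ('b \<Rightarrow> real \<Rightarrow> 'a::real_normed_vector) \<Rightarrow> bool" where
  "C1_in_2nd A B w \<longleftrightarrow>
     (\<forall>y\<in>A. \<forall>t\<in>B. (\<lambda>\<tau>. w y \<tau>) differentiable (at t within B)) \<and>
     continuous_on (A \<times> B) (\<lambda>(y, t). deriv2 B w y t)"

definition C1_both :: "real set \<Rightarrow> real set \<Rightarrow> (real \<Rightarrow> real \<Rightarrow> 'a::real_normed_vector) \<Rightarrow> bool" where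
  "C1_both A B w \<longleftrightarrow> C1_in_1st A B w \<and> C1_in_2nd A B w"

(* If all partial derivatives of g p are continuous, g p is (Frechet) differentiable, so that
   the library's jacobian (g p) (at y) is the matrix of these partial derivatives; its i-th row
   is the gradient of the i-th component of g p. *)

definition partial_deriv :: "'n \<Rightarrow> (real ^ 'n \<Rightarrow> real ^ 'm) \<Rightarrow> real ^ 'n \<Rightarrow> real ^ 'm" where
  "partial_deriv j g y = vector_derivative (\<lambda>s. g (y + s *\<^sub>R axis j 1)) (at 0)"

definition C1_in_vector ::
    "'b::topological_space set \<Rightarrow> ('b \<Rightarrow> real ^ 'n \<Rightarrow> real ^ 'm) \<Rightarrow> bool" where
  "C1_in_vector P g \<longleftrightarrow>
     (\<forall>j. (\<forall>p\<in>P. \<forall>y. (\<lambda>s. g p (y + s *\<^sub>R axis j 1)) differentiable (at 0)) \<and>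
          continuous_on (P \<times> UNIV) (\<lambda>(p, y). partial_deriv j (g p) y))"

(* The third argument of F, and the second one of H, stands for the norm of a vector. *)

definition C1_polynomial_xt :: "real \<Rightarrow> (real \<Rightarrow> real \<Rightarrow> real \<Rightarrow> real) \<Rightarrow> bool" where
  "C1_polynomial_xt T F \<longleftrightarrow>
     (\<exists>m a. (\<forall>j\<le>m. C1_both {0..1} {0..T} (a j)) \<and>
        (\<forall>x\<in>{0..1}. \<forall>t\<in>{0..T}. \<forall>s\<ge>0. F x t s = (\<Sum>j\<le>(m::nat). a j x t * s ^ j)))"

definition C1_polynomial_t :: "real \<Rightarrow> (real \<Rightarrow> real \<Rightarrow> real) \<Rightarrow> bool" where
  "C1_polynomial_t T H \<longleftrightarrow>
     (\<exists>m a. (\<forall>j\<le>m. C1_within {0..T} (a j)) \<and>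
        (\<forall>t\<in>{0..T}. \<forall>s\<ge>0. H t s = (\<Sum>j\<le>(m::nat). a j t * s ^ j)))"

(* Components 1, ..., k of a (a vector belonging to x = 0) and k+1, ..., n of b (a vector belonging
   to x = 1); in particular v(t) = outgoing k (u 0 t) (u 1 t). *)
definition outgoing :: "nat \<Rightarrow> real ^ 'n::{finite,linorder} \<Rightarrow> real ^ 'n::_ \<Rightarrow> real ^ 'n::_" where
  "outgoing k a b = (\<chi> i. if idx i \<le> k then a $ i else b $ i)"

definition classical_solution ::
    "nat \<Rightarrow> (real \<Rightarrow> real \<Rightarrow> real ^ 'n::{finite,linorder}) \<Rightarrow> (real \<Rightarrow> real \<Rightarrow> real ^ 'n::_ \<Rightarrow> real ^ 'n::_) \<Rightarrow>
     (real \<Rightarrow> real ^ 'n::_) \<Rightarrow> (real \<Rightarrow> real ^ 'n::_ \<Rightarrow> real ^ 'n::_) \<Rightarrow>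
     (real \<Rightarrow> real \<Rightarrow> real ^ 'n::_) \<Rightarrow> bool" where
  "classical_solution k lam f \<phi> h u \<longleftrightarrow>
     C1_both {0..1} {0..} u \<and>
     (\<forall>x\<in>{0<..<1}. \<forall>t>0.
        deriv2 {0..} u x t + diag (lam x t) *v deriv1 {0..1} u x t = f x t (u x t)) \<and>
     (\<forall>x\<in>{0<..<1}. u x 0 = \<phi> x) \<and>
     (\<forall>t>0. \<forall>i. k + 1 \<le> idx i \<longrightarrow> u 0 t $ i = h t (outgoing k (u 0 t) (u 1 t)) $ i) \<and>
     (\<forall>t>0. \<forall>i. idx i \<le> k \<longrightarrow> u 1 t $ i = h t (outgoing k (u 0 t) (u 1 t)) $ i)"

definition zero_order_compatible ::
    "nat \<Rightarrow> (real \<Rightarrow> real ^ 'n::{finite,linorder}) \<Rightarrow> (real \<Rightarrow> real ^ 'n::_ \<Rightarrow> real ^ 'n::_) \<Rightarrow> bool" where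
  "zero_order_compatible k \<phi> h \<longleftrightarrow>
     (let v0 = outgoing k (\<phi> 0) (\<phi> 1) in
        (\<forall>i. k + 1 \<le> idx i \<longrightarrow> \<phi> 0 $ i = h 0 v0 $ i) \<and>
        (\<forall>i. idx i \<le> k \<longrightarrow> \<phi> 1 $ i = h 0 v0 $ i))"

(* The time derivative at t = 0 which the system prescribes to a solution with initial data phi. *)
definition initial_velocity ::
    "(real \<Rightarrow> real \<Rightarrow> real ^ 'n) \<Rightarrow> (real \<Rightarrow> real \<Rightarrow> real ^ 'n \<Rightarrow> real ^ 'n) \<Rightarrow>
     (real \<Rightarrow> real ^ 'n) \<Rightarrow> real \<Rightarrow> real ^ 'n" where
  "initial_velocity lam f \<phi> x =
     f x 0 (\<phi> x) - diag (lam x 0) *v vector_derivative \<phi> (at x within {0..1})"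

definition first_order_compatible ::
    "nat \<Rightarrow> (real \<Rightarrow> real \<Rightarrow> real ^ 'n::{finite,linorder}) \<Rightarrow> (real \<Rightarrow> real \<Rightarrow> real ^ 'n::_ \<Rightarrow> real ^ 'n::_) \<Rightarrow>
     (real \<Rightarrow> real ^ 'n::_) \<Rightarrow> (real \<Rightarrow> real ^ 'n::_ \<Rightarrow> real ^ 'n::_) \<Rightarrow> bool" where
  "first_order_compatible k lam f \<phi> h \<longleftrightarrow>
     (let v0 = outgoing k (\<phi> 0) (\<phi> 1);
          d = initial_velocity lam f \<phi>;
          v0' = outgoing k (d 0) (d 1)
      in
        (\<forall>i. k + 1 \<le> idx i \<longrightarrow>
           d 0 $ i = deriv1 {0..} h 0 v0 $ i + row i (jacobian (h 0) (at v0)) \<bullet> v0') \<and>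
        (\<forall>i. idx i \<le> k \<longrightarrow>
           d 1 $ i = deriv1 {0..} h 0 v0 $ i + row i (jacobian (h 0) (at v0)) \<bullet> v0'))"

end

(* Along the characteristics of one component the equation is an ordinary differential equation, so the
   scalar transport equation is solved by straightening the flow X(t, y) of its speed: u(X(t, y), t) is an
   integral in t plus a function of the label y, which is the initial datum for y >= 0 and is read off from the
   inflow datum for y < 0; first-order compatibility makes the two pieces fit together in a C1 way.
   The system is solved by the Jacobi iteration u', p' = u'_x with source f(x, t, u) and inflow data h(t, v).
   In the weighted norm with weights exp(K t - r * depth), where depth is the distance from the
   inflow boundary of the component, traces at the exit count little, so that the iteration contracts although the
   boundary map does not.  The p' converge as well, since they solve linear problems of
   the same kind.  The Lipschitz constants are uniform because the growth condition yields a barrier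
   that the iteration preserves; no continuation argument is needed.  Uniqueness is the same contraction. *)
theory Submission
  imports Defs
begin

section \<open>Extension and gluing of differentiable functions\<close>

text \<open>Coefficients and source are only continuous in t, so the equation cannot be
  differentiated in t, and u_x is in general merely continuous. Its inflow value comes from the
  equation itself, p = (f - u_t) / lam, with u_t the time derivative of the boundary datum; hence
  u_t is carried along with u and p. The derivatives of f and h are only continuous, so the step for
  p contracts only up to an error that vanishes as the iterates u converge. Origin of the exponent
  1/4: for |z| of order exp (exp s) it lets the gradient be of order exp (s / 4). The barrier drops
  by exp (- s / 2) towards the exit, so the boundary map returns at most exp (- s / 4) times the
  inflow barrier up to a constant, and for large s this beats the constant. In the interior the
  source may exceed the barrier by a factor of order exp s, since this is the relative rate at which
  the barrier grows in time.\<close>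

definition clip :: "real \<Rightarrow> real \<Rightarrow> real \<Rightarrow> real" where
  "clip a b x = max a (min b x)"

lemma clip_in [simp]: "a \<le> b \<Longrightarrow> clip a b x \<in> {a..b}"
  by (auto simp: clip_def)

lemma clip_ge [simp]: "a \<le> b \<Longrightarrow> a \<le> clip a b x"
  and clip_le [simp]: "a \<le> b \<Longrightarrow> clip a b x \<le> b"
  by (auto simp: clip_def)

lemma clip_id [simp]: "a \<le> x \<Longrightarrow> x \<le> b \<Longrightarrow> clip a b x = x"
  by (auto simp: clip_def)

lemma continuous_on_clip [continuous_intros]:
  "continuous_on S f \<Longrightarrow> continuous_on S (\<lambda>x. clip a b (f x))"
  unfolding clip_def by (intro continuous_intros)

lemma dist_clip: "\<bar>clip a b x - clip a b y\<bar> \<le> \<bar>x - y\<bar>"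
  by (auto simp: clip_def)

lemma has_real_derivative_glue:
  fixes f :: "real \<Rightarrow> real"
  assumes "(f has_real_derivative D) (at c within {..c})"
    and "(f has_real_derivative D) (at c within {c..})"
  shows "(f has_real_derivative D) (at c)"
proof -
  have "(f has_real_derivative D) (at_left c)" "(f has_real_derivative D) (at_right c)"
    using assms by (auto intro: DERIV_subset)
  then show ?thesis
    unfolding has_field_derivative_iff by (rule filterlim_split_at)
qed

text \<open>A C1 extension by tangent lines. Its derivative is \<open>w'\<close> composed with
  \<open>clip\<close>, so continuity and bounds of \<open>w'\<close> carry over from the interval to
  the whole line.\<close>

definition lin_ext :: "real \<Rightarrow> real \<Rightarrow> (real \<Rightarrow> real) \<Rightarrow> (real \<Rightarrow> real) \<Rightarrow> real \<Rightarrow> real" where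
  "lin_ext a b w w' x = w (clip a b x) + w' (clip a b x) * (x - clip a b x)"

lemma lin_ext_eq [simp]: "a \<le> x \<Longrightarrow> x \<le> b \<Longrightarrow> lin_ext a b w w' x = w x"
  by (simp add: lin_ext_def)

lemma has_real_derivative_lin_ext:
  assumes ab: "a < b"
    and w: "\<And>x. x \<in> {a..b} \<Longrightarrow> (w has_real_derivative w' x) (at x within {a..b})"
  shows "(lin_ext a b w w' has_real_derivative w' (clip a b x)) (at x)"
proof -
  have lo: "(lin_ext a b w w' has_real_derivative w' a) (at x within {..a})" if "x \<le> a" for x
  proof (rule has_field_derivative_transform_within[where d = 1])
    show "((\<lambda>x. w a + w' a * (x - a)) has_real_derivative w' a) (at x within {..a})"
      by (auto intro!: derivative_eq_intros)
    show "w a + w' a * (y - a) = lin_ext a b w w' y" if "y \<in> {..a}" for y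
      using that ab by (simp add: lin_ext_def clip_def)
  qed (use that in auto)
  have hi: "(lin_ext a b w w' has_real_derivative w' b) (at x within {b..})" if "b \<le> x" for x
  proof (rule has_field_derivative_transform_within[where d = 1])
    show "((\<lambda>x. w b + w' b * (x - b)) has_real_derivative w' b) (at x within {b..})"
      by (auto intro!: derivative_eq_intros)
    show "w b + w' b * (y - b) = lin_ext a b w w' y" if "y \<in> {b..}" for y
      using that ab by (simp add: lin_ext_def clip_def)
  qed (use that in auto)
  have mid: "(lin_ext a b w w' has_real_derivative w' x) (at x within {a..b})" if "x \<in> {a..b}" for x
  proof (rule has_field_derivative_transform_within[where d = 1])
    show "(w has_real_derivative w' x) (at x within {a..b})"
      using that by (rule w)
  qed (use that in auto)
  consider "x < a" | "x = a" | "a < x" "x < b" | "x = b" | "b < x" by linarith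
  then show ?thesis
  proof cases
    case 1
    have "(lin_ext a b w w' has_real_derivative w' a) (at x within {..<a})"
      using lo[of x] 1 by (auto intro: DERIV_subset)
    moreover have "at x within {..<a} = at x"
      using 1 by (intro at_within_open) auto
    ultimately show ?thesis using 1 ab by (simp add: clip_def)
  next
    case 2
    have "(lin_ext a b w w' has_real_derivative w' a) (at a within {a..})"
    proof -
      have "at a within {a..b} = at a within {a..}"
        using ab by (intro at_within_nhd[of a "{..<b}"]) auto
      then show ?thesis using mid[of a] ab by simp
    qed
    then show ?thesis
      using has_real_derivative_glue[OF lo[of a]] 2 ab by simp
  next
    case 3
    then show ?thesis using mid[of x] at_within_Icc_at[of a x b] by simp
  next
    case 4
    have "(lin_ext a b w w' has_real_derivative w' b) (at b within {..b})"
    proof -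
      have "at b within {a..b} = at b within {..b}"
        using ab by (intro at_within_nhd[of b "{a<..}"]) auto
      then show ?thesis using mid[of b] ab by simp
    qed
    then show ?thesis
      using has_real_derivative_glue[OF _ hi[of b]] 4 ab by simp
  next
    case 5
    have "(lin_ext a b w w' has_real_derivative w' b) (at x within {b<..})"
      using hi[of x] 5 by (auto intro: DERIV_subset)
    moreover have "at x within {b<..} = at x"
      using 5 by (intro at_within_open) auto
    ultimately show ?thesis using 5 ab by (simp add: clip_def)
  qed
qed

lemma nondecreasing_if_derivative_nonneg:
  fixes F :: "real \<Rightarrow> real"
  assumes "s \<le> t"
    and "\<And>r. r \<in> {s..t} \<Longrightarrow> (F has_real_derivative F' r) (at r within {s..t})"
    and "\<And>r. r \<in> {s..t} \<Longrightarrow> F' r \<ge> 0"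
  shows "F s \<le> F t"
proof -
  have "\<exists>r\<in>{s..t}. F t - F s = F' r * (t - s)"
    using assms(1,2) by (intro mvt_very_simple) (auto simp: has_field_derivative_def)
  then obtain r where "r \<in> {s..t}" "F t - F s = F' r * (t - s)" by blast
  moreover have "F' r * (t - s) \<ge> 0" using assms(1,3) calculation(1) by simp
  ultimately show ?thesis by linarith
qed

lemma continuous_on_integral_upto:
  fixes k :: "real \<Rightarrow> 'b::topological_space \<Rightarrow> real"
  assumes "continuous_on ({0..T} \<times> UNIV) (\<lambda>(r, y). k r y)"
  shows "continuous_on ({0..T} \<times> UNIV) (\<lambda>(t, y). integral {0..t} (\<lambda>r. k r y))"
proof -
  note k = continuous_on_compose_Pair[OF assms]
  have split: "integral {0..t} (\<lambda>r. k r y) =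
      integral (cbox 0 T) (\<lambda>r. k (min r t) y) - (T - t) * k t y" if t: "t \<in> {0..T}" for t y
  proof -
    have "integral {0..t} (\<lambda>r. k (min r t) y) + integral {t..T} (\<lambda>r. k (min r t) y)
        = integral {0..T} (\<lambda>r. k (min r t) y)"
      using t by (intro Henstock_Kurzweil_Integration.integral_combine integrable_continuous_real k)
        (auto intro!: continuous_intros)
    moreover have "integral {0..t} (\<lambda>r. k (min r t) y) = integral {0..t} (\<lambda>r. k r y)"
      by (intro integral_cong) (auto simp: min_def)
    moreover have "integral {t..T} (\<lambda>r. k (min r t) y) = integral {t..T} (\<lambda>r. k t y)"
      by (intro integral_cong) (auto simp: min_def)
    ultimately show ?thesis using t by simp
  qed
  have "continuous_on ({0..T} \<times> UNIV)
     (\<lambda>p. integral (cbox 0 T) (\<lambda>r. k (min r (fst p)) (snd p)) - (T - fst p) * k (fst p) (snd p))"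
    by (intro continuous_intros integral_continuous_on_param)
      (auto intro!: continuous_intros k simp: split_beta)
  then show ?thesis
    by (rule continuous_on_cong[THEN iffD1, rotated -1]) (auto simp: split)
qed

lemma has_real_derivative_integral_upto:
  fixes k :: "real \<Rightarrow> real"
  assumes "continuous_on {0..T} k" "t \<in> {0..T}"
  shows "((\<lambda>t. integral {0..t} k) has_real_derivative k t) (at t within {0..T})"
  using integral_has_vector_derivative[OF assms]
  by (simp add: has_real_derivative_iff_has_vector_derivative)

text \<open>Separate continuity suffices because the Lipschitz constant in y does not depend on t.
  Used for the flow, for its inverse and for functions with bounded x-derivative.\<close>

lemma continuous_on_lipschitz_snd:
  fixes X :: "real \<Rightarrow> real \<Rightarrow> real"
  assumes lip: "\<And>t y z. t \<in> A \<Longrightarrow> \<bar>X t y - X t z\<bar> \<le> M * \<bar>y - z\<bar>"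
    and cont: "\<And>y. continuous_on A (\<lambda>t. X t y)"
  shows "continuous_on (A \<times> UNIV) (\<lambda>(t, y). X t y)"
  unfolding continuous_on_def
proof
  fix p assume p: "p \<in> A \<times> (UNIV :: real set)"
  obtain t y where ty: "p = (t, y)" "t \<in> A" using p by auto
  let ?F = "at p within A \<times> UNIV"
  have lim1: "((\<lambda>q. X (fst q) y) \<longlongrightarrow> X t y) ?F"
  proof -
    have "continuous_on (A \<times> UNIV) (\<lambda>q :: real \<times> real. X (fst q) y)"
      by (intro continuous_on_compose2[OF cont[of y]] continuous_intros) auto
    then show ?thesis using p ty unfolding continuous_on_def by fastforce
  qed
  have "((\<lambda>q. X (fst q) (snd q) - X (fst q) y) \<longlongrightarrow> 0) ?F"
  proof (rule Lim_null_comparison)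
    show "\<forall>\<^sub>F q in ?F. norm (X (fst q) (snd q) - X (fst q) y) \<le> M * \<bar>snd q - y\<bar>"
      by (auto simp: eventually_at_filter split_beta intro!: always_eventually lip)
    have "((\<lambda>q. M * \<bar>snd q - y\<bar>) \<longlongrightarrow> M * \<bar>snd p - y\<bar>) ?F"
      by (intro tendsto_intros)
    then show "((\<lambda>q. M * \<bar>snd q - y\<bar>) \<longlongrightarrow> 0) ?F" using ty by simp
  qed
  from tendsto_add[OF this lim1] show "((\<lambda>(t, y). X t y) \<longlongrightarrow> (case p of (t, y) \<Rightarrow> X t y)) ?F"
    using ty by (simp add: case_prod_unfold)
qed

section \<open>The flow of a scalar field\<close>

text \<open>Both partial derivatives together with continuity of one of them give total
  differentiability relative to the rectangle \<open>A \<times> B\<close>. At its edges the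
  derivatives are one-sided, as they are on the closed strip.\<close>

lemma has_real_derivative_compose_partials:
  fixes w :: "real \<Rightarrow> real \<Rightarrow> real"
  assumes wx: "\<And>x y. x \<in> A \<Longrightarrow> y \<in> B \<Longrightarrow> ((\<lambda>x. w x y) has_real_derivative wx x y) (at x within A)"
    and wy: "\<And>x y. x \<in> A \<Longrightarrow> y \<in> B \<Longrightarrow> ((\<lambda>y. w x y) has_real_derivative wy x y) (at y within B)"
    and wy_cont: "continuous_on (A \<times> B) (\<lambda>(x, y). wy x y)"
    and B: "convex B"
    and \<xi>: "(\<xi> has_real_derivative \<xi>') (at t within S)" "\<xi> ` S \<subseteq> A"
    and \<eta>: "(\<eta> has_real_derivative \<eta>') (at t within S)" "\<eta> ` S \<subseteq> B"
    and t: "t \<in> S"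
  shows "((\<lambda>t. w (\<xi> t) (\<eta> t)) has_real_derivative
           wx (\<xi> t) (\<eta> t) * \<xi>' + wy (\<xi> t) (\<eta> t) * \<eta>') (at t within S)"
proof -
  have mem: "\<xi> t \<in> A" "\<eta> t \<in> B" using \<xi>(2) \<eta>(2) t by auto
  have D: "((\<lambda>(x, y). w x y) has_derivative
      (\<lambda>(tx, ty). wx (\<xi> t) (\<eta> t) * tx + blinfun_mult_right (wy (\<xi> t) (\<eta> t)) ty))
      (at (\<xi> t, \<eta> t) within A \<times> B)"
  proof (rule has_derivative_partialsI)
    show "((\<lambda>x. w x (\<eta> t)) has_derivative (*) (wx (\<xi> t) (\<eta> t))) (at (\<xi> t) within A)"
      using wx[OF mem] by (simp add: has_field_derivative_def)
    show "((\<lambda>y. w x y) has_derivative blinfun_apply (blinfun_mult_right (wy x y))) (at y within B)"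
      if "x \<in> A" "y \<in> B" for x y
      using wy[OF that] by (simp add: has_field_derivative_def blinfun_mult_right.rep_eq)
    have "continuous_on (A \<times> B) (\<lambda>(x, y). blinfun_mult_right (wy x y))"
      using wy_cont unfolding case_prod_unfold
      by (intro bounded_linear.continuous_on[OF bounded_linear_blinfun_mult_right])
    then show "continuous (at (\<xi> t, \<eta> t) within A \<times> B) (\<lambda>(x, y). blinfun_mult_right (wy x y))"
      using mem by (simp add: continuous_on_eq_continuous_within)
  qed (use mem B in auto)
  have P: "((\<lambda>t. (\<xi> t, \<eta> t)) has_derivative (\<lambda>s. (\<xi>' * s, \<eta>' * s))) (at t within S)"
    using \<xi>(1) \<eta>(1) by (intro has_derivative_Pair) (simp_all add: has_field_derivative_def)
  have "(((\<lambda>(x, y). w x y) \<circ> (\<lambda>t. (\<xi> t, \<eta> t))) has_derivative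
      (\<lambda>(tx, ty). wx (\<xi> t) (\<eta> t) * tx + blinfun_mult_right (wy (\<xi> t) (\<eta> t)) ty) \<circ> (\<lambda>s. (\<xi>' * s, \<eta>' * s)))
      (at t within S)"
  proof (rule diff_chain_within[OF P])
    show "((\<lambda>(x, y). w x y) has_derivative
        (\<lambda>(tx, ty). wx (\<xi> t) (\<eta> t) * tx + blinfun_mult_right (wy (\<xi> t) (\<eta> t)) ty))
        (at (\<xi> t, \<eta> t) within (\<lambda>t. (\<xi> t, \<eta> t)) ` S)"
      by (rule has_derivative_subset[OF D]) (use \<xi>(2) \<eta>(2) in auto)
  qed
  then show ?thesis
    unfolding has_field_derivative_def o_def split_conv
    by (rule has_derivative_eq_rhs) (auto simp: blinfun_mult_right.rep_eq algebra_simps)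
qed

definition solves :: "(real \<Rightarrow> real \<Rightarrow> real) \<Rightarrow> (real \<Rightarrow> real) \<Rightarrow> real \<Rightarrow> real \<Rightarrow> bool" where
  "solves l \<xi> s t \<longleftrightarrow> (\<forall>r\<in>{s..t}. (\<xi> has_real_derivative l (\<xi> r) r) (at r within {s..t}))"

lemma solvesD: "solves l \<xi> s t \<Longrightarrow> r \<in> {s..t} \<Longrightarrow> (\<xi> has_real_derivative l (\<xi> r) r) (at r within {s..t})"
  by (simp add: solves_def)

lemma solves_subinterval: "solves l \<xi> s t \<Longrightarrow> {s'..t'} \<subseteq> {s..t} \<Longrightarrow> solves l \<xi> s' t'"
  unfolding solves_def by (blast intro: DERIV_subset)

lemma solves_continuous_on: "solves l \<xi> s t \<Longrightarrow> continuous_on {s..t} \<xi>"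
  by (rule DERIV_continuous_on[OF solvesD])

text \<open>The field lives on the whole line and has the bounded x-derivative \<open>m\<close>, so
  no solution blows up before T. A field given on the strip is brought into this form by
  \<open>C1_x_extension\<close>.\<close>

locale scalar_flow =
  fixes l m :: "real \<Rightarrow> real \<Rightarrow> real" and T L :: real
  assumes T: "0 < T" and L: "0 < L"
    and l_cont: "continuous_on (UNIV \<times> {0..T}) (\<lambda>(x, t). l x t)"
    and m_cont: "continuous_on (UNIV \<times> {0..T}) (\<lambda>(x, t). m x t)"
    and l_deriv: "\<And>x t. t \<in> {0..T} \<Longrightarrow> ((\<lambda>x. l x t) has_real_derivative m x t) (at x)"
    and m_bound: "\<And>x t. t \<in> {0..T} \<Longrightarrow> \<bar>m x t\<bar> \<le> L"
begin

section \<open>Existence and stability of integral curves\<close>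

lemma l_diff:
  assumes "t \<in> {0..T}"
  shows "\<exists>\<zeta>. \<bar>\<zeta> - y\<bar> \<le> \<bar>x - y\<bar> \<and> l x t - l y t = m \<zeta> t * (x - y)"
proof -
  consider "x < y" | "x = y" | "y < x" by linarith
  then show ?thesis
  proof cases
    case 1
    obtain z where "x < z" "z < y" "l y t - l x t = (y - x) * m z t"
      using MVT2[OF 1, of "\<lambda>x. l x t" "\<lambda>x. m x t"] l_deriv[OF assms] by blast
    then show ?thesis by (intro exI[of _ z]) (auto simp: algebra_simps)
  next
    case 3
    obtain z where "y < z" "z < x" "l x t - l y t = (x - y) * m z t"
      using MVT2[OF 3, of "\<lambda>x. l x t" "\<lambda>x. m x t"] l_deriv[OF assms] by blast
    then show ?thesis by (intro exI[of _ z]) (auto simp: algebra_simps)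
  qed auto
qed

lemma l_lipschitz:
  assumes "t \<in> {0..T}"
  shows "\<bar>l x t - l y t\<bar> \<le> L * \<bar>x - y\<bar>"
proof -
  obtain \<zeta> where "l x t - l y t = m \<zeta> t * (x - y)" using l_diff[OF assms, of y x] by blast
  then show ?thesis using m_bound[OF assms, of \<zeta>] by (simp add: abs_mult mult_right_mono)
qed

text \<open>Picard iteration for \<open>w t = exp (- 2 * L * t) * (\<xi> t - y)\<close>: with this
  weight the integral operator is a contraction by 1/2 on all of [0, T] at once. Clipping the time
  turns it into an operator on bounded continuous functions on the real line, to which Banach's
  theorem applies.\<close>

lemma solution_exists: "\<exists>\<xi>. \<xi> 0 = y \<and> solves l \<xi> 0 T"
proof -
  define g where "g w r = l (y + exp (2 * L * r) * w r) r" for w :: "real \<Rightarrow> real" and r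
  define J where "J w t = integral {0..t} (g w)" for w t
  define F where "F w t = exp (- (2 * L * clip 0 T t)) * J w (clip 0 T t)" for w t
  have g_cont: "continuous_on {0..T} (g w)" if "continuous_on UNIV w" for w
    unfolding g_def
    by (intro continuous_on_compose_Pair[OF l_cont] continuous_intros continuous_on_subset[OF that]) auto
  have J_deriv: "(J w has_real_derivative g w t) (at t within {0..T})"
    if "continuous_on UNIV w" "t \<in> {0..T}" for w t
    unfolding J_def by (rule has_real_derivative_integral_upto[OF g_cont[OF that(1)] that(2)])
  have J_cont: "continuous_on {0..T} (J w)" if "continuous_on UNIV w" for w
    using J_deriv[OF that] by (rule DERIV_continuous_on)
  have F_bcont: "F w \<in> bcontfun" if w: "continuous_on UNIV w" for w
  proof -
    define K where "K t = exp (- (2 * L * t)) * J w t" for t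
    have K: "continuous_on {0..T} K"
      unfolding K_def by (intro continuous_intros J_cont w)
    have "F w = (\<lambda>t. K (clip 0 T t))" by (auto simp: F_def K_def)
    moreover have "continuous_on UNIV (\<lambda>t. K (clip 0 T t))"
      using T by (intro continuous_on_compose2[OF K] continuous_intros) auto
    moreover have "bounded (range (\<lambda>t. K (clip 0 T t)))"
    proof (rule bounded_subset)
      show "bounded (K ` {0..T})"
        using compact_continuous_image[OF K] compact_imp_bounded by blast
      show "range (\<lambda>t. K (clip 0 T t)) \<subseteq> K ` {0..T}"
        using T clip_in[of 0 T] by (auto simp del: clip_in)
    qed
    ultimately show ?thesis by (simp add: bcontfun_def)
  qed
  have F_contr: "\<bar>F w t - F v t\<bar> \<le> d / 2"
    if w: "continuous_on UNIV w" and v: "continuous_on UNIV v" and d: "\<And>r. \<bar>w r - v r\<bar> \<le> d" for w v t d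
  proof -
    define c where "c = clip 0 T t"
    have c: "c \<in> {0..T}" using T by (simp add: c_def)
    have sub: "{0..c} \<subseteq> {0..T}" using c by auto
    have gd: "\<bar>g w r - g v r\<bar> \<le> L * exp (2 * L * r) * d" if "r \<in> {0..c}" for r
    proof -
      have "\<bar>g w r - g v r\<bar> \<le> L * \<bar>(y + exp (2 * L * r) * w r) - (y + exp (2 * L * r) * v r)\<bar>"
        unfolding g_def using that sub by (intro l_lipschitz) auto
      also have "\<dots> = L * exp (2 * L * r) * \<bar>w r - v r\<bar>"
        by (simp add: abs_mult flip: right_diff_distrib)
      also have "\<dots> \<le> L * exp (2 * L * r) * d" using L d by (intro mult_left_mono) auto
      finally show ?thesis .
    qed
    have DJ: "((\<lambda>r. J w r - J v r) has_real_derivative g w r - g v r) (at r within {0..c})"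
      if "r \<in> {0..c}" for r
      using that sub by (intro DERIV_diff DERIV_subset[OF J_deriv[OF w] sub] DERIV_subset[OF J_deriv[OF v] sub]) auto
    \<comment> \<open>\<open>d / 2 * exp (2 * L * r)\<close> is a primitive of the bound in
      \<open>gd\<close>. Monotonicity of its sum and its difference with \<open>J w - J v\<close>
      replaces an estimate of integrals.\<close>
    have "d / 2 * exp (2 * L * 0) + (J w 0 - J v 0) \<le> d / 2 * exp (2 * L * c) + (J w c - J v c)"
    proof (rule nondecreasing_if_derivative_nonneg[where F' = "\<lambda>r. L * exp (2 * L * r) * d + (g w r - g v r)"
          and F = "\<lambda>r. d / 2 * exp (2 * L * r) + (J w r - J v r)"])
      show "((\<lambda>r. d / 2 * exp (2 * L * r) + (J w r - J v r)) has_real_derivative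
           L * exp (2 * L * r) * d + (g w r - g v r)) (at r within {0..c})" if "r \<in> {0..c}" for r
        by (rule DERIV_cong[OF DERIV_add[OF _ DJ[OF that]]]) (auto intro!: derivative_eq_intros)
    qed (use c gd in \<open>force+\<close>)
    moreover have "d / 2 * exp (2 * L * 0) - (J w 0 - J v 0) \<le> d / 2 * exp (2 * L * c) - (J w c - J v c)"
    proof (rule nondecreasing_if_derivative_nonneg[where F' = "\<lambda>r. L * exp (2 * L * r) * d - (g w r - g v r)"
          and F = "\<lambda>r. d / 2 * exp (2 * L * r) - (J w r - J v r)"])
      show "((\<lambda>r. d / 2 * exp (2 * L * r) - (J w r - J v r)) has_real_derivative
           L * exp (2 * L * r) * d - (g w r - g v r)) (at r within {0..c})" if "r \<in> {0..c}" for r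
        by (rule DERIV_cong[OF DERIV_diff[OF _ DJ[OF that]]]) (auto intro!: derivative_eq_intros)
    qed (use c gd in \<open>force+\<close>)
    moreover have "d \<ge> 0" using d[of 0] by linarith
    moreover have "J w 0 = 0" "J v 0 = 0" by (simp_all add: J_def)
    ultimately have "\<bar>J w c - J v c\<bar> \<le> d / 2 * exp (2 * L * c)"
      by (intro abs_leI) simp_all
    then have "exp (- (2 * L * c)) * \<bar>J w c - J v c\<bar> \<le> exp (- (2 * L * c)) * (d / 2 * exp (2 * L * c))"
      by (intro mult_left_mono) auto
    also have "\<dots> = d / 2" by (simp add: exp_minus)
    finally show ?thesis
      by (simp add: F_def c_def[symmetric] abs_mult flip: right_diff_distrib)
  qed
  define \<Phi> where "\<Phi> w = Bcontfun (F (apply_bcontfun w))" for w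
  have \<Phi>: "apply_bcontfun (\<Phi> w) = F (apply_bcontfun w)" for w
    unfolding \<Phi>_def by (intro Bcontfun_inverse F_bcont) simp
  have "\<exists>!w. \<Phi> w = w"
  proof (rule banach_fix_type[of "1 / 2"])
    show "\<forall>w v. dist (\<Phi> w) (\<Phi> v) \<le> 1 / 2 * dist w v"
    proof (intro allI dist_bound)
      fix w v t
      show "dist (\<Phi> w t) (\<Phi> v t) \<le> 1 / 2 * dist w v"
        unfolding \<Phi> dist_real_def using dist_bounded[of w _ v]
        by (intro order_trans[OF F_contr[where d = "dist w v"]]) (auto simp: dist_real_def)
    qed
  qed auto
  then obtain w where w: "\<Phi> w = w" by blast
  have wc: "continuous_on UNIV (apply_bcontfun w)" by simp
  define \<xi> where "\<xi> t = y + J (apply_bcontfun w) t" for t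
  have eq: "exp (2 * L * t) * apply_bcontfun w t = J (apply_bcontfun w) t" if "t \<in> {0..T}" for t
  proof -
    have "apply_bcontfun w t = F (apply_bcontfun w) t" using \<Phi>[of w] w by simp
    then show ?thesis using that by (simp add: F_def exp_minus)
  qed
  have "\<xi> 0 = y" by (simp add: \<xi>_def J_def)
  moreover have "solves l \<xi> 0 T"
    unfolding solves_def
  proof
    fix r assume r: "r \<in> {0..T}"
    have "(\<xi> has_real_derivative 0 + g (apply_bcontfun w) r) (at r within {0..T})"
      unfolding \<xi>_def by (intro DERIV_add DERIV_const J_deriv wc r)
    moreover have "g (apply_bcontfun w) r = l (\<xi> r) r"
      using eq[OF r] by (simp add: g_def \<xi>_def)
    ultimately show "(\<xi> has_real_derivative l (\<xi> r) r) (at r within {0..T})" by simp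
  qed
  ultimately show ?thesis by blast
qed

text \<open>Gronwall in both time directions: the squared distance, multiplied by
  \<open>exp (2 * L * (r - s))\<close> or \<open>exp (- 2 * L * (r - s))\<close>, is monotone.
  Squaring avoids differentiating an absolute value. The backward estimate makes the flow injective
  with a Lipschitz inverse.\<close>

lemma solutions_compare:
  assumes \<xi>: "solves l \<xi> s t" and \<eta>: "solves l \<eta> s t" and st: "0 \<le> s" "s \<le> t" "t \<le> T"
  shows "\<bar>\<xi> t - \<eta> t\<bar> \<le> exp (L * (t - s)) * \<bar>\<xi> s - \<eta> s\<bar>"
    and "\<bar>\<xi> s - \<eta> s\<bar> \<le> exp (L * (t - s)) * \<bar>\<xi> t - \<eta> t\<bar>"
proof -
  define d where "d r = \<xi> r - \<eta> r" for r
  define d' where "d' r = l (\<xi> r) r - l (\<eta> r) r" for r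
  have D: "(d has_real_derivative d' r) (at r within {s..t})" if "r \<in> {s..t}" for r
    unfolding d_def d'_def by (intro DERIV_diff solvesD[OF \<xi>] solvesD[OF \<eta>] that)
  have bound: "\<bar>d r * d' r\<bar> \<le> L * (d r)\<^sup>2" if "r \<in> {s..t}" for r
  proof -
    have "\<bar>d' r\<bar> \<le> L * \<bar>d r\<bar>" unfolding d_def d'_def using that st by (intro l_lipschitz) auto
    then have "\<bar>d r\<bar> * \<bar>d' r\<bar> \<le> \<bar>d r\<bar> * (L * \<bar>d r\<bar>)" by (intro mult_left_mono) auto
    also have "\<dots> = L * (d r)\<^sup>2" by (simp add: power2_eq_square)
    finally show ?thesis by (simp add: abs_mult)
  qed
  have "(d s)\<^sup>2 * exp (2 * L * (s - s)) \<le> (d t)\<^sup>2 * exp (2 * L * (t - s))"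
  proof (rule nondecreasing_if_derivative_nonneg[where
        F' = "\<lambda>r. 2 * (d r * d' r + L * (d r)\<^sup>2) * exp (2 * L * (r - s))"
        and F = "\<lambda>r. (d r)\<^sup>2 * exp (2 * L * (r - s))"])
    show "((\<lambda>r. (d r)\<^sup>2 * exp (2 * L * (r - s))) has_real_derivative
        2 * (d r * d' r + L * (d r)\<^sup>2) * exp (2 * L * (r - s))) (at r within {s..t})" if "r \<in> {s..t}" for r
      by (auto intro!: derivative_eq_intros D[OF that] simp: algebra_simps power2_eq_square)
    show "0 \<le> 2 * (d r * d' r + L * (d r)\<^sup>2) * exp (2 * L * (r - s))" if "r \<in> {s..t}" for r
      using bound[OF that] by (intro mult_nonneg_nonneg) auto
  qed (use st in auto)
  then have "\<bar>d s\<bar>\<^sup>2 \<le> (exp (L * (t - s)) * \<bar>d t\<bar>)\<^sup>2"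
    by (simp add: power_mult_distrib mult_ac flip: exp_double)
  then show "\<bar>\<xi> s - \<eta> s\<bar> \<le> exp (L * (t - s)) * \<bar>\<xi> t - \<eta> t\<bar>"
    unfolding d_def by (rule power2_le_imp_le) auto
  have "- ((d s)\<^sup>2 * exp (- 2 * L * (s - s))) \<le> - ((d t)\<^sup>2 * exp (- 2 * L * (t - s)))"
  proof (rule nondecreasing_if_derivative_nonneg[where
        F' = "\<lambda>r. 2 * (L * (d r)\<^sup>2 - d r * d' r) * exp (- 2 * L * (r - s))"
        and F = "\<lambda>r. - ((d r)\<^sup>2 * exp (- 2 * L * (r - s)))"])
    show "((\<lambda>r. - ((d r)\<^sup>2 * exp (- 2 * L * (r - s)))) has_real_derivative
        2 * (L * (d r)\<^sup>2 - d r * d' r) * exp (- 2 * L * (r - s))) (at r within {s..t})" if "r \<in> {s..t}" for r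
      by (auto intro!: derivative_eq_intros D[OF that] simp: algebra_simps power2_eq_square)
    show "0 \<le> 2 * (L * (d r)\<^sup>2 - d r * d' r) * exp (- 2 * L * (r - s))" if "r \<in> {s..t}" for r
      using bound[OF that] by (intro mult_nonneg_nonneg) auto
  qed (use st in auto)
  then have "(d t)\<^sup>2 * exp (- 2 * L * (t - s)) * exp (2 * L * (t - s)) \<le> (d s)\<^sup>2 * exp (2 * L * (t - s))"
    by (intro mult_right_mono) auto
  then have "\<bar>d t\<bar>\<^sup>2 \<le> (exp (L * (t - s)) * \<bar>d s\<bar>)\<^sup>2"
    by (simp add: power_mult_distrib mult_ac mult_exp_exp flip: exp_double)
  then show "\<bar>\<xi> t - \<eta> t\<bar> \<le> exp (L * (t - s)) * \<bar>\<xi> s - \<eta> s\<bar>"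
    unfolding d_def by (rule power2_le_imp_le) auto
qed

section \<open>The flow, its inverse and their derivatives\<close>

definition X :: "real \<Rightarrow> real \<Rightarrow> real" where
  "X t y = (SOME \<xi>. \<xi> 0 = y \<and> solves l \<xi> 0 T) t"

lemma X_0 [simp]: "X 0 y = y"
  and solves_X: "solves l (\<lambda>t. X t y) 0 T"
proof -
  have "(SOME \<xi>. \<xi> 0 = y \<and> solves l \<xi> 0 T) 0 = y \<and> solves l (SOME \<xi>. \<xi> 0 = y \<and> solves l \<xi> 0 T) 0 T"
    by (rule someI_ex[OF solution_exists])
  then show "X 0 y = y" "solves l (\<lambda>t. X t y) 0 T" by (simp_all add: X_def)
qed

lemma X_deriv: "t \<in> {0..T} \<Longrightarrow> ((\<lambda>t. X t y) has_real_derivative l (X t y) t) (at t within {0..T})"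
  using solves_X by (rule solvesD)

lemma X_compare:
  assumes "t \<in> {0..T}"
  shows "\<bar>X t y - X t z\<bar> \<le> exp (L * T) * \<bar>y - z\<bar>"
    and "\<bar>y - z\<bar> \<le> exp (L * T) * \<bar>X t y - X t z\<bar>"
proof -
  have S: "solves l (\<lambda>r. X r y) 0 t" for y
    using solves_subinterval[OF solves_X] assms by auto
  have "exp (L * (t - 0)) \<le> exp (L * T)" using assms L by simp
  note e = mult_right_mono[OF this abs_ge_zero]
  show "\<bar>X t y - X t z\<bar> \<le> exp (L * T) * \<bar>y - z\<bar>"
    using solutions_compare(1)[OF S[of y] S[of z]] e[of "y - z"] assms by auto
  show "\<bar>y - z\<bar> \<le> exp (L * T) * \<bar>X t y - X t z\<bar>"
    using solutions_compare(2)[OF S[of y] S[of z]] e[of "X t y - X t z"] assms by auto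
qed

lemma X_inj: "t \<in> {0..T} \<Longrightarrow> X t y = X t z \<Longrightarrow> y = z"
proof -
  assume "t \<in> {0..T}" "X t y = X t z"
  then have "\<bar>y - z\<bar> \<le> 0" using X_compare(2)[of t y z] by simp
  then show ?thesis by simp
qed

lemma X_cont_t: "continuous_on {0..T} (\<lambda>t. X t y)"
  using solves_X by (rule solves_continuous_on)

lemma X_cont: "continuous_on ({0..T} \<times> UNIV) (\<lambda>(t, y). X t y)"
  by (rule continuous_on_lipschitz_snd[where M = "exp (L * T)"]) (fact X_compare X_cont_t)+

text \<open>Two curves whose order is reversed at time t have met before, by the intermediate value
  theorem, and curves that meet have the same label.\<close>

lemma X_strict_mono:
  assumes "t \<in> {0..T}" "y < z"
  shows "X t y < X t z"
proof (rule ccontr)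
  assume "\<not> X t y < X t z"
  then have "\<exists>r\<ge>0. r \<le> t \<and> X r z - X r y = 0"
    using assms
    by (intro IVT2') (auto intro!: continuous_on_diff continuous_on_subset[OF X_cont_t])
  then obtain r where r: "0 \<le> r" "r \<le> t" "X r z = X r y" by auto
  moreover have "r \<in> {0..T}" using r assms(1) by simp
  ultimately have "z = y" using X_inj[of r z y] by blast
  then show False using assms(2) by simp
qed

lemma X_surj:
  assumes t: "t \<in> {0..T}"
  shows "\<exists>y. X t y = x"
proof -
  \<comment> \<open>By the backward estimate \<open>X t (- z)\<close> and \<open>X t z\<close> lie
    on either side of \<open>X t 0\<close> at distance at least \<open>exp (- L * T) * z\<close>;
    this \<open>z\<close> makes that exceed the distance of \<open>x\<close>.\<close>
  define z where "z = exp (L * T) * \<bar>x - X t 0\<bar> + 1"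
  have z: "z > 0" unfolding z_def by (auto intro: add_nonneg_pos)
  have up: "exp (L * T) * a \<le> exp (L * T) * \<bar>a\<bar>" for a by (intro mult_left_mono) auto
  have "z \<le> exp (L * T) * (X t z - X t 0)"
    using X_compare(2)[OF t, of z 0] z X_strict_mono[OF t z] by simp
  then have "exp (L * T) * (x - X t 0) \<le> exp (L * T) * (X t z - X t 0)"
    using up[of "x - X t 0"] unfolding z_def by linarith
  then have 1: "x \<le> X t z" by simp
  have "z \<le> exp (L * T) * (X t 0 - X t (- z))"
    using X_compare(2)[OF t, of "-z" 0] z X_strict_mono[OF t, of "-z" 0] by simp
  then have "exp (L * T) * (X t 0 - x) \<le> exp (L * T) * (X t 0 - X t (- z))"
    using up[of "X t 0 - x"] unfolding z_def abs_minus_commute[of "X t 0" x] by linarith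
  then have 2: "X t (- z) \<le> x" by simp
  have "continuous_on {-z..z} (\<lambda>y. X t y)"
    by (intro continuous_on_compose_Pair[OF X_cont] continuous_intros) (use t in auto)
  moreover have "- z \<le> z" using z by simp
  ultimately have "\<exists>y\<ge>- z. y \<le> z \<and> X t y = x" by (intro IVT' 1 2)
  then show ?thesis by blast
qed

text \<open>The label of the characteristic through (x, t), constant along characteristics. In the
  transport problem a negative label belongs to a curve of the extended field that is left of the
  strip at time 0.\<close>

definition Y :: "real \<Rightarrow> real \<Rightarrow> real" where
  "Y x t = (THE y. X t y = x)"

lemma X_Y [simp]: "t \<in> {0..T} \<Longrightarrow> X t (Y x t) = x"
proof -
  assume t: "t \<in> {0..T}"
  obtain y where "X t y = x" using X_surj[OF t] by blast
  then show ?thesis unfolding Y_def by (rule theI) (use X_inj[OF t] \<open>X t y = x\<close> in blast)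
qed

lemma Y_X [simp]:
  assumes "t \<in> {0..T}"
  shows "Y (X t y) t = y"
  by (rule X_inj[OF assms X_Y[OF assms]])

lemma Y_0 [simp]: "Y x 0 = x"
proof -
  have "Y (X 0 x) 0 = x" using T by (intro Y_X) simp
  then show ?thesis by simp
qed

lemma Y_lipschitz:
  assumes "t \<in> {0..T}"
  shows "\<bar>Y x t - Y z t\<bar> \<le> exp (L * T) * \<bar>x - z\<bar>"
  using X_compare(2)[OF assms, of "Y x t" "Y z t"] unfolding X_Y[OF assms] .

lemma Y_cont: "continuous_on ({0..T} \<times> UNIV) (\<lambda>(t, x). Y x t)"
proof (rule continuous_on_lipschitz_snd[where X = "\<lambda>t x. Y x t" and M = "exp (L * T)"])
  show "\<bar>Y y t - Y z t\<bar> \<le> exp (L * T) * \<bar>y - z\<bar>" if "t \<in> {0..T}" for t y z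
    using that by (rule Y_lipschitz)
  fix x
  show "continuous_on {0..T} (\<lambda>t. Y x t)"
    unfolding continuous_on_def
  proof
    fix s assume s: "s \<in> {0..T}"
    \<comment> \<open>The difference of the labels is controlled by the distance at time t of the
      two curves, which are at x and at \<open>X t (Y x s)\<close>; the latter is continuous in
      t.\<close>
    have "((\<lambda>t. Y x t - Y x s) \<longlongrightarrow> 0) (at s within {0..T})"
    proof (rule Lim_null_comparison)
      show "\<forall>\<^sub>F t in at s within {0..T}. norm (Y x t - Y x s) \<le> exp (L * T) * \<bar>x - X t (Y x s)\<bar>"
      proof -
        have "norm (Y x t - Y x s) \<le> exp (L * T) * \<bar>x - X t (Y x s)\<bar>" if "t \<in> {0..T}" for t
          using X_compare(2)[OF that, of "Y x t" "Y x s"] X_Y[OF that, of x] by simp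
        then show ?thesis unfolding eventually_at_filter by (intro always_eventually) blast
      qed
      have "((\<lambda>t. exp (L * T) * \<bar>x - X t (Y x s)\<bar>) \<longlongrightarrow> exp (L * T) * \<bar>x - X s (Y x s)\<bar>) (at s within {0..T})"
      proof -
        have "((\<lambda>t. X t (Y x s)) \<longlongrightarrow> X s (Y x s)) (at s within {0..T})"
          using X_cont_t[of "Y x s"] s by (simp only: continuous_on_def)
        then show ?thesis by (intro tendsto_intros)
      qed
      then show "((\<lambda>t. exp (L * T) * \<bar>x - X t (Y x s)\<bar>) \<longlongrightarrow> 0) (at s within {0..T})"
        by (simp only: X_Y[OF s] diff_self abs_zero mult_zero_right)
    qed
    then show "((\<lambda>t. Y x t) \<longlongrightarrow> Y x s) (at s within {0..T})"
      by (rule LIM_zero_cancel)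
  qed
qed

text \<open>The derivative of \<open>X t\<close> in y: the explicit solution of the variational
  equation \<open>E' = m * E\<close> with value 1 at time 0. The exponential makes it positive at
  sight.\<close>

definition E :: "real \<Rightarrow> real \<Rightarrow> real" where
  "E t y = exp (integral {0..t} (\<lambda>r. m (X r y) r))"

lemma mX_cont: "continuous_on ({0..T} \<times> UNIV) (\<lambda>(r, y). m (X r y) r)"
  unfolding case_prod_unfold
  by (intro continuous_on_compose_Pair[OF m_cont] continuous_on_compose_Pair[OF X_cont] continuous_intros) auto

lemma lX_cont: "continuous_on ({0..T} \<times> UNIV) (\<lambda>(r, y). l (X r y) r)"
  unfolding case_prod_unfold
  by (intro continuous_on_compose_Pair[OF l_cont] continuous_on_compose_Pair[OF X_cont] continuous_intros) auto

lemma mX_cont_t: "continuous_on {0..T} (\<lambda>r. m (X r y) r)"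
  by (intro continuous_on_compose_Pair[OF mX_cont] continuous_intros) auto

lemma E_cont: "continuous_on ({0..T} \<times> UNIV) (\<lambda>(t, y). E t y)"
proof -
  have "continuous_on ({0..T} \<times> UNIV) (\<lambda>p. exp (case p of (t, y) \<Rightarrow> integral {0..t} (\<lambda>r. m (X r y) r)))"
    by (intro continuous_on_exp continuous_on_integral_upto mX_cont)
  then show ?thesis unfolding E_def by (simp add: case_prod_unfold)
qed

lemma E_pos [simp]: "E t y > 0"
  and E_nonzero [simp]: "E t y \<noteq> 0"
  and E_0 [simp]: "E 0 y = 1"
  by (simp_all add: E_def)

lemma E_deriv_t:
  assumes "t \<in> {0..T}"
  shows "((\<lambda>t. E t y) has_real_derivative E t y * m (X t y) t) (at t within {0..T})"
  unfolding E_def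
  by (rule DERIV_chain2[OF DERIV_exp has_real_derivative_integral_upto[OF mX_cont_t assms]])

text \<open>The difference quotient \<open>q \<eta>\<close> is positive by strict monotonicity, and
  the mean value theorem in x gives it the time derivative
  \<open>m (\<zeta> r) r * q \<eta> r\<close>, with \<zeta> no farther from the first curve than the
  second one is. Hence the derivative of \<open>ln (q \<eta>)\<close> is \<open>m\<close> at
  \<zeta>, which tends to \<open>m\<close> along the first curve uniformly in time as \<eta> tends
  to 0.\<close>

lemma X_deriv_y:
  assumes t: "t \<in> {0..T}"
  shows "((\<lambda>y. X t y) has_real_derivative E t y) (at y)"
proof -
  define I where "I s = integral {0..s} (\<lambda>r. m (X r y) r)" for s
  define q where "q \<eta> s = (X s (y + \<eta>) - X s y) / \<eta>" for \<eta> s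
  have q_pos: "q \<eta> s > 0" if "\<eta> \<noteq> 0" "s \<in> {0..T}" for \<eta> s
  proof (cases "\<eta> > 0")
    case True
    then show ?thesis using X_strict_mono[OF that(2), of y "y + \<eta>"] by (simp add: q_def)
  next
    case False
    then show ?thesis using X_strict_mono[OF that(2), of "y + \<eta>" y] that(1)
      by (auto simp: q_def intro!: divide_neg_neg)
  qed
  have sub: "{0..t} \<subseteq> {0..T}" using t by auto
  have "((\<lambda>\<eta>. ln (q \<eta> t)) \<longlongrightarrow> I t) (at 0)"
  proof (rule tendstoI)
    fix e :: real assume e: "e > 0"
    obtain R where R: "\<And>r. r \<in> {0..T} \<Longrightarrow> \<bar>X r y\<bar> \<le> R"
      using compact_imp_bounded[OF compact_continuous_image[OF X_cont_t[of y]]]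
      unfolding bounded_iff real_norm_def by blast
    have "compact ({-R-1..R+1} \<times> {0..T})" by (intro compact_Times) auto
    then have uc: "uniformly_continuous_on ({-R-1..R+1} \<times> {0..T}) (\<lambda>(x, t). m x t)"
      by (intro compact_uniformly_continuous continuous_on_subset[OF m_cont]) auto
    define e' where "e' = e / (T + 1)"
    have e': "e' > 0" using e T by (simp add: e'_def)
    obtain d where d: "d > 0"
      and dm: "\<And>p q. p \<in> {-R-1..R+1} \<times> {0..T} \<Longrightarrow> q \<in> {-R-1..R+1} \<times> {0..T} \<Longrightarrow> dist p q < d \<Longrightarrow>
        dist (case p of (x, t) \<Rightarrow> m x t) (case q of (x, t) \<Rightarrow> m x t) < e'"
      using uc e' unfolding uniformly_continuous_on_def by metis
    \<comment> \<open>For |\<eta>| < \<delta> the two curves stay closer than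
      \<open>min d 1\<close>: the 1 keeps \<zeta> in the enlarged compact set on which
      \<open>m\<close> is uniformly continuous, and \<open>d\<close> is the modulus there.\<close>
    define \<delta> where "\<delta> = min d 1 / exp (L * T)"
    have \<delta>: "\<delta> > 0" using d by (simp add: \<delta>_def)
    have "dist (ln (q \<eta> t)) (I t) < e" if \<eta>: "\<eta> \<noteq> 0" "dist \<eta> 0 < \<delta>" for \<eta>
    proof -
      have "\<exists>\<zeta>. \<bar>\<zeta> - X r y\<bar> \<le> \<bar>X r (y + \<eta>) - X r y\<bar> \<and>
           l (X r (y + \<eta>)) r - l (X r y) r = m \<zeta> r * (X r (y + \<eta>) - X r y)" if "r \<in> {0..T}" for r
        using l_diff[OF that] .
      then obtain \<zeta> where \<zeta>1: "\<And>r. r \<in> {0..T} \<Longrightarrow> \<bar>\<zeta> r - X r y\<bar> \<le> \<bar>X r (y + \<eta>) - X r y\<bar>"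
        and \<zeta>2: "\<And>r. r \<in> {0..T} \<Longrightarrow>
          l (X r (y + \<eta>)) r - l (X r y) r = m (\<zeta> r) r * (X r (y + \<eta>) - X r y)"
        by metis
      have close: "\<bar>m (\<zeta> r) r - m (X r y) r\<bar> < e'" if r: "r \<in> {0..T}" for r
      proof -
        have "\<bar>\<zeta> r - X r y\<bar> \<le> exp (L * T) * \<bar>\<eta>\<bar>"
          using \<zeta>1[OF r] X_compare(1)[OF r, of "y + \<eta>" y] by simp
        also have "\<dots> < exp (L * T) * \<delta>" using \<eta> by (intro mult_strict_left_mono) auto
        also have "\<dots> = min d 1" by (simp add: \<delta>_def)
        finally have *: "\<bar>\<zeta> r - X r y\<bar> < d" "\<bar>\<zeta> r - X r y\<bar> < 1" by auto
        have "dist (\<zeta> r, r) (X r y, r) < d" using * by (simp add: dist_Pair_Pair dist_real_def)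
        moreover have "\<zeta> r \<in> {-R-1..R+1}" "X r y \<in> {-R-1..R+1}" using R[OF r] *(2) by auto
        ultimately show ?thesis using dm[of "(\<zeta> r, r)" "(X r y, r)"] r by (simp add: dist_real_def)
      qed
      define H where "H s = ln (q \<eta> s) - I s" for s
      have qD: "(q \<eta> has_real_derivative m (\<zeta> r) r * q \<eta> r) (at r within {0..T})" if r: "r \<in> {0..T}" for r
        unfolding q_def
        by (rule DERIV_cong[OF DERIV_cdivide[OF DERIV_diff[OF X_deriv[OF r] X_deriv[OF r]]]])
          (simp add: \<zeta>2[OF r])
      \<comment> \<open>\<zeta> comes from a choice and has no regularity in r, so \<open>H\<close>
        is estimated by the mean value theorem and not by integrating its derivative.\<close>
      have "\<exists>r\<in>{0..t}. H t - H 0 = (m (\<zeta> r) r - m (X r y) r) * (t - 0)"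
      proof (rule mvt_very_simple)
        fix r assume r: "0 \<le> r" "r \<le> t"
        have r': "r \<in> {0..T}" using r t by auto
        have "((\<lambda>s. ln (q \<eta> s)) has_real_derivative 1 / q \<eta> r * (m (\<zeta> r) r * q \<eta> r)) (at r within {0..t})"
          by (rule DERIV_chain2[OF DERIV_ln_divide[OF q_pos[OF \<eta>(1) r']] DERIV_subset[OF qD[OF r'] sub]])
        moreover have "(I has_real_derivative m (X r y) r) (at r within {0..t})"
          unfolding I_def by (rule DERIV_subset[OF has_real_derivative_integral_upto[OF mX_cont_t r'] sub])
        ultimately have "(H has_real_derivative 1 / q \<eta> r * (m (\<zeta> r) r * q \<eta> r) - m (X r y) r) (at r within {0..t})"
          unfolding H_def by (rule DERIV_diff)
        then show "(H has_derivative (*) (m (\<zeta> r) r - m (X r y) r)) (at r within {0..t})"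
          using q_pos[OF \<eta>(1) r'] by (simp add: has_field_derivative_def)
      qed (use t in auto)
      then obtain r where r: "r \<in> {0..t}" "H t - H 0 = (m (\<zeta> r) r - m (X r y) r) * t" by auto
      have "q \<eta> 0 = 1" using \<eta> by (simp add: q_def)
      then have "H 0 = 0" by (simp add: H_def I_def)
      then have "\<bar>H t\<bar> = \<bar>m (\<zeta> r) r - m (X r y) r\<bar> * t" using r t by (simp add: abs_mult)
      also have "\<dots> \<le> e' * T" using close[of r] r t T by (intro mult_mono) auto
      also have "\<dots> < e" using e T by (simp add: e'_def field_simps)
      finally show ?thesis by (simp add: H_def dist_real_def)
    qed
    then show "\<forall>\<^sub>F \<eta> in at 0. dist (ln (q \<eta> t)) (I t) < e"
      unfolding eventually_at using \<delta> by blast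
  qed
  then have "((\<lambda>\<eta>. exp (ln (q \<eta> t))) \<longlongrightarrow> E t y) (at 0)"
    unfolding E_def I_def by (rule tendsto_exp)
  then have "((\<lambda>\<eta>. q \<eta> t) \<longlongrightarrow> E t y) (at 0)"
    by (rule Lim_transform_eventually) (use q_pos t in \<open>auto simp: eventually_at_filter\<close>)
  then show ?thesis by (simp add: DERIV_def q_def)
qed

lemma Y_cont_x: "t \<in> {0..T} \<Longrightarrow> continuous_on UNIV (\<lambda>x. Y x t)"
  by (intro continuous_on_compose_Pair[OF Y_cont] continuous_intros) auto

lemma Y_cont_t: "continuous_on {0..T} (\<lambda>t. Y x t)"
  by (intro continuous_on_compose_Pair[OF Y_cont] continuous_intros) auto

lemma Y_deriv_x:
  assumes t: "t \<in> {0..T}"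
  shows "((\<lambda>x. Y x t) has_real_derivative inverse (E t (Y x t))) (at x)"
proof (rule DERIV_inverse_function[where f = "X t" and a = "x - 1" and b = "x + 1"])
  show "(X t has_real_derivative E t (Y x t)) (at (Y x t))" by (rule X_deriv_y[OF t])
  show "isCont (\<lambda>x. Y x t) x"
    using Y_cont_x[OF t] by (simp add: continuous_on_eq_continuous_at)
qed (use t in auto)

text \<open>\<open>\<kappa> t\<close> is the position at the fixed time s of the characteristic
  through (x, t). Then \<open>Y x t = Y (\<kappa> t) s\<close>, so the chain rule takes only the
  x-derivative of \<open>Y\<close> at time s and the derivative of \<kappa> at s, which the mean
  value theorem along the curves gives as \<open>- l x s\<close>.\<close>

lemma Y_deriv_t:
  assumes s: "s \<in> {0..T}"
  shows "((\<lambda>t. Y x t) has_real_derivative - l x s / E s (Y x s)) (at s within {0..T})"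
proof -
  let ?F = "at s within {0..T}"
  define \<kappa> where "\<kappa> t = X s (Y x t)" for t
  have "(\<kappa> has_real_derivative - l x s) ?F"
    unfolding has_field_derivative_iff
  proof -
    have "\<exists>r. \<bar>r - s\<bar> \<le> \<bar>t - s\<bar> \<and> r \<in> {0..T} \<and> \<kappa> t - x = - (l (X r (Y x t)) r * (t - s))"
      if t: "t \<in> {0..T}" for t
    proof (cases "s \<le> t")
      case True
      have "\<exists>r\<in>{s..t}. X t (Y x t) - X s (Y x t) = l (X r (Y x t)) r * (t - s)"
      proof (rule mvt_very_simple[OF True])
        fix r assume "s \<le> r" "r \<le> t"
        then show "((\<lambda>t'. X t' (Y x t)) has_derivative (*) (l (X r (Y x t)) r)) (at r within {s..t})"
          using DERIV_subset[OF X_deriv[of r "Y x t"], of "{s..t}"] s t by (simp add: has_field_derivative_def)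
      qed
      then obtain r where "r \<in> {s..t}" "x - \<kappa> t = l (X r (Y x t)) r * (t - s)"
        using X_Y[OF t] by (auto simp: \<kappa>_def)
      then show ?thesis using s t by (intro exI[of _ r]) auto
    next
      case False
      have "\<exists>r\<in>{t..s}. X s (Y x t) - X t (Y x t) = l (X r (Y x t)) r * (s - t)"
      proof (rule mvt_very_simple)
        fix r assume "t \<le> r" "r \<le> s"
        then show "((\<lambda>t'. X t' (Y x t)) has_derivative (*) (l (X r (Y x t)) r)) (at r within {t..s})"
          using DERIV_subset[OF X_deriv[of r "Y x t"], of "{t..s}"] s t by (simp add: has_field_derivative_def)
      qed (use False in auto)
      then obtain r where "r \<in> {t..s}" "\<kappa> t - x = l (X r (Y x t)) r * (s - t)"
        using X_Y[OF t] by (auto simp: \<kappa>_def)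
      then show ?thesis using s t False by (intro exI[of _ r]) (auto simp: algebra_simps)
    qed
    then obtain r where r1: "\<And>t. t \<in> {0..T} \<Longrightarrow> \<bar>r t - s\<bar> \<le> \<bar>t - s\<bar>"
      and r2: "\<And>t. t \<in> {0..T} \<Longrightarrow> r t \<in> {0..T}"
      and r3: "\<And>t. t \<in> {0..T} \<Longrightarrow> \<kappa> t - x = - (l (X (r t) (Y x t)) (r t) * (t - s))"
      by metis
    have ev: "\<forall>\<^sub>F t in ?F. t \<in> {0..T} \<and> t \<noteq> s"
      by (simp add: eventually_at_filter)
    have "((\<lambda>t. r t - s) \<longlongrightarrow> 0) ?F"
    proof (rule Lim_null_comparison)
      show "\<forall>\<^sub>F t in ?F. norm (r t - s) \<le> \<bar>t - s\<bar>"
        using ev by eventually_elim (use r1 in auto)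
      have "((\<lambda>t. \<bar>t - s\<bar>) \<longlongrightarrow> \<bar>s - s\<bar>) ?F" by (intro tendsto_intros)
      then show "((\<lambda>t. \<bar>t - s\<bar>) \<longlongrightarrow> 0) ?F" by simp
    qed
    then have rl: "(r \<longlongrightarrow> s) ?F" by (rule LIM_zero_cancel)
    have Yl: "((\<lambda>t. Y x t) \<longlongrightarrow> Y x s) ?F"
      using Y_cont_t[of x] s by (simp add: continuous_on_def)
    have "((\<lambda>t. (\<lambda>(t, y). l (X t y) t) (r t, Y x t)) \<longlongrightarrow> (\<lambda>(t, y). l (X t y) t) (s, Y x s)) ?F"
    proof (rule continuous_on_tendsto_compose[OF lX_cont])
      show "((\<lambda>t. (r t, Y x t)) \<longlongrightarrow> (s, Y x s)) ?F" by (intro tendsto_Pair rl Yl)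
      show "\<forall>\<^sub>F t in ?F. (r t, Y x t) \<in> {0..T} \<times> UNIV"
        using ev by eventually_elim (use r2 in auto)
    qed (use s in auto)
    then have "((\<lambda>t. - l (X (r t) (Y x t)) (r t)) \<longlongrightarrow> - l x s) ?F"
      using X_Y[OF s] by (intro tendsto_minus) simp
    then show "((\<lambda>t. (\<kappa> t - \<kappa> s) / (t - s)) \<longlongrightarrow> - l x s) ?F"
    proof (rule Lim_transform_eventually)
      show "\<forall>\<^sub>F t in ?F. - l (X (r t) (Y x t)) (r t) = (\<kappa> t - \<kappa> s) / (t - s)"
        using ev
      proof eventually_elim
        case (elim t)
        have "\<kappa> s = x" using X_Y[OF s] by (simp add: \<kappa>_def)
        then show ?case using r3[of t] elim by (simp add: field_simps)
      qed
    qed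
  qed
  moreover have "((\<lambda>z. Y z s) has_real_derivative inverse (E s (Y x s))) (at (\<kappa> s))"
    using Y_deriv_x[OF s, of x] X_Y[OF s] by (simp add: \<kappa>_def)
  ultimately have "((\<lambda>t. Y (\<kappa> t) s) has_real_derivative inverse (E s (Y x s)) * (- l x s)) ?F"
    by (rule DERIV_chain2[rotated])
  then show ?thesis using s by (simp add: \<kappa>_def divide_inverse mult.commute)
qed

text \<open>Passage from labels to positions. Along a characteristic the label is fixed and only
  \<open>G\<close> acts, so \<open>U t (Y x t)\<close> satisfies the transport equation with source
  \<open>G\<close>.\<close>

lemma push_forward:
  assumes Ut: "\<And>t y. t \<in> {0..T} \<Longrightarrow> ((\<lambda>t. U t y) has_real_derivative G t y) (at t within {0..T})"
    and Uy: "\<And>t y. t \<in> {0..T} \<Longrightarrow> ((\<lambda>y. U t y) has_real_derivative V t y) (at y)"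
    and V_cont: "continuous_on ({0..T} \<times> UNIV) (\<lambda>(t, y). V t y)"
    and t: "t \<in> {0..T}"
  shows "((\<lambda>x. U t (Y x t)) has_real_derivative V t (Y x t) / E t (Y x t)) (at x)"
    and "((\<lambda>t. U t (Y x t)) has_real_derivative G t (Y x t) - l x t * (V t (Y x t) / E t (Y x t)))
          (at t within {0..T})"
proof -
  show "((\<lambda>x. U t (Y x t)) has_real_derivative V t (Y x t) / E t (Y x t)) (at x)"
    using DERIV_chain2[OF Uy[OF t] Y_deriv_x[OF t]] by (simp add: divide_inverse)
  have "((\<lambda>t. U t (Y x t)) has_real_derivative G t (Y x t) * 1 + V t (Y x t) * (- l x t / E t (Y x t)))
          (at t within {0..T})"
    by (rule has_real_derivative_compose_partials[where w = U and A = "{0..T}" and B = UNIV])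
      (use Ut Uy V_cont Y_deriv_t[OF t] t in auto)
  then show "((\<lambda>t. U t (Y x t)) has_real_derivative G t (Y x t) - l x t * (V t (Y x t) / E t (Y x t)))
          (at t within {0..T})" by (simp add: mult.commute)
qed

end

section \<open>The scalar transport equation\<close>

lemma has_real_derivative_glue_functions:
  fixes f g :: "real \<Rightarrow> real"
  assumes f: "\<And>y. (f has_real_derivative f' y) (at y)"
    and g: "\<And>y. (g has_real_derivative g' y) (at y)"
    and eq: "f c = g c" "f' c = g' c"
  shows "((\<lambda>y. if y \<le> c then f y else g y) has_real_derivative (if y \<le> c then f' y else g' y)) (at y)"
proof -
  let ?h = "\<lambda>y. if y \<le> c then f y else g y"
  consider "y < c" | "y = c" | "y > c" by linarith
  then show ?thesis
  proof cases
    case 1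
    have "(?h has_real_derivative f' y) (at y)"
      by (rule has_field_derivative_transform_within_open[OF f, of "{..<c}"]) (use 1 in auto)
    then show ?thesis using 1 by simp
  next
    case 2
    have "(?h has_real_derivative f' c) (at c within {..c})"
      by (rule has_field_derivative_transform_within[OF has_field_derivative_at_within[OF f], of 1]) auto
    moreover have "(?h has_real_derivative f' c) (at c within {c..})"
      unfolding eq(2)
      by (rule has_field_derivative_transform_within[OF has_field_derivative_at_within[OF g], of 1])
        (use eq in auto)
    ultimately show ?thesis using 2 by (simp add: has_real_derivative_glue)
  next
    case 3
    have "(?h has_real_derivative g' y) (at y)"
      by (rule has_field_derivative_transform_within_open[OF g, of "{c<..}"]) (use 3 in auto)
    then show ?thesis using 3 by simp
  qed
qed

text \<open>Applied to \<open>a t = Y 0 t\<close>, whose inverse assigns to a label its time of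
  entry at x = 0. Extending \<open>a\<close> by tangent lines makes the inverse a C1 function on the
  whole line, so no one-sided derivative occurs at the label 0.\<close>

lemma decreasing_inverse_exists:
  fixes a a' :: "real \<Rightarrow> real"
  assumes T: "0 < T"
    and a: "\<And>t. t \<in> {0..T} \<Longrightarrow> (a has_real_derivative a' t) (at t within {0..T})"
    and neg: "\<And>t. t \<in> {0..T} \<Longrightarrow> a' t < 0"
  shows "\<exists>b. (\<forall>t\<in>{0..T}. b (a t) = t) \<and>
           (\<forall>y. (b has_real_derivative 1 / a' (clip 0 T (b y))) (at y))"
proof -
  define A where "A = lin_ext 0 T a a'"
  have A: "(A has_real_derivative a' (clip 0 T t)) (at t)" for t
    unfolding A_def by (rule has_real_derivative_lin_ext[OF T a])
  have neg': "a' (clip 0 T t) < 0" for t using neg T by simp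
  have dec: "A s > A t" if "s < t" for s t
    by (rule DERIV_neg_imp_decreasing[OF that]) (use A neg' in blast)
  have inj: "A s = A t \<Longrightarrow> s = t" for s t
    using dec[of s t] dec[of t s] by (cases s t rule: linorder_cases) auto
  have A_cont: "isCont A t" for t using A by (rule DERIV_isCont)
  have surj: "\<exists>t. A t = y" for y
  proof -
    consider "y \<ge> a 0" | "y \<le> a T" | "a T < y" "y < a 0" by linarith
    then show ?thesis
    proof cases
      case 1
      have "(y - a 0) / a' 0 \<le> 0" using 1 neg[of 0] T by (simp add: divide_nonneg_neg)
      then have "A ((y - a 0) / a' 0) = y"
        using neg[of 0] T by (simp add: A_def lin_ext_def clip_def)
      then show ?thesis by blast
    next
      case 2
      have "(y - a T) / a' T \<ge> 0" using 2 neg[of T] T by (simp add: divide_nonpos_neg)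
      then have "A (T + (y - a T) / a' T) = y"
        using neg[of T] T by (simp add: A_def lin_ext_def clip_def)
      then show ?thesis by blast
    next
      case 3
      have "\<exists>t\<ge>0. t \<le> T \<and> A t = y"
        by (rule IVT2') (use 3 T A_cont in \<open>auto simp: A_def intro: continuous_at_imp_continuous_on\<close>)
      then show ?thesis by blast
    qed
  qed
  obtain b where b: "\<And>y. A (b y) = y" using surj by metis
  have bA: "b (A t) = t" for t using inj[OF b] .
  have b_cont: "isCont b y" for y
  proof -
    have "isCont b (A (b y))"
      by (rule isCont_inverse_function[of 1]) (simp_all add: bA A_cont)
    then show ?thesis by (simp add: b)
  qed
  have "(b has_real_derivative 1 / a' (clip 0 T (b y))) (at y)" for y
  proof -
    have "(b has_real_derivative inverse (a' (clip 0 T (b y)))) (at y)"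
      by (rule DERIV_inverse_function[where f = A and a = "y - 1" and b = "y + 1"])
        (use A neg'[of "b y"] b b_cont in auto)
    then show ?thesis by (simp add: inverse_eq_divide)
  qed
  moreover have "b (a t) = t" if "t \<in> {0..T}" for t
    using bA[of t] that by (simp add: A_def)
  ultimately show ?thesis by blast
qed

section \<open>Transport on the whole line\<close>

context scalar_flow begin

text \<open>The last clause is the x-differentiated equation. It is stated along integral curves:
  there the label is fixed, and \<open>p = V / E\<close> is differentiable because \<open>V\<close>
  and \<open>E\<close> depend on time through integrals only.\<close>

lemma transport_on_line:
  fixes g gx :: "real \<Rightarrow> real \<Rightarrow> real" and \<phi> \<phi>' \<beta> \<beta>' :: "real \<Rightarrow> real"
  assumes pos: "\<And>t. t \<in> {0..T} \<Longrightarrow> l 0 t > 0"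
    and g_cont: "continuous_on (UNIV \<times> {0..T}) (\<lambda>(x, t). g x t)"
    and gx_cont: "continuous_on (UNIV \<times> {0..T}) (\<lambda>(x, t). gx x t)"
    and g_deriv: "\<And>x t. t \<in> {0..T} \<Longrightarrow> ((\<lambda>x. g x t) has_real_derivative gx x t) (at x)"
    and \<phi>: "\<And>x. (\<phi> has_real_derivative \<phi>' x) (at x)"
    and \<phi>'_cont: "continuous_on UNIV \<phi>'"
    and \<beta>: "\<And>t. t \<in> {0..T} \<Longrightarrow> (\<beta> has_real_derivative \<beta>' t) (at t within {0..T})"
    and \<beta>'_cont: "continuous_on {0..T} \<beta>'"
    and compat: "\<phi> 0 = \<beta> 0" "\<beta>' 0 = g 0 0 - l 0 0 * \<phi>' 0"
  shows "\<exists>u p. continuous_on (UNIV \<times> {0..T}) (\<lambda>(x, t). p x t) \<and>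
     (\<forall>x. \<forall>t\<in>{0..T}. ((\<lambda>x. u x t) has_real_derivative p x t) (at x)) \<and>
     (\<forall>x. \<forall>t\<in>{0..T}. ((\<lambda>t. u x t) has_real_derivative g x t - l x t * p x t) (at t within {0..T})) \<and>
     (\<forall>x\<ge>0. u x 0 = \<phi> x) \<and> (\<forall>t\<in>{0..T}. u 0 t = \<beta> t) \<and>
     (\<forall>\<xi> s t r. 0 \<le> s \<longrightarrow> t \<le> T \<longrightarrow> solves l \<xi> s t \<longrightarrow> r \<in> {s..t} \<longrightarrow>
        ((\<lambda>r. p (\<xi> r) r) has_real_derivative gx (\<xi> r) r - m (\<xi> r) r * p (\<xi> r) r) (at r within {s..t}))"
proof -
  have gX_cont: "continuous_on ({0..T} \<times> UNIV) (\<lambda>(r, y). g (X r y) r)"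
    unfolding case_prod_unfold
    by (intro continuous_on_compose_Pair[OF g_cont] continuous_on_compose_Pair[OF X_cont] continuous_intros) auto
  have hX_cont: "continuous_on ({0..T} \<times> UNIV) (\<lambda>(r, y). gx (X r y) r * E r y)"
    unfolding case_prod_unfold
    by (intro continuous_on_mult continuous_on_compose_Pair[OF gx_cont] continuous_on_compose_Pair[OF X_cont]
        continuous_on_compose_Pair[OF E_cont] continuous_intros) auto
  have gX_cont_t: "continuous_on {0..T} (\<lambda>r. g (X r y) r)" for y
    by (intro continuous_on_compose_Pair[OF gX_cont] continuous_intros) auto
  have hX_cont_t: "continuous_on {0..T} (\<lambda>r. gx (X r y) r * E r y)" for y
    by (intro continuous_on_compose_Pair[OF hX_cont] continuous_intros) auto
  \<comment> \<open>The integral starts at time 0 for every label. For a negative label this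
    includes the time before entry, where the extended source is used; \<Psi> compensates for that
    contribution.\<close>
  define U1 where "U1 t y = integral {0..t} (\<lambda>r. g (X r y) r)" for t y
  define V1 where "V1 t y = integral {0..t} (\<lambda>r. gx (X r y) r * E r y)" for t y
  have U1t: "((\<lambda>t. U1 t y) has_real_derivative g (X t y) t) (at t within {0..T})" if "t \<in> {0..T}" for t y
    unfolding U1_def by (rule has_real_derivative_integral_upto[OF gX_cont_t that])
  have V1t: "((\<lambda>t. V1 t y) has_real_derivative gx (X t y) t * E t y) (at t within {0..T})" if "t \<in> {0..T}" for t y
    unfolding V1_def by (rule has_real_derivative_integral_upto[OF hX_cont_t that])
  have U1y: "((\<lambda>y. U1 t y) has_real_derivative V1 t y) (at y)" if t: "t \<in> {0..T}" for t y
  proof -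
    have "((\<lambda>y. integral (cbox 0 t) (\<lambda>r. g (X r y) r)) has_field_derivative
         integral (cbox 0 t) (\<lambda>r. gx (X r y) r * E r y)) (at y within UNIV)"
    proof (rule leibniz_rule_field_derivative)
      show "((\<lambda>y. g (X r y) r) has_field_derivative gx (X r y) r * E r y) (at y within UNIV)"
        if "r \<in> cbox 0 t" for y r
        using that t by (intro DERIV_chain2[OF g_deriv X_deriv_y]) auto
      show "(\<lambda>r. g (X r y) r) integrable_on cbox 0 t" for y
        using t by (auto intro!: integrable_continuous_real continuous_on_subset[OF gX_cont_t])
      show "continuous_on (UNIV \<times> cbox 0 t) (\<lambda>(y, r). gx (X r y) r * E r y)"
        unfolding case_prod_unfold
        using t by (intro continuous_on_compose_Pair[OF hX_cont] continuous_intros) auto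
    qed auto
    then show ?thesis by (simp add: U1_def V1_def)
  qed
  have V1_cont: "continuous_on ({0..T} \<times> UNIV) (\<lambda>(t, y). V1 t y)"
    unfolding V1_def by (rule continuous_on_integral_upto[OF hX_cont])
  have V1_0: "V1 0 y = 0" and U1_0: "U1 0 y = 0" for y by (simp_all add: V1_def U1_def)
  \<comment> \<open>The label of the curve that enters at time t; it decreases because the speed at
    x = 0 is positive.\<close>
  define a where "a t = Y 0 t" for t
  define a' where "a' t = - l 0 t / E t (a t)" for t
  have a: "(a has_real_derivative a' t) (at t within {0..T})" if "t \<in> {0..T}" for t
    unfolding a_def a'_def by (rule Y_deriv_t[OF that])
  have a'_neg: "a' t < 0" if "t \<in> {0..T}" for t
    using pos[OF that] by (simp add: a'_def)
  have a'_cont: "continuous_on {0..T} a'"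
    unfolding a'_def a_def
    by (intro continuous_on_divide continuous_on_minus continuous_on_compose_Pair[OF l_cont]
        continuous_on_compose_Pair[OF E_cont] continuous_on_compose_Pair[OF Y_cont] continuous_intros) auto
  have a0: "a 0 = 0" by (simp add: a_def)
  have a_nonpos: "a t \<le> 0" if t: "t \<in> {0..T}" for t
  proof -
    have "- a 0 \<le> - a t"
    proof (rule nondecreasing_if_derivative_nonneg[where F = "\<lambda>t. - a t" and F' = "\<lambda>t. - a' t"])
      show "((\<lambda>t. - a t) has_real_derivative - a' r) (at r within {0..t})" if "r \<in> {0..t}" for r
        using that t by (intro DERIV_minus DERIV_subset[OF a]) auto
      show "0 \<le> - a' r" if "r \<in> {0..t}" for r using a'_neg[of r] that t by auto
    qed (use t in auto)
    then show ?thesis by (simp add: a0)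
  qed
  define Jx where "Jx t = V1 t (a t) / E t (a t)" for t
  have Jt: "((\<lambda>t. U1 t (a t)) has_real_derivative g 0 t - l 0 t * Jx t) (at t within {0..T})"
    if "t \<in> {0..T}" for t
    using push_forward(2)[of U1 "\<lambda>t y. g (X t y) t" V1, OF U1t U1y V1_cont that] X_Y[OF that]
    by (simp add: a_def Jx_def)
  have Jx_cont: "continuous_on {0..T} Jx"
    unfolding Jx_def a_def
    by (intro continuous_on_divide continuous_on_compose_Pair[OF V1_cont]
        continuous_on_compose_Pair[OF E_cont] continuous_on_compose_Pair[OF Y_cont] continuous_intros) auto
  \<comment> \<open>What the label part has to add to \<open>U1\<close> at x = 0 in order to attain
    the datum \<beta>. The function \<Psi> is fixed by
    \<open>\<Psi> (a t) = \<gamma> t\<close>.\<close>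
  define \<gamma> where "\<gamma> t = \<beta> t - U1 t (a t)" for t
  define \<gamma>' where "\<gamma>' t = \<beta>' t - (g 0 t - l 0 t * Jx t)" for t
  have \<gamma>: "(\<gamma> has_real_derivative \<gamma>' t) (at t within {0..T})" if "t \<in> {0..T}" for t
    unfolding \<gamma>_def \<gamma>'_def by (intro DERIV_diff \<beta> Jt that)
  have \<gamma>'_cont: "continuous_on {0..T} \<gamma>'"
    unfolding \<gamma>'_def
    by (intro continuous_on_diff continuous_on_mult \<beta>'_cont Jx_cont continuous_on_compose_Pair[OF g_cont]
        continuous_on_compose_Pair[OF l_cont] continuous_intros) auto
  obtain b where ba: "\<And>t. t \<in> {0..T} \<Longrightarrow> b (a t) = t"
    and b: "\<And>y. (b has_real_derivative 1 / a' (clip 0 T (b y))) (at y)"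
    using decreasing_inverse_exists[of T a a', OF T a a'_neg] by blast
  have b_cont: "continuous_on UNIV b"
    using DERIV_isCont[OF b] by (simp add: continuous_on_eq_continuous_at)
  define \<Psi> where "\<Psi> y = lin_ext 0 T \<gamma> \<gamma>' (b y)" for y
  define \<Psi>' where "\<Psi>' y = \<gamma>' (clip 0 T (b y)) * (1 / a' (clip 0 T (b y)))" for y
  have \<Psi>: "(\<Psi> has_real_derivative \<Psi>' y) (at y)" for y
    unfolding \<Psi>_def \<Psi>'_def by (rule DERIV_chain2[OF has_real_derivative_lin_ext[OF T \<gamma>] b])
  have \<Psi>'_cont: "continuous_on UNIV \<Psi>'"
    unfolding \<Psi>'_def
  proof (intro continuous_on_mult continuous_on_divide continuous_on_const)
    show "continuous_on UNIV (\<lambda>y. \<gamma>' (clip 0 T (b y)))"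
      using T by (intro continuous_on_compose2[OF \<gamma>'_cont continuous_on_clip[OF b_cont]]) auto
    show "continuous_on UNIV (\<lambda>y. a' (clip 0 T (b y)))"
      using T by (intro continuous_on_compose2[OF a'_cont continuous_on_clip[OF b_cont]]) auto
    have "a' (clip 0 T (b y)) < 0" for y using a'_neg T by simp
    then show "\<forall>y\<in>UNIV. a' (clip 0 T (b y)) \<noteq> 0" by (metis less_irrefl)
  qed
  have b0: "b 0 = 0" using ba[of 0] T by (simp add: a0)
  have \<Psi>0: "\<Psi> 0 = \<phi> 0" using T by (simp add: \<Psi>_def b0 \<gamma>_def U1_0 compat)
  \<comment> \<open>At time 0 the quotient \<open>\<gamma>' / a'\<close> is
    \<open>(g - \<beta>') / l\<close>, since \<open>V1\<close> vanishes and \<open>E\<close> is 1.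
    First-order compatibility says that this is \<open>\<phi>' 0\<close>.\<close>
  have \<Psi>'0: "\<Psi>' 0 = \<phi>' 0"
    using T pos[of 0] by (simp add: \<Psi>'_def b0 \<gamma>'_def Jx_def V1_0 a'_def compat(2))
  define \<Phi> where "\<Phi> y = (if y \<le> 0 then \<Psi> y else \<phi> y)" for y
  define \<Phi>' where "\<Phi>' y = (if y \<le> 0 then \<Psi>' y else \<phi>' y)" for y
  have \<Phi>: "(\<Phi> has_real_derivative \<Phi>' y) (at y)" for y
    unfolding \<Phi>_def \<Phi>'_def by (rule has_real_derivative_glue_functions[OF \<Psi> \<phi> \<Psi>0 \<Psi>'0])
  have \<Phi>'_cont: "continuous_on UNIV \<Phi>'"
    unfolding \<Phi>'_def
    by (rule continuous_on_cases_le) (auto intro: continuous_on_subset[OF \<Psi>'_cont]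
        continuous_on_subset[OF \<phi>'_cont] simp: \<Psi>'0)
  define V where "V t y = V1 t y + \<Phi>' y" for t y
  have V_cont: "continuous_on ({0..T} \<times> UNIV) (\<lambda>(t, y). V t y)"
    unfolding V_def case_prod_unfold
    by (intro continuous_on_add continuous_on_compose_Pair[OF V1_cont]
        continuous_on_compose2[OF \<Phi>'_cont] continuous_intros) auto
  have Ut: "((\<lambda>t. U1 t y + \<Phi> y) has_real_derivative g (X t y) t) (at t within {0..T})"
    if "t \<in> {0..T}" for t y
    using DERIV_add[OF U1t[OF that, of y] DERIV_const[of "\<Phi> y"]] by simp
  have Uy: "((\<lambda>y. U1 t y + \<Phi> y) has_real_derivative V t y) (at y)" if "t \<in> {0..T}" for t y
    unfolding V_def by (rule DERIV_add[OF U1y[OF that] \<Phi>])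
  define u where "u x t = U1 t (Y x t) + \<Phi> (Y x t)" for x t
  define p where "p x t = V t (Y x t) / E t (Y x t)" for x t
  have "continuous_on (UNIV \<times> {0..T}) (\<lambda>(x, t). p x t)"
    unfolding p_def case_prod_unfold
    by (intro continuous_on_divide continuous_on_compose_Pair[OF V_cont]
        continuous_on_compose_Pair[OF E_cont] continuous_on_compose_Pair[OF Y_cont] continuous_intros) auto
  moreover have "((\<lambda>x. u x t) has_real_derivative p x t) (at x)" if "t \<in> {0..T}" for x t
    unfolding u_def p_def
    using push_forward(1)[of "\<lambda>t y. U1 t y + \<Phi> y" "\<lambda>t y. g (X t y) t" V, OF Ut Uy V_cont that] .
  moreover have "((\<lambda>t. u x t) has_real_derivative g x t - l x t * p x t) (at t within {0..T})"
    if "t \<in> {0..T}" for x t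
    unfolding u_def p_def
    using push_forward(2)[of "\<lambda>t y. U1 t y + \<Phi> y" "\<lambda>t y. g (X t y) t" V, OF Ut Uy V_cont that, of x]
    unfolding X_Y[OF that] .
  moreover have "u x 0 = \<phi> x" if "x \<ge> 0" for x
    using that \<Psi>0 by (auto simp: u_def U1_0 \<Phi>_def)
  moreover have "u 0 t = \<beta> t" if "t \<in> {0..T}" for t
    using that a_nonpos[OF that] ba[OF that] by (simp add: u_def \<Phi>_def a_def[symmetric] \<Psi>_def \<gamma>_def)
  moreover have "((\<lambda>r. p (\<xi> r) r) has_real_derivative gx (\<xi> r) r - m (\<xi> r) r * p (\<xi> r) r) (at r within {s..t})"
    if st: "0 \<le> s" "t \<le> T" and \<xi>: "solves l \<xi> s t" and r: "r \<in> {s..t}" for \<xi> s t r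
  proof -
    \<comment> \<open>By the stability estimate every integral curve is a piece of the flow, so the
      claim reduces to differentiating \<open>V / E\<close> in time at a fixed label.\<close>
    define y where "y = Y (\<xi> s) s"
    have s: "s \<in> {0..T}" using st r by auto
    have eq: "\<xi> r' = X r' y" if r': "r' \<in> {s..t}" for r'
    proof -
      have "\<bar>\<xi> r' - X r' y\<bar> \<le> exp (L * (r' - s)) * \<bar>\<xi> s - X s y\<bar>"
        using r' st by (intro solutions_compare(1) solves_subinterval[OF \<xi>] solves_subinterval[OF solves_X]) auto
      then show ?thesis using X_Y[OF s] by (simp add: y_def)
    qed
    have r0: "r \<in> {0..T}" and sub: "{s..t} \<subseteq> {0..T}" using r st by auto
    have "((\<lambda>r. V r y / E r y) has_real_derivative
       ((gx (X r y) r * E r y + 0) * E r y - V r y * (E r y * m (X r y) r)) / (E r y * E r y)) (at r within {0..T})"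
      unfolding V_def by (intro DERIV_divide DERIV_add DERIV_const V1t E_deriv_t r0) simp
    also have "((gx (X r y) r * E r y + 0) * E r y - V r y * (E r y * m (X r y) r)) / (E r y * E r y)
       = gx (X r y) r - m (X r y) r * (V r y / E r y)"
      by (simp add: field_simps)
    finally have D: "((\<lambda>r. V r y / E r y) has_real_derivative
        gx (X r y) r - m (X r y) r * (V r y / E r y)) (at r within {s..t})"
      using DERIV_subset sub by blast
    have pe: "V r' y / E r' y = p (\<xi> r') r'" if "r' \<in> {s..t}" for r'
    proof -
      have "r' \<in> {0..T}" using that sub by blast
      then show ?thesis unfolding eq[OF that] p_def by simp
    qed
    show ?thesis
      using has_field_derivative_transform_within[OF D zero_less_one r pe] pe[OF r] eq[OF r] by simp
  qed
  ultimately show ?thesis by (intro exI[of _ u] exI[of _ p]) blast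
qed

end

section \<open>Transport on the strip with positive speed\<close>

definition C1_x :: "real \<Rightarrow> (real \<Rightarrow> real \<Rightarrow> real) \<Rightarrow> (real \<Rightarrow> real \<Rightarrow> real) \<Rightarrow> bool" where
  "C1_x T w wx \<longleftrightarrow>
     continuous_on ({0..1} \<times> {0..T}) (\<lambda>(x, t). w x t) \<and>
     continuous_on ({0..1} \<times> {0..T}) (\<lambda>(x, t). wx x t) \<and>
     (\<forall>x\<in>{0..1}. \<forall>t\<in>{0..T}. ((\<lambda>x. w x t) has_real_derivative wx x t) (at x within {0..1}))"

definition characteristic :: "(real \<Rightarrow> real \<Rightarrow> real) \<Rightarrow> real \<Rightarrow> (real \<Rightarrow> real) \<Rightarrow> real \<Rightarrow> real \<Rightarrow> bool" where
  "characteristic l T \<xi> s t \<longleftrightarrow> 0 \<le> s \<and> s \<le> t \<and> t \<le> T \<and> solves l \<xi> s t \<and> \<xi> ` {s..t} \<subseteq> {0..1}"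

text \<open>The third clause is the formally x-differentiated equation; as \<open>p\<close> is
  merely continuous, it has a meaning only along characteristics. All estimates of x-derivatives
  rest on it.\<close>

definition transport_solution where
  "transport_solution T l lx g gx u p \<longleftrightarrow>
     C1_x T u p \<and>
     (\<forall>x\<in>{0..1}. \<forall>t\<in>{0..T}.
        ((\<lambda>t. u x t) has_real_derivative g x t - l x t * p x t) (at t within {0..T})) \<and>
     (\<forall>\<xi> s t. characteristic l T \<xi> s t \<longrightarrow> (\<forall>r\<in>{s..t}.
        ((\<lambda>r. p (\<xi> r) r) has_real_derivative gx (\<xi> r) r - lx (\<xi> r) r * p (\<xi> r) r) (at r within {s..t})))"

lemma C1_x_extension:
  assumes "C1_x T w wx"
  defines "W \<equiv> \<lambda>x t. lin_ext 0 1 (\<lambda>x. w x t) (\<lambda>x. wx x t) x"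
  shows "continuous_on (UNIV \<times> {0..T}) (\<lambda>(x, t). W x t)"
    and "continuous_on (UNIV \<times> {0..T}) (\<lambda>(x, t). wx (clip 0 1 x) t)"
    and "\<And>x t. t \<in> {0..T} \<Longrightarrow> ((\<lambda>x. W x t) has_real_derivative wx (clip 0 1 x) t) (at x)"
    and "\<And>x t. x \<in> {0..1} \<Longrightarrow> W x t = w x t"
proof -
  have w: "continuous_on ({0..1} \<times> {0..T}) (\<lambda>(x, t). w x t)"
    and wx: "continuous_on ({0..1} \<times> {0..T}) (\<lambda>(x, t). wx x t)"
    using assms by (simp_all add: C1_x_def)
  show "continuous_on (UNIV \<times> {0..T}) (\<lambda>(x, t). wx (clip 0 1 x) t)"
    unfolding case_prod_unfold
    by (intro continuous_on_compose_Pair[OF wx] continuous_intros) auto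
  show "continuous_on (UNIV \<times> {0..T}) (\<lambda>(x, t). W x t)"
    unfolding case_prod_unfold W_def lin_ext_def
    by (intro continuous_on_add continuous_on_mult continuous_on_compose_Pair[OF wx]
        continuous_on_compose_Pair[OF w] continuous_intros) auto
  show "((\<lambda>x. W x t) has_real_derivative wx (clip 0 1 x) t) (at x)" if "t \<in> {0..T}" for x t
    using assms that unfolding W_def C1_x_def by (intro has_real_derivative_lin_ext) auto
  show "W x t = w x t" if "x \<in> {0..1}" for x t using that by (simp add: W_def)
qed

lemma solves_cong:
  assumes "solves l \<xi> s t" "\<And>r. r \<in> {s..t} \<Longrightarrow> l (\<xi> r) r = l' (\<xi> r) r"
  shows "solves l' \<xi> s t"
  using assms by (auto simp: solves_def)

lemma compact_bounded_real:
  fixes w :: "real \<Rightarrow> real \<Rightarrow> real"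
  assumes "continuous_on ({0..1} \<times> {0..T}) (\<lambda>(x, t). w x t)"
  shows "\<exists>C>0. \<forall>x\<in>{0..1}. \<forall>t\<in>{0..T}. \<bar>w x t\<bar> \<le> C"
proof -
  have "compact ((\<lambda>(x, t). w x t) ` ({0..1} \<times> {0..T}))"
    by (intro compact_continuous_image assms compact_Times) auto
  then have "bounded ((\<lambda>(x, t). w x t) ` ({0..1} \<times> {0..T}))" by (rule compact_imp_bounded)
  then obtain C where "C > 0" "\<forall>z\<in>(\<lambda>(x, t). w x t) ` ({0..1} \<times> {0..T}). norm z \<le> C"
    unfolding bounded_pos by blast
  then show ?thesis by (intro exI[of _ C]) auto
qed

text \<open>\<open>wx\<close> is bounded by compactness, so \<open>w\<close> is Lipschitz in x
  uniformly in t, and continuity in t at each x becomes joint continuity.\<close>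

lemma continuous_on_rectangle_if_C1:
  fixes w :: "real \<Rightarrow> real \<Rightarrow> real"
  assumes wx: "\<And>x t. x \<in> {0..1} \<Longrightarrow> t \<in> {0..T} \<Longrightarrow> ((\<lambda>x. w x t) has_real_derivative wx x t) (at x within {0..1})"
    and wx_cont: "continuous_on ({0..1} \<times> {0..T}) (\<lambda>(x, t). wx x t)"
    and w_cont: "\<And>x. x \<in> {0..1} \<Longrightarrow> continuous_on {0..T} (w x)"
  shows "continuous_on ({0..1} \<times> {0..T}) (\<lambda>(x, t). w x t)"
proof -
  obtain M where M: "M > 0" "\<And>x t. x \<in> {0..1} \<Longrightarrow> t \<in> {0..T} \<Longrightarrow> \<bar>wx x t\<bar> \<le> M"
    using compact_bounded_real[OF wx_cont] by auto
  have w_cl: "continuous_on ({0..T} \<times> UNIV) (\<lambda>(t, x). w (clip 0 1 x) t)"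
  proof (rule continuous_on_lipschitz_snd[where M = M])
    show "continuous_on {0..T} (\<lambda>t. w (clip 0 1 x) t)" for x
      using w_cont[of "clip 0 1 x"] by simp
    fix t y z assume t: "t \<in> {0..T}"
    have "norm (w (clip 0 1 y) t - w (clip 0 1 z) t) \<le> M * norm (clip 0 1 y - clip 0 1 z)"
      by (rule field_differentiable_bound[of "{0..1}" "\<lambda>x. w x t" "\<lambda>x. wx x t"])
        (use wx M(2) t in auto)
    also have "\<dots> \<le> M * \<bar>y - z\<bar>"
      using M dist_clip[of 0 1 y z] by (intro mult_left_mono) auto
    finally show "\<bar>w (clip 0 1 y) t - w (clip 0 1 z) t\<bar> \<le> M * \<bar>y - z\<bar>" by simp
  qed
  have "continuous_on ({0..1} \<times> {0..T}) (\<lambda>p. w (clip 0 1 (fst p)) (snd p))"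
    by (intro continuous_on_compose_Pair[OF w_cl] continuous_intros) auto
  then show ?thesis by (rule continuous_on_eq) auto
qed

text \<open>Here the characteristics enter at x = 0; the other sign is reduced to this one by
  reflection. Backwards in time a characteristic cannot leave through x = 1, since the speed there
  is positive, so it ends at time 0 or at x = 0. The transport problem is solved on the line with
  tangent-line extensions of the coefficients, source and initial data, and then restricted.\<close>

lemma
  fixes l lx :: "real \<Rightarrow> real \<Rightarrow> real"
  assumes T: "0 < T" and l: "C1_x T l lx"
    and pos: "\<And>x t. x \<in> {0..1} \<Longrightarrow> t \<in> {0..T} \<Longrightarrow> l x t > 0"
  shows characteristic_exists_pos: "\<And>x t. x \<in> {0..1} \<Longrightarrow> t \<in> {0..T} \<Longrightarrow>
      \<exists>\<xi> s. characteristic l T \<xi> s t \<and> \<xi> t = x \<and> (s = 0 \<or> \<xi> s = 0)"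
    and transport_exists_pos: "\<And>g gx \<phi> \<phi>' \<beta> \<beta>'. C1_x T g gx \<Longrightarrow>
      (\<And>x. x \<in> {0..1} \<Longrightarrow> (\<phi> has_real_derivative \<phi>' x) (at x within {0..1})) \<Longrightarrow>
      continuous_on {0..1} \<phi>' \<Longrightarrow>
      (\<And>t. t \<in> {0..T} \<Longrightarrow> (\<beta> has_real_derivative \<beta>' t) (at t within {0..T})) \<Longrightarrow>
      continuous_on {0..T} \<beta>' \<Longrightarrow>
      \<phi> 0 = \<beta> 0 \<Longrightarrow> \<beta>' 0 = g 0 0 - l 0 0 * \<phi>' 0 \<Longrightarrow>
      \<exists>u p. transport_solution T l lx g gx u p \<and> (\<forall>x\<in>{0..1}. u x 0 = \<phi> x) \<and> (\<forall>t\<in>{0..T}. u 0 t = \<beta> t)"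
proof -
  define lt where "lt x t = lin_ext 0 1 (\<lambda>x. l x t) (\<lambda>x. lx x t) x" for x t
  define m where "m x t = lx (clip 0 1 x) t" for x t
  note ext = C1_x_extension[OF l, folded lt_def m_def]
  obtain L where L: "L > 0" "\<And>x t. x \<in> {0..1} \<Longrightarrow> t \<in> {0..T} \<Longrightarrow> \<bar>lx x t\<bar> \<le> L"
    using compact_bounded_real[of T lx] l by (auto simp: C1_x_def)
  interpret scalar_flow lt m T L
  proof
    show "\<bar>m x t\<bar> \<le> L" if "t \<in> {0..T}" for x t
      unfolding m_def using that by (intro L(2)) auto
  qed (use T L ext in auto)
  have solves_eq: "solves lt \<xi> s t \<longleftrightarrow> solves l \<xi> s t" if "\<xi> ` {s..t} \<subseteq> {0..1}" for \<xi> s t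
  proof
    show "solves lt \<xi> s t \<Longrightarrow> solves l \<xi> s t"
      by (rule solves_cong[where l = lt]) (use that ext(4) in blast)+
    show "solves l \<xi> s t \<Longrightarrow> solves lt \<xi> s t"
      by (rule solves_cong[where l = l]) (use that ext(4) in fastforce)+
  qed
  show "\<exists>\<xi> s. characteristic l T \<xi> s t \<and> \<xi> t = x \<and> (s = 0 \<or> \<xi> s = 0)"
    if x: "x \<in> {0..1}" and t: "t \<in> {0..T}" for x t
  proof -
    define \<xi> where "\<xi> r = X r (Y x t)" for r
    have \<xi>t: "\<xi> t = x" using X_Y[OF t] by (simp add: \<xi>_def)
    have sol: "solves lt \<xi> 0 T" unfolding \<xi>_def by (rule solves_X)
    have cont: "continuous_on {0..T} \<xi>" by (rule solves_continuous_on[OF sol])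
    \<comment> \<open>The last time in \<open>S\<close>, if any, is the time of entry; after it the
      curve is nonnegative.\<close>
    define S where "S = {r \<in> {0..t}. \<xi> r \<le> 0}"
    obtain s where s: "s \<in> {0..t}" "s = 0 \<or> \<xi> s = 0" "\<And>r. r \<in> {s..t} \<Longrightarrow> \<xi> r \<ge> 0"
    proof (cases "S = {}")
      case True
      have "\<xi> r \<ge> 0" if "r \<in> {0..t}" for r
      proof (rule ccontr)
        assume "\<not> \<xi> r \<ge> 0"
        then have "r \<in> S" using that by (simp add: S_def)
        then show False using True by simp
      qed
      then show ?thesis using t by (intro that[of 0]) auto
    next
      case False
      have "closed S" unfolding S_def
        using t by (intro continuous_on_closed_Collect_le continuous_on_subset[OF cont] continuous_intros) auto
      moreover have "bounded S" by (rule bounded_subset[of "{0..t}"]) (auto simp: S_def)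
      ultimately have "compact S" by (simp add: compact_eq_bounded_closed)
      then obtain s where s: "s \<in> S" "\<And>r. r \<in> S \<Longrightarrow> r \<le> s"
        using compact_attains_sup[of S] False by blast
      have "\<exists>r\<ge>s. r \<le> t \<and> \<xi> r = 0"
        using s(1) x \<xi>t t by (intro IVT' continuous_on_subset[OF cont]) (auto simp: S_def)
      then obtain r where r: "s \<le> r" "r \<le> t" "\<xi> r = 0" by blast
      then have "r \<in> S" using s(1) by (auto simp: S_def)
      then have "r = s" using s(2) r by force
      show ?thesis
      proof (rule that[of s])
        show "s \<in> {0..t}" using s(1) by (simp add: S_def)
        show "s = 0 \<or> \<xi> s = 0" using r \<open>r = s\<close> by simp
        fix r' assume r': "r' \<in> {s..t}"
        show "\<xi> r' \<ge> 0"
        proof (rule ccontr)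
          assume "\<not> \<xi> r' \<ge> 0"
          then have "r' \<in> S" "\<xi> r' < 0" using r' s(1) by (auto simp: S_def)
          then show False using s(2)[of r'] r' r \<open>r = s\<close> by auto
        qed
      qed
    qed
    have le1: "\<xi> r0 \<le> 1" if r0: "r0 \<in> {0..t}" for r0
    proof (rule ccontr)
      assume gt: "\<not> \<xi> r0 \<le> 1"
      \<comment> \<open>At the first time \<open>r1\<close> in \<open>R\<close> the curve equals 1
        with positive slope, so it is below 1 shortly before, against the choice of
        \<open>r1\<close>.\<close>
      define R where "R = {r \<in> {r0..t}. \<xi> r \<le> 1}"
      have "closed R" unfolding R_def
        using r0 t by (intro continuous_on_closed_Collect_le continuous_on_subset[OF cont] continuous_intros) auto
      moreover have "bounded R" by (rule bounded_subset[of "{r0..t}"]) (auto simp: R_def)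
      ultimately have "compact R" by (simp add: compact_eq_bounded_closed)
      moreover have "t \<in> R" using x \<xi>t r0 by (simp add: R_def)
      ultimately obtain r1 where r1: "r1 \<in> R" "\<And>r. r \<in> R \<Longrightarrow> r1 \<le> r"
        using compact_attains_inf[of R] by blast
      have "\<exists>r\<ge>r0. r \<le> r1 \<and> \<xi> r = 1"
        using r1(1) r0 gt t by (intro IVT2' continuous_on_subset[OF cont]) (auto simp: R_def)
      then obtain r where r: "r0 \<le> r" "r \<le> r1" "\<xi> r = 1" by blast
      then have "r \<in> R" using r1(1) by (auto simp: R_def)
      then have \<xi>r1: "\<xi> r1 = 1" using r1(2) r by force
      have r1T: "r1 \<in> {0..T}" using r1(1) r0 t by (auto simp: R_def)
      have "(\<xi> has_real_derivative lt 1 r1) (at r1 within {0..T})"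
        using solvesD[OF sol r1T] \<xi>r1 by simp
      moreover have "lt 1 r1 > 0" using ext(4)[of 1] pos[of 1 r1] r1T by simp
      ultimately obtain d where d: "d > 0" "\<And>h. h > 0 \<Longrightarrow> r1 - h \<in> {0..T} \<Longrightarrow> h < d \<Longrightarrow> \<xi> (r1 - h) < \<xi> r1"
        using has_real_derivative_pos_inc_left by blast
      have "r0 < r1" using gt \<xi>r1 r1(1) by (cases "r0 = r1") (auto simp: R_def)
      define h where "h = min (d / 2) (r1 - r0)"
      have h: "h > 0" "h < d" "r0 \<le> r1 - h" using d \<open>r0 < r1\<close> by (auto simp: h_def)
      then have "\<xi> (r1 - h) < 1" using d(2)[of h] r0 r1T \<xi>r1 by auto
      then have "r1 - h \<in> R" using h r1(1) by (auto simp: R_def)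
      then show False using r1(2) h by force
    qed
    have img: "\<xi> ` {s..t} \<subseteq> {0..1}" using le1 s(1,3) by auto
    have "solves l \<xi> s t"
      using solves_subinterval[OF sol, of s t] s(1) t solves_eq[OF img] by auto
    then have "characteristic l T \<xi> s t" using s(1) t img by (simp add: characteristic_def)
    then show ?thesis using \<xi>t s(2) by blast
  qed
  show "\<exists>u p. transport_solution T l lx g gx u p \<and> (\<forall>x\<in>{0..1}. u x 0 = \<phi> x) \<and> (\<forall>t\<in>{0..T}. u 0 t = \<beta> t)"
    if g: "C1_x T g gx"
      and \<phi>: "\<And>x. x \<in> {0..1} \<Longrightarrow> (\<phi> has_real_derivative \<phi>' x) (at x within {0..1})"
      and \<phi>'_cont: "continuous_on {0..1} \<phi>'"
      and \<beta>: "\<And>t. t \<in> {0..T} \<Longrightarrow> (\<beta> has_real_derivative \<beta>' t) (at t within {0..T})"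
      and \<beta>'_cont: "continuous_on {0..T} \<beta>'"
      and compat: "\<phi> 0 = \<beta> 0" "\<beta>' 0 = g 0 0 - l 0 0 * \<phi>' 0"
    for g gx \<phi> \<phi>' \<beta> \<beta>'
  proof -
    define gt where "gt x t = lin_ext 0 1 (\<lambda>x. g x t) (\<lambda>x. gx x t) x" for x t
    note gext = C1_x_extension[OF g, folded gt_def]
    have \<phi>'c: "continuous_on UNIV (\<lambda>x. \<phi>' (clip 0 1 x))"
      by (intro continuous_on_compose2[OF \<phi>'_cont] continuous_intros) auto
    have lt0: "lt 0 t = l 0 t" and gt0: "gt 0 t = g 0 t" for t using ext(4) gext(4) by simp_all
    have lt0_pos: "lt 0 t > 0" if "t \<in> {0..T}" for t using pos[of 0 t] that by (simp add: lt0)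
    have c1: "lin_ext 0 1 \<phi> \<phi>' 0 = \<beta> 0" using compat by simp
    have c2: "\<beta>' 0 = gt 0 0 - lt 0 0 * \<phi>' (clip 0 1 0)" using compat by (simp add: lt0 gt0)
    have "\<exists>u p. continuous_on (UNIV \<times> {0..T}) (\<lambda>(x, t). p x t) \<and>
       (\<forall>x. \<forall>t\<in>{0..T}. ((\<lambda>x. u x t) has_real_derivative p x t) (at x)) \<and>
       (\<forall>x. \<forall>t\<in>{0..T}. ((\<lambda>t. u x t) has_real_derivative gt x t - lt x t * p x t) (at t within {0..T})) \<and>
       (\<forall>x\<ge>0. u x 0 = lin_ext 0 1 \<phi> \<phi>' x) \<and> (\<forall>t\<in>{0..T}. u 0 t = \<beta> t) \<and>
       (\<forall>\<xi> s t r. 0 \<le> s \<longrightarrow> t \<le> T \<longrightarrow> solves lt \<xi> s t \<longrightarrow> r \<in> {s..t} \<longrightarrow>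
          ((\<lambda>r. p (\<xi> r) r) has_real_derivative gx (clip 0 1 (\<xi> r)) r - m (\<xi> r) r * p (\<xi> r) r)
            (at r within {s..t}))"
      by (rule transport_on_line[where \<phi>' = "\<lambda>x. \<phi>' (clip 0 1 x)" and \<beta>' = \<beta>'])
        (fact lt0_pos gext \<phi>'c \<beta>'_cont c1 c2 \<beta> | rule has_real_derivative_lin_ext, simp, erule \<phi>)+
    then obtain u p where p_cont: "continuous_on (UNIV \<times> {0..T}) (\<lambda>(x, t). p x t)"
      and 1: "\<forall>x. \<forall>t\<in>{0..T}. ((\<lambda>x. u x t) has_real_derivative p x t) (at x)"
      and 2: "\<forall>x. \<forall>t\<in>{0..T}. ((\<lambda>t. u x t) has_real_derivative gt x t - lt x t * p x t) (at t within {0..T})"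
      and 3: "\<forall>x\<ge>0. u x 0 = lin_ext 0 1 \<phi> \<phi>' x" and 4: "\<forall>t\<in>{0..T}. u 0 t = \<beta> t"
      and 5: "\<forall>\<xi> s t r. 0 \<le> s \<longrightarrow> t \<le> T \<longrightarrow> solves lt \<xi> s t \<longrightarrow> r \<in> {s..t} \<longrightarrow>
          ((\<lambda>r. p (\<xi> r) r) has_real_derivative gx (clip 0 1 (\<xi> r)) r - m (\<xi> r) r * p (\<xi> r) r)
            (at r within {s..t})"
      by (elim exE conjE)
    note ux = 1[rule_format] and ut = 2[rule_format] and u0 = 3[rule_format] and ub = 4[rule_format]
      and pc = 5[rule_format]
    have "C1_x T u p"
      unfolding C1_x_def
    proof (intro conjI ballI)
      show "continuous_on ({0..1} \<times> {0..T}) (\<lambda>(x, t). p x t)"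
        by (rule continuous_on_subset[OF p_cont]) auto
      show "((\<lambda>x. u x t) has_real_derivative p x t) (at x within {0..1})" if "t \<in> {0..T}" for x t
        by (rule has_field_derivative_at_within[OF ux[OF that]])
      show "continuous_on ({0..1} \<times> {0..T}) (\<lambda>(x, t). u x t)"
      proof (rule continuous_on_rectangle_if_C1)
        show "((\<lambda>x. u x t) has_real_derivative p x t) (at x within {0..1})" if "t \<in> {0..T}" for x t
          by (rule has_field_derivative_at_within[OF ux[OF that]])
        show "continuous_on ({0..1} \<times> {0..T}) (\<lambda>(x, t). p x t)"
          by (rule continuous_on_subset[OF p_cont]) auto
        show "continuous_on {0..T} (u x)" for x
          using ut by (rule DERIV_continuous_on)
      qed
    qed
    moreover have "((\<lambda>t. u x t) has_real_derivative g x t - l x t * p x t) (at t within {0..T})"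
      if "x \<in> {0..1}" "t \<in> {0..T}" for x t
      using ut[OF that(2), of x] ext(4)[OF that(1)] gext(4)[OF that(1)] by simp
    moreover have "((\<lambda>r. p (\<xi> r) r) has_real_derivative gx (\<xi> r) r - lx (\<xi> r) r * p (\<xi> r) r) (at r within {s..t})"
      if "characteristic l T \<xi> s t" "r \<in> {s..t}" for \<xi> s t r
    proof -
      have c: "0 \<le> s" "t \<le> T" "\<xi> ` {s..t} \<subseteq> {0..1}" "solves lt \<xi> s t"
        using that solves_eq by (auto simp: characteristic_def)
      have "\<xi> r \<in> {0..1}" using c that by blast
      then show ?thesis using pc[OF c(1,2,4) that(2)] by (simp add: m_def)
    qed
    moreover have "u x 0 = \<phi> x" if "x \<in> {0..1}" for x using u0[of x] that by simp
    ultimately show ?thesis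
      using ub unfolding transport_solution_def by (intro exI[of _ u] exI[of _ p]) blast
  qed
qed

section \<open>Reflection, transport in either direction, and comparison\<close>

lemma C1_x_reflect: "C1_x T w wx \<Longrightarrow> C1_x T (\<lambda>x t. w (1 - x) t) (\<lambda>x t. - wx (1 - x) t)"
  unfolding C1_x_def
proof (intro conjI ballI; elim conjE)
  assume w: "continuous_on ({0..1} \<times> {0..T}) (\<lambda>(x, t). w x t)"
    and wx: "continuous_on ({0..1} \<times> {0..T}) (\<lambda>(x, t). wx x t)"
  show "continuous_on ({0..1} \<times> {0..T}) (\<lambda>(x, t). w (1 - x) t)"
    unfolding case_prod_unfold by (intro continuous_on_compose_Pair[OF w] continuous_intros) auto
  show "continuous_on ({0..1} \<times> {0..T}) (\<lambda>(x, t). - wx (1 - x) t)"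
    unfolding case_prod_unfold
    by (intro continuous_on_minus continuous_on_compose_Pair[OF wx] continuous_intros) auto
next
  fix x t :: real
  assume x: "x \<in> {0..1}" and t: "t \<in> {0..T}"
    and D: "\<forall>x\<in>{0..1}. \<forall>t\<in>{0..T}. ((\<lambda>x. w x t) has_real_derivative wx x t) (at x within {0..1})"
  have "((\<lambda>x. w x t) \<circ> (\<lambda>x. 1 - x) has_real_derivative wx (1 - x) t * (- 1)) (at x within {0..1})"
  proof (rule DERIV_image_chain)
    have "(\<lambda>x::real. 1 - x) ` {0..1} \<subseteq> {0..1}" by auto
    moreover have "((\<lambda>x. w x t) has_real_derivative wx (1 - x) t) (at (1 - x) within {0..1})"
      using D x t by auto
    ultimately show "((\<lambda>x. w x t) has_real_derivative wx (1 - x) t) (at (1 - x) within (\<lambda>x. 1 - x) ` {0..1})"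
      by (rule DERIV_subset[rotated])
    show "((\<lambda>x. 1 - x) has_real_derivative - 1) (at x within {0..1})"
      by (auto intro!: derivative_eq_intros)
  qed
  then show "((\<lambda>x. w (1 - x) t) has_real_derivative - wx (1 - x) t) (at x within {0..1})"
    by (simp add: o_def)
qed

lemma characteristic_reflect:
  assumes "characteristic l T \<xi> s t"
  shows "characteristic (\<lambda>x t. - l (1 - x) t) T (\<lambda>r. 1 - \<xi> r) s t"
proof -
  have "solves (\<lambda>x t. - l (1 - x) t) (\<lambda>r. 1 - \<xi> r) s t"
    using assms unfolding characteristic_def solves_def
    by (auto intro!: derivative_eq_intros)
  then show ?thesis using assms by (auto simp: characteristic_def)
qed

text \<open>\<open>en\<close> is the end point of \<open>{0..1}\<close> at which the characteristics enter.\<close>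

locale transport =
  fixes T en :: real and l lx :: "real \<Rightarrow> real \<Rightarrow> real"
  assumes T: "0 < T" and en: "en = 0 \<or> en = 1" and l: "C1_x T l lx"
    and sgn: "\<And>x t. x \<in> {0..1} \<Longrightarrow> t \<in> {0..T} \<Longrightarrow> (1 - 2 * en) * l x t > 0"
begin

lemma reflected:
  assumes "en = 1"
  shows "C1_x T (\<lambda>x t. - l (1 - x) t) (\<lambda>x t. lx (1 - x) t)"
    and "\<And>x t. x \<in> {0..1} \<Longrightarrow> t \<in> {0..T} \<Longrightarrow> - l (1 - x) t > 0"
proof -
  have "C1_x T (\<lambda>x t. - l x t) (\<lambda>x t. - lx x t)"
    using l unfolding C1_x_def
    by (auto simp: case_prod_unfold intro!: continuous_on_minus DERIV_minus)
  from C1_x_reflect[OF this] show "C1_x T (\<lambda>x t. - l (1 - x) t) (\<lambda>x t. lx (1 - x) t)" by simp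
  show "- l (1 - x) t > 0" if "x \<in> {0..1}" "t \<in> {0..T}" for x t
    using sgn[of "1 - x" t] that assms by simp
qed

lemma characteristic_exists:
  assumes x: "x \<in> {0..1}" and t: "t \<in> {0..T}"
  shows "\<exists>\<xi> s. characteristic l T \<xi> s t \<and> \<xi> t = x \<and> (s = 0 \<or> \<xi> s = en)"
  using en
proof
  assume "en = 0"
  then have "l x t > 0" if "x \<in> {0..1}" "t \<in> {0..T}" for x t using sgn[OF that] by simp
  then have "\<exists>\<xi> s. characteristic l T \<xi> s t \<and> \<xi> t = x \<and> (s = 0 \<or> \<xi> s = 0)"
    by (rule characteristic_exists_pos[OF T l _ x t])
  then show ?thesis using \<open>en = 0\<close> by simp
next
  assume en1: "en = 1"
  have x': "1 - x \<in> {0..1}" using x by simp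
  have ex: "\<exists>\<xi> s. characteristic (\<lambda>x t. - l (1 - x) t) T \<xi> s t \<and> \<xi> t = 1 - x \<and> (s = 0 \<or> \<xi> s = 0)"
    by (rule characteristic_exists_pos[OF T reflected(1)[OF en1] _ x' t]) (rule reflected(2)[OF en1])
  obtain \<xi> s where *: "characteristic (\<lambda>x t. - l (1 - x) t) T \<xi> s t" "\<xi> t = 1 - x" "s = 0 \<or> \<xi> s = 0"
    using ex by blast
  have "characteristic l T (\<lambda>r. 1 - \<xi> r) s t"
    using characteristic_reflect[OF *(1)] by simp
  then show ?thesis using * en1 by (intro exI[of _ "\<lambda>r. 1 - \<xi> r"] exI[of _ s]) auto
qed

lemma transport_exists:
  assumes g: "C1_x T g gx"
    and \<phi>: "\<And>x. x \<in> {0..1} \<Longrightarrow> (\<phi> has_real_derivative \<phi>' x) (at x within {0..1})"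
    and \<phi>'_cont: "continuous_on {0..1} \<phi>'"
    and \<beta>: "\<And>t. t \<in> {0..T} \<Longrightarrow> (\<beta> has_real_derivative \<beta>' t) (at t within {0..T})"
    and \<beta>'_cont: "continuous_on {0..T} \<beta>'"
    and compat: "\<phi> en = \<beta> 0" "\<beta>' 0 = g en 0 - l en 0 * \<phi>' en"
  shows "\<exists>u p. transport_solution T l lx g gx u p \<and>
    (\<forall>x\<in>{0..1}. u x 0 = \<phi> x) \<and> (\<forall>t\<in>{0..T}. u en t = \<beta> t)"
  using en
proof
  assume "en = 0"
  then have "l x t > 0" if "x \<in> {0..1}" "t \<in> {0..T}" for x t using sgn[OF that] by simp
  then show ?thesis unfolding \<open>en = 0\<close>
    by (rule transport_exists_pos[OF T l _ g \<phi> \<phi>'_cont \<beta> \<beta>'_cont]) (use compat \<open>en = 0\<close> in auto)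
next
  assume en1: "en = 1"
  have \<phi>r: "((\<lambda>x. \<phi> (1 - x)) has_real_derivative - \<phi>' (1 - x)) (at x within {0..1})" if x: "x \<in> {0..1}" for x
  proof -
    have "(\<phi> \<circ> (\<lambda>x. 1 - x) has_real_derivative \<phi>' (1 - x) * (- 1)) (at x within {0..1})"
    proof (rule DERIV_image_chain)
      have "(\<lambda>x::real. 1 - x) ` {0..1} \<subseteq> {0..1}" by auto
      moreover have "(\<phi> has_real_derivative \<phi>' (1 - x)) (at (1 - x) within {0..1})"
        using \<phi>[of "1 - x"] x by auto
      ultimately show "(\<phi> has_real_derivative \<phi>' (1 - x)) (at (1 - x) within (\<lambda>x. 1 - x) ` {0..1})"
        by (rule DERIV_subset[rotated])
      show "((\<lambda>x. 1 - x) has_real_derivative - 1) (at x within {0..1})"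
        by (auto intro!: derivative_eq_intros)
    qed
    then show ?thesis by (simp add: o_def)
  qed
  have \<phi>'r: "continuous_on {0..1} (\<lambda>x. - \<phi>' (1 - x))"
    by (intro continuous_on_minus continuous_on_compose2[OF \<phi>'_cont] continuous_intros) auto
  have c1: "\<phi> (1 - 0) = \<beta> 0" and c2: "\<beta>' 0 = g (1 - 0) 0 - (- l (1 - 0) 0) * (- \<phi>' (1 - 0))"
    using compat en1 by simp_all
  have ex: "\<exists>u p. transport_solution T (\<lambda>x t. - l (1 - x) t) (\<lambda>x t. lx (1 - x) t)
      (\<lambda>x t. g (1 - x) t) (\<lambda>x t. - gx (1 - x) t) u p \<and>
      (\<forall>x\<in>{0..1}. u x 0 = \<phi> (1 - x)) \<and> (\<forall>t\<in>{0..T}. u 0 t = \<beta> t)"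
    by (rule transport_exists_pos[where \<phi> = "\<lambda>x::real. \<phi> (1 - x)" and \<phi>' = "\<lambda>x::real. - \<phi>' (1 - x)" and \<beta>' = \<beta>'])
      (fact T reflected[OF en1] C1_x_reflect[OF g] \<phi>r \<phi>'r \<beta> \<beta>'_cont c1 c2)+
  obtain u p where up: "transport_solution T (\<lambda>x t. - l (1 - x) t) (\<lambda>x t. lx (1 - x) t)
      (\<lambda>x t. g (1 - x) t) (\<lambda>x t. - gx (1 - x) t) u p"
    and u0: "\<And>x. x \<in> {0..1} \<Longrightarrow> u x 0 = \<phi> (1 - x)" and ub: "\<And>t. t \<in> {0..T} \<Longrightarrow> u 0 t = \<beta> t"
    using ex by blast
  define u' where "u' x t = u (1 - x) t" for x t
  define p' where "p' x t = - p (1 - x) t" for x t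
  have "transport_solution T l lx g gx u' p'"
    unfolding transport_solution_def
  proof (intro conjI ballI allI impI)
    have "C1_x T u p" using up by (simp add: transport_solution_def)
    from C1_x_reflect[OF this] show "C1_x T u' p'" by (simp add: u'_def[abs_def] p'_def[abs_def])
  next
    fix x t :: real assume x: "x \<in> {0..1}" and t: "t \<in> {0..T}"
    have "((\<lambda>t. u (1 - x) t) has_real_derivative g (1 - (1 - x)) t - (- l (1 - (1 - x)) t) * p (1 - x) t)
        (at t within {0..T})"
      using up x t unfolding transport_solution_def by fastforce
    then show "((\<lambda>t. u' x t) has_real_derivative g x t - l x t * p' x t) (at t within {0..T})"
      by (simp add: u'_def p'_def)
  next
    fix \<xi> s t r assume c: "characteristic l T \<xi> s t" and r: "r \<in> {s..t}"
    have "((\<lambda>r. p (1 - \<xi> r) r) has_real_derivative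
       - gx (1 - (1 - \<xi> r)) r - lx (1 - (1 - \<xi> r)) r * p (1 - \<xi> r) r) (at r within {s..t})"
      using up characteristic_reflect[OF c] r unfolding transport_solution_def by blast
    from DERIV_minus[OF this]
    show "((\<lambda>r. p' (\<xi> r) r) has_real_derivative gx (\<xi> r) r - lx (\<xi> r) r * p' (\<xi> r) r) (at r within {s..t})"
      by (simp add: p'_def algebra_simps)
  qed
  moreover have "\<forall>x\<in>{0..1}. u' x 0 = \<phi> x" using u0 by (simp add: u'_def)
  moreover have "\<forall>t\<in>{0..T}. u' en t = \<beta> t" using ub en1 by (simp add: u'_def)
  ultimately show ?thesis by blast
qed

text \<open>The factor \<open>1 - 2 * en\<close> is the sign of the speed, so depth increases along
  characteristics at the rate |l|.\<close>

definition depth :: "real \<Rightarrow> real" where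
  "depth x = en + (1 - 2 * en) * x"

lemma depth_bounds: "x \<in> {0..1} \<Longrightarrow> 0 \<le> depth x" "x \<in> {0..1} \<Longrightarrow> depth x \<le> 1"
  using en by (auto simp: depth_def)

lemma depth_en [simp]: "depth en = 0" and depth_exit [simp]: "depth (1 - en) = 1"
  using en by (auto simp: depth_def)

lemma en_in [simp]: "en \<in> {0..1}" "1 - en \<in> {0..1}"
  using en by auto

text \<open>Up to the summand \<open>L\<close>, which absorbs the coefficient \<open>c\<close>, the
  bracket in \<open>growth\<close> is the logarithmic derivative of the barrier along a
  characteristic. Hence the barrier dominates from the starting point on, be it at time 0 or at the
  inflow end, where the depth is 0 and \<open>R\<close> drops out. Used with constant
  \<open>R\<close> for the contraction and with growing \<open>R\<close> for the a priori
  bound.\<close>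

lemma comparison:
  assumes z: "\<And>\<xi> s t r. characteristic l T \<xi> s t \<Longrightarrow> r \<in> {s..t} \<Longrightarrow>
      ((\<lambda>r. z (\<xi> r) r) has_real_derivative G (\<xi> r) r - c (\<xi> r) r * z (\<xi> r) r) (at r within {s..t})"
    and c_cont: "continuous_on ({0..1} \<times> {0..T}) (\<lambda>(x, t). c x t)"
    and c_bound: "\<And>x t. x \<in> {0..1} \<Longrightarrow> t \<in> {0..T} \<Longrightarrow> \<bar>c x t\<bar> \<le> L"
    and A: "\<And>t. t \<in> {0..T} \<Longrightarrow> (A has_real_derivative A' t) (at t within {0..T})"
    and R: "\<And>t. t \<in> {0..T} \<Longrightarrow> (R has_real_derivative R' t) (at t within {0..T})"
    and growth: "\<And>x t. x \<in> {0..1} \<Longrightarrow> t \<in> {0..T} \<Longrightarrow>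
      \<bar>G x t\<bar> \<le> (A' t - R' t * depth x - R t * \<bar>l x t\<bar> - L) * (D * exp (A t - R t * depth x))"
    and init: "\<And>x. x \<in> {0..1} \<Longrightarrow> \<bar>z x 0\<bar> \<le> D * exp (A 0 - R 0 * depth x)"
    and inflow: "\<And>t. t \<in> {0..T} \<Longrightarrow> \<bar>z en t\<bar> \<le> D * exp (A t)"
    and D: "D \<ge> 0"
    and x: "x \<in> {0..1}" and t: "t \<in> {0..T}"
  shows "\<bar>z x t\<bar> \<le> D * exp (A t - R t * depth x)"
proof -
  obtain \<xi> s where \<xi>: "characteristic l T \<xi> s t" "\<xi> t = x" "s = 0 \<or> \<xi> s = en"
    using characteristic_exists[OF x t] by blast
  have st: "0 \<le> s" "s \<le> t" "t \<le> T" and sol: "solves l \<xi> s t" and img: "\<And>r. r \<in> {s..t} \<Longrightarrow> \<xi> r \<in> {0..1}"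
    using \<xi>(1) by (auto simp: characteristic_def image_subset_iff simp del: atLeastAtMost_iff)
  have sub: "{s..t} \<subseteq> {0..T}" using st by auto
  have \<xi>_cont: "continuous_on {s..t} \<xi>" by (rule solves_continuous_on[OF sol])
  define B where "B r = D * exp (A r - R r * depth (\<xi> r))" for r
  define B' where "B' r = B r * (A' r - R' r * depth (\<xi> r) - R r * \<bar>l (\<xi> r) r\<bar>)" for r
  have BD: "(B has_real_derivative B' r) (at r within {s..t})" if r: "r \<in> {s..t}" for r
  proof -
    have r': "r \<in> {0..T}" using r sub by blast
    have absl: "\<bar>l (\<xi> r) r\<bar> = (1 - 2 * en) * l (\<xi> r) r"
      using sgn[OF img[OF r] r'] en by auto
    show ?thesis
      unfolding B_def B'_def absl depth_def
      by (auto intro!: derivative_eq_intros DERIV_subset[OF A[OF r'] sub] DERIV_subset[OF R[OF r'] sub]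
          solvesD[OF sol r] simp: algebra_simps)
  qed
  \<comment> \<open>\<open>exp (C r)\<close> is the integrating factor that removes the term with
    \<open>c\<close>.\<close>
  define C where "C r = integral {s..r} (\<lambda>r. c (\<xi> r) r)" for r
  have "continuous_on {s..t} (\<lambda>r. c (\<xi> r) r)"
    using sub img by (intro continuous_on_compose_Pair[OF c_cont] \<xi>_cont continuous_intros) auto
  then have CD: "(C has_real_derivative c (\<xi> r) r) (at r within {s..t})" if "r \<in> {s..t}" for r
    unfolding C_def has_real_derivative_iff_has_vector_derivative
    by (rule integral_has_vector_derivative[OF _ that])
  have zD: "((\<lambda>r. z (\<xi> r) r) has_real_derivative G (\<xi> r) r - c (\<xi> r) r * z (\<xi> r) r) (at r within {s..t})"
    if "r \<in> {s..t}" for r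
    by (rule z[OF \<xi>(1) that])
  have B_nonneg: "B r \<ge> 0" for r using D by (simp add: B_def)
  have key: "\<bar>G (\<xi> r) r\<bar> \<le> B' r + c (\<xi> r) r * B r" if r: "r \<in> {s..t}" for r
  proof -
    have r': "r \<in> {0..T}" using r sub by blast
    have "\<bar>G (\<xi> r) r\<bar> \<le> B' r - L * B r"
      using growth[OF img[OF r] r'] by (simp add: B'_def B_def algebra_simps)
    moreover have "- L * B r \<le> c (\<xi> r) r * B r"
      using c_bound[OF img[OF r] r'] B_nonneg by (intro mult_right_mono) auto
    ultimately show ?thesis by simp
  qed
  have start: "\<bar>z (\<xi> s) s\<bar> \<le> B s"
    using \<xi>(3)
  proof
    assume "s = 0"
    then show ?thesis using init[OF img[of s]] st by (simp add: B_def)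
  next
    assume "\<xi> s = en"
    then show ?thesis using inflow[of s] st by (simp add: B_def)
  qed
  have lo: "(B s + z (\<xi> s) s) * exp (C s) \<le> (B t + z (\<xi> t) t) * exp (C t)"
  proof (rule nondecreasing_if_derivative_nonneg[where F = "\<lambda>r. (B r + z (\<xi> r) r) * exp (C r)"
        and F' = "\<lambda>r. (B' r + c (\<xi> r) r * B r + G (\<xi> r) r) * exp (C r)"])
    show "((\<lambda>r. (B r + z (\<xi> r) r) * exp (C r)) has_real_derivative
       (B' r + c (\<xi> r) r * B r + G (\<xi> r) r) * exp (C r)) (at r within {s..t})" if "r \<in> {s..t}" for r
      by (auto intro!: derivative_eq_intros BD[OF that] zD[OF that] CD[OF that] simp: algebra_simps)
    show "0 \<le> (B' r + c (\<xi> r) r * B r + G (\<xi> r) r) * exp (C r)" if "r \<in> {s..t}" for r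
      using key[OF that] by (intro mult_nonneg_nonneg) auto
  qed (use st in auto)
  have hi: "(B s - z (\<xi> s) s) * exp (C s) \<le> (B t - z (\<xi> t) t) * exp (C t)"
  proof (rule nondecreasing_if_derivative_nonneg[where F = "\<lambda>r. (B r - z (\<xi> r) r) * exp (C r)"
        and F' = "\<lambda>r. (B' r + c (\<xi> r) r * B r - G (\<xi> r) r) * exp (C r)"])
    show "((\<lambda>r. (B r - z (\<xi> r) r) * exp (C r)) has_real_derivative
       (B' r + c (\<xi> r) r * B r - G (\<xi> r) r) * exp (C r)) (at r within {s..t})" if "r \<in> {s..t}" for r
      by (auto intro!: derivative_eq_intros BD[OF that] zD[OF that] CD[OF that] simp: algebra_simps)
    show "0 \<le> (B' r + c (\<xi> r) r * B r - G (\<xi> r) r) * exp (C r)" if "r \<in> {s..t}" for r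
      using key[OF that] by (intro mult_nonneg_nonneg) auto
  qed (use st in auto)
  have "0 \<le> (B s + z (\<xi> s) s) * exp (C s)" "0 \<le> (B s - z (\<xi> s) s) * exp (C s)"
    using start by (auto intro!: mult_nonneg_nonneg)
  then have "0 \<le> (B t + z (\<xi> t) t) * exp (C t)" "0 \<le> (B t - z (\<xi> t) t) * exp (C t)"
    using lo hi by linarith+
  then have "0 \<le> B t + z (\<xi> t) t" "0 \<le> B t - z (\<xi> t) t"
    by (simp_all add: zero_le_mult_iff not_le[symmetric])
  then show ?thesis using \<xi>(2) by (auto simp: B_def abs_le_iff)
qed

end

section \<open>Mixed problems for hyperbolic systems\<close>

text \<open>The chain rule for \<open>f x t (u x t)\<close> as a function of x and for
  \<open>h t (exit_trace u t)\<close> as a function of t, with one-sided derivatives at the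
  ends.\<close>

lemma has_real_derivative_compose_vector:
  fixes w :: "real \<Rightarrow> 'a::real_normed_vector \<Rightarrow> real"
  assumes wx: "\<And>x y. x \<in> A \<Longrightarrow> ((\<lambda>x. w x y) has_real_derivative wx x y) (at x within A)"
    and wx_cont: "continuous_on (A \<times> UNIV) (\<lambda>(x, y). wx x y)"
    and wy: "((\<lambda>y. w s y) has_derivative D) (at (\<eta> s))"
    and \<eta>: "(\<eta> has_vector_derivative \<eta>') (at s within A)"
    and A: "convex A" "s \<in> A"
  shows "((\<lambda>s. w s (\<eta> s)) has_real_derivative wx s (\<eta> s) + D \<eta>') (at s within A)"
proof -
  have W: "((\<lambda>(y, x). w x y) has_derivative
      (\<lambda>(ty, tx). D ty + blinfun_mult_right (wx s (\<eta> s)) tx)) (at (\<eta> s, s) within UNIV \<times> A)"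
  proof (rule has_derivative_partialsI[where f = "\<lambda>y x. w x y" and fy = "\<lambda>y x. blinfun_mult_right (wx x y)"])
    show "((\<lambda>y. w s y) has_derivative D) (at (\<eta> s) within UNIV)" using wy .
    show "((\<lambda>x. w x y) has_derivative blinfun_apply (blinfun_mult_right (wx x y))) (at x within A)"
      if "x \<in> A" for x y
      using wx[OF that] by (simp add: has_field_derivative_def blinfun_mult_right.rep_eq)
    have "continuous_on (UNIV \<times> A) (\<lambda>p. wx (snd p) (fst p))"
      by (intro continuous_on_compose_Pair[OF wx_cont] continuous_intros) auto
    then have "continuous_on (UNIV \<times> A) (\<lambda>(y, x). blinfun_mult_right (wx x y))"
      unfolding case_prod_unfold
      by (intro bounded_linear.continuous_on[OF bounded_linear_blinfun_mult_right])
    then show "continuous (at (\<eta> s, s) within UNIV \<times> A) (\<lambda>(y, x). blinfun_mult_right (wx x y))"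
      using A by (simp add: continuous_on_eq_continuous_within)
  qed (use A in auto)
  have P: "((\<lambda>s. (\<eta> s, s)) has_derivative (\<lambda>r. (r *\<^sub>R \<eta>', r))) (at s within A)"
    using \<eta> by (intro has_derivative_Pair has_derivative_ident) (simp add: has_vector_derivative_def)
  have "(((\<lambda>(y, x). w x y) \<circ> (\<lambda>s. (\<eta> s, s))) has_derivative
      (\<lambda>(ty, tx). D ty + blinfun_mult_right (wx s (\<eta> s)) tx) \<circ> (\<lambda>r. (r *\<^sub>R \<eta>', r))) (at s within A)"
    by (rule diff_chain_within[OF P has_derivative_subset[OF W]]) (use A in auto)
  moreover have "D (r *\<^sub>R \<eta>') = r * D \<eta>'" for r
    using linear_scale[OF has_derivative_linear[OF wy]] by simp
  ultimately show ?thesis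
    unfolding has_field_derivative_def o_def split_conv
    by (elim has_derivative_eq_rhs) (auto simp: blinfun_mult_right.rep_eq algebra_simps)
qed

lemma has_real_derivative_unique_within_Icc:
  assumes "(f has_real_derivative D) (at x within {a..b})" "(g has_real_derivative E) (at x within {a..b})"
    and "\<And>y. y \<in> {a..b} \<Longrightarrow> f y = g y" and "x \<in> {a..b}" "a < b"
  shows "D = E"
proof -
  have "(g has_real_derivative D) (at x within {a..b})"
    by (rule has_field_derivative_transform_within[OF assms(1) zero_less_one assms(4)]) (use assms(3) in auto)
  then show ?thesis
    using vector_derivative_unique_within_closed_interval[of a b x g D E] assms
    by (simp add: has_real_derivative_iff_has_vector_derivative)
qed

lemma continuous_on_vec_components:
  fixes w :: "'b::topological_space \<Rightarrow> real ^ 'n"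
  assumes "\<And>i. continuous_on S (\<lambda>x. w x $ i)"
  shows "continuous_on S w"
proof -
  have "continuous_on S (\<lambda>x. \<chi> i. w x $ i)" using assms by (intro continuous_on_vec_lambda) auto
  then show ?thesis by (simp add: vec_lambda_eta)
qed

lemma has_vector_derivative_components:
  fixes w :: "real \<Rightarrow> real ^ 'n"
  shows "(w has_vector_derivative w') (at t within S) \<longleftrightarrow>
    (\<forall>i. ((\<lambda>t. w t $ i) has_real_derivative w' $ i) (at t within S))"
proof -
  have "(w has_vector_derivative w') (at t within S) \<longleftrightarrow>
      (\<forall>i. ((\<lambda>t. w t \<bullet> axis i 1) has_derivative (\<lambda>r. (r *\<^sub>R w') \<bullet> axis i 1)) (at t within S))"
    unfolding has_vector_derivative_def has_derivative_componentwise_within[of w]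
    by (auto simp: Basis_vec_def)
  also have "\<dots> \<longleftrightarrow> (\<forall>i. ((\<lambda>t. w t $ i) has_real_derivative w' $ i) (at t within S))"
    by (simp add: inner_axis has_field_derivative_def mult.commute[of _ "w' $ _"] fun_eq_iff)
  finally show ?thesis .
qed

text \<open>From here on only the entry end \<open>en i\<close> of each component matters; the
  splitting by k and the order of the indices return in \<open>ibvp\<close>.\<close>

locale hyperbolic =
  fixes T :: real and en :: "'n::finite \<Rightarrow> real"
    and lam lamx :: "real \<Rightarrow> real \<Rightarrow> real ^ 'n"
    and f fx :: "real \<Rightarrow> real \<Rightarrow> real ^ 'n \<Rightarrow> real ^ 'n"
    and fy :: "real \<Rightarrow> real \<Rightarrow> real ^ 'n \<Rightarrow> real ^ 'n ^ 'n"
    and h ht :: "real \<Rightarrow> real ^ 'n \<Rightarrow> real ^ 'n"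
    and hz :: "real \<Rightarrow> real ^ 'n \<Rightarrow> real ^ 'n ^ 'n"
    and \<phi> \<phi>' :: "real \<Rightarrow> real ^ 'n"
  assumes transport: "\<And>i. transport T (en i) (\<lambda>x t. lam x t $ i) (\<lambda>x t. lamx x t $ i)"
    and f_cont: "continuous_on ({0..1} \<times> {0..T} \<times> UNIV) (\<lambda>(x, t, y). f x t y)"
    and fx_cont: "continuous_on ({0..1} \<times> {0..T} \<times> UNIV) (\<lambda>(x, t, y). fx x t y)"
    and fy_cont: "continuous_on ({0..1} \<times> {0..T} \<times> UNIV) (\<lambda>(x, t, y). fy x t y)"
    and f_x: "\<And>x t y. x \<in> {0..1} \<Longrightarrow> t \<in> {0..T} \<Longrightarrow>
        ((\<lambda>x. f x t y) has_vector_derivative fx x t y) (at x within {0..1})"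
    and f_y: "\<And>x t y. x \<in> {0..1} \<Longrightarrow> t \<in> {0..T} \<Longrightarrow> (f x t has_derivative (\<lambda>v. fy x t y *v v)) (at y)"
    and ht_cont: "continuous_on ({0..T} \<times> UNIV) (\<lambda>(t, z). ht t z)"
    and hz_cont: "continuous_on ({0..T} \<times> UNIV) (\<lambda>(t, z). hz t z)"
    and h_t: "\<And>t z. t \<in> {0..T} \<Longrightarrow> ((\<lambda>t. h t z) has_vector_derivative ht t z) (at t within {0..T})"
    and h_z: "\<And>t z. t \<in> {0..T} \<Longrightarrow> (h t has_derivative (\<lambda>v. hz t z *v v)) (at z)"
    and \<phi>_x: "\<And>x. x \<in> {0..1} \<Longrightarrow> (\<phi> has_vector_derivative \<phi>' x) (at x within {0..1})"
    and \<phi>'_cont: "continuous_on {0..1} \<phi>'"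
begin

text \<open>The vector v(t) of the problem: every component is read where its characteristics
  leave.\<close>

definition exit_trace :: "(real \<Rightarrow> real \<Rightarrow> real ^ 'n) \<Rightarrow> real \<Rightarrow> real ^ 'n" where
  "exit_trace u t = (\<chi> j. u (1 - en j) t $ j)"

definition velocity :: "real \<Rightarrow> real ^ 'n" where
  "velocity x = f x 0 (\<phi> x) - (\<chi> i. lam x 0 $ i * \<phi>' x $ i)"

definition v0 where "v0 = exit_trace (\<lambda>x t. \<phi> x) 0"
definition v0' where "v0' = exit_trace (\<lambda>x t. velocity x) 0"

text \<open>\<open>p\<close> is u_x and \<open>q\<close> is u_t. They are kept as functions of their
  own, so that estimates and limits can refer to them directly.\<close>

definition C1v :: "(real \<Rightarrow> real \<Rightarrow> real ^ 'n) \<Rightarrow> (real \<Rightarrow> real \<Rightarrow> real ^ 'n) \<Rightarrow> (real \<Rightarrow> real \<Rightarrow> real ^ 'n) \<Rightarrow> bool" where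
  "C1v u p q \<longleftrightarrow> (\<forall>i. C1_x T (\<lambda>x t. u x t $ i) (\<lambda>x t. p x t $ i)) \<and>
     continuous_on ({0..1} \<times> {0..T}) (\<lambda>(x, t). q x t) \<and>
     (\<forall>i. \<forall>x\<in>{0..1}. \<forall>t\<in>{0..T}. ((\<lambda>t. u x t $ i) has_real_derivative q x t $ i) (at t within {0..T}))"

text \<open>The invariant of the iteration. With these values at time 0 the compatibility conditions
  of the next linear problem are exactly those of the nonlinear one, so the next iterate is C1
  again.\<close>

definition admissible where
  "admissible u p q \<longleftrightarrow> C1v u p q \<and> (\<forall>x\<in>{0..1}. u x 0 = \<phi> x) \<and> exit_trace q 0 = v0'"

text \<open>Source and inflow data are taken from the old iterate, so the components decouple. The
  third clause is the differentiated boundary condition; together with the last one it determines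
  \<open>p'\<close> at the inflow end.\<close>

definition iterates where
  "iterates u p q u' p' q' \<longleftrightarrow>
     (\<forall>i. transport_solution T (\<lambda>x t. lam x t $ i) (\<lambda>x t. lamx x t $ i)
        (\<lambda>x t. f x t (u x t) $ i) (\<lambda>x t. (fx x t (u x t) + fy x t (u x t) *v p x t) $ i)
        (\<lambda>x t. u' x t $ i) (\<lambda>x t. p' x t $ i)) \<and>
     (\<forall>i. \<forall>t\<in>{0..T}. u' (en i) t $ i = h t (exit_trace u t) $ i) \<and>
     (\<forall>i. \<forall>t\<in>{0..T}. q' (en i) t $ i = (ht t (exit_trace u t) + hz t (exit_trace u t) *v exit_trace q t) $ i) \<and>
     (\<forall>x\<in>{0..1}. p' x 0 = \<phi>' x) \<and>
     (\<forall>i. \<forall>x\<in>{0..1}. \<forall>t\<in>{0..T}. q' x t $ i = f x t (u x t) $ i - lam x t $ i * p' x t $ i)"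

lemma T: "0 < T"
  using transport by (rule transport.T)

lemma en_cases: "en i = 0 \<or> en i = 1"
  using transport by (rule transport.en)

lemma en_in: "en i \<in> {0..1}" "1 - en i \<in> {0..1}"
  using en_cases[of i] by auto

lemma lam_C1_x: "C1_x T (\<lambda>x t. lam x t $ i) (\<lambda>x t. lamx x t $ i)"
  using transport by (rule transport.l)

lemma lam_nonzero: "x \<in> {0..1} \<Longrightarrow> t \<in> {0..T} \<Longrightarrow> lam x t $ i \<noteq> 0"
  using transport.sgn[OF transport[of i], of x t] by auto

lemma lam_cont: "continuous_on ({0..1} \<times> {0..T}) (\<lambda>(x, t). lam x t)"
  by (rule continuous_on_vec_components) (use lam_C1_x in \<open>simp add: C1_x_def case_prod_unfold\<close>)

lemma C1vD:
  assumes "C1v u p q"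
  shows "C1_x T (\<lambda>x t. u x t $ i) (\<lambda>x t. p x t $ i)"
    and "continuous_on ({0..1} \<times> {0..T}) (\<lambda>(x, t). u x t)"
    and "continuous_on ({0..1} \<times> {0..T}) (\<lambda>(x, t). p x t)"
    and "continuous_on ({0..1} \<times> {0..T}) (\<lambda>(x, t). q x t)"
    and "\<And>x t. x \<in> {0..1} \<Longrightarrow> t \<in> {0..T} \<Longrightarrow> ((\<lambda>x. u x t) has_vector_derivative p x t) (at x within {0..1})"
    and "\<And>x t. x \<in> {0..1} \<Longrightarrow> t \<in> {0..T} \<Longrightarrow> ((\<lambda>t. u x t) has_vector_derivative q x t) (at t within {0..T})"
proof -
  show C: "C1_x T (\<lambda>x t. u x t $ i) (\<lambda>x t. p x t $ i)" for i
    using assms by (simp add: C1v_def)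
  show "continuous_on ({0..1} \<times> {0..T}) (\<lambda>(x, t). u x t)"
    by (rule continuous_on_vec_components) (use C in \<open>simp add: C1_x_def case_prod_unfold\<close>)
  show "continuous_on ({0..1} \<times> {0..T}) (\<lambda>(x, t). p x t)"
    by (rule continuous_on_vec_components) (use C in \<open>simp add: C1_x_def case_prod_unfold\<close>)
  show "continuous_on ({0..1} \<times> {0..T}) (\<lambda>(x, t). q x t)"
    using assms by (simp add: C1v_def)
  show "((\<lambda>x. u x t) has_vector_derivative p x t) (at x within {0..1})" if "x \<in> {0..1}" "t \<in> {0..T}" for x t
    unfolding has_vector_derivative_components using C that unfolding C1_x_def by blast
  show "((\<lambda>t. u x t) has_vector_derivative q x t) (at t within {0..T})" if "x \<in> {0..1}" "t \<in> {0..T}" for x t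
    unfolding has_vector_derivative_components using assms that unfolding C1v_def by blast
qed

lemma continuous_on_triple:
  assumes "continuous_on ({0..1} \<times> {0..T} \<times> UNIV) (\<lambda>(x, t, y). F x t y)"
    and "continuous_on ({0..1} \<times> {0..T}) (\<lambda>(x, t). u x t)"
  shows "continuous_on ({0..1} \<times> {0..T}) (\<lambda>(x, t). F x t (u x t))"
proof -
  have "continuous_on ({0..1} \<times> {0..T}) (\<lambda>p. (\<lambda>(x, t, y). F x t y) (fst p, snd p, u (fst p) (snd p)))"
    using assms(2)
    by (intro continuous_on_compose2[OF assms(1)] continuous_intros) (auto simp: case_prod_unfold)
  then show ?thesis by (simp add: case_prod_unfold)
qed

lemma source_C1_x:
  assumes u: "C1v u p q"
  shows "C1_x T (\<lambda>x t. f x t (u x t) $ i) (\<lambda>x t. (fx x t (u x t) + fy x t (u x t) *v p x t) $ i)"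
  unfolding C1_x_def
proof (intro conjI ballI)
  note uc = C1vD(2)[OF u]
  show "continuous_on ({0..1} \<times> {0..T}) (\<lambda>(x, t). f x t (u x t) $ i)"
    using continuous_on_triple[OF f_cont uc] by (auto simp: case_prod_unfold intro!: continuous_intros)
  have "continuous_on ({0..1} \<times> {0..T}) (\<lambda>p'. fy (fst p') (snd p') (u (fst p') (snd p')) *v p (fst p') (snd p'))"
    using continuous_on_triple[OF fy_cont uc] C1vD(3)[OF u]
    unfolding matrix_vector_mult_def case_prod_unfold
    by (intro continuous_on_vec_lambda continuous_intros)
  then show "continuous_on ({0..1} \<times> {0..T}) (\<lambda>(x, t). (fx x t (u x t) + fy x t (u x t) *v p x t) $ i)"
    using continuous_on_triple[OF fx_cont uc] by (auto simp: case_prod_unfold intro!: continuous_intros)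
  fix x t assume x: "x \<in> {0..1::real}" and t: "t \<in> {0..T}"
  have "((\<lambda>x. f x t (u x t) $ i) has_real_derivative
      fx x t (u x t) $ i + (fy x t (u x t) *v p x t) $ i) (at x within {0..1})"
  proof (rule has_real_derivative_compose_vector[where w = "\<lambda>x y. f x t y $ i" and wx = "\<lambda>x y. fx x t y $ i"
        and \<eta> = "\<lambda>x. u x t" and \<eta>' = "p x t" and D = "\<lambda>v. (fy x t (u x t) *v v) $ i"])
    show "((\<lambda>x. f x t y $ i) has_real_derivative fx x t y $ i) (at x within {0..1})" if "x \<in> {0..1}" for x y
      using f_x[OF that t] by (simp add: has_vector_derivative_components)
    have "continuous_on ({0..1} \<times> UNIV) (\<lambda>p. (\<lambda>(x, t, y). fx x t y) (fst p, t, snd p) $ i)"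
      using t by (intro continuous_intros continuous_on_compose2[OF fx_cont]) auto
    then show "continuous_on ({0..1} \<times> UNIV) (\<lambda>(x, y). fx x t y $ i)" by (simp add: case_prod_unfold)
    show "((\<lambda>y. f x t y $ i) has_derivative (\<lambda>v. (fy x t (u x t) *v v) $ i)) (at (u x t))"
      using f_y[OF x t] by (rule bounded_linear.has_derivative[OF bounded_linear_vec_nth])
    show "((\<lambda>x. u x t) has_vector_derivative p x t) (at x within {0..1})" by (rule C1vD(5)[OF u x t])
  qed (use x in auto)
  then show "((\<lambda>x. f x t (u x t) $ i) has_real_derivative
      (fx x t (u x t) + fy x t (u x t) *v p x t) $ i) (at x within {0..1})" by simp
qed

lemma exit_trace_deriv:
  assumes "C1v u p q" "t \<in> {0..T}"
  shows "(exit_trace u has_vector_derivative exit_trace q t) (at t within {0..T})"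
  using C1vD(6)[OF assms(1) en_in(2) assms(2)]
  by (simp add: exit_trace_def has_vector_derivative_components)

lemma exit_trace_cont:
  assumes "continuous_on ({0..1} \<times> {0..T}) (\<lambda>(x, t). u x t)"
  shows "continuous_on {0..T} (exit_trace u)"
proof (rule continuous_on_vec_components)
  fix j
  have "continuous_on {0..T} (\<lambda>t. u (1 - en j) t)"
    by (rule continuous_on_compose_Pair[OF assms]) (use en_in in \<open>auto intro: continuous_intros\<close>)
  then show "continuous_on {0..T} (\<lambda>t. exit_trace u t $ j)"
    by (simp add: exit_trace_def continuous_on_component)
qed

lemma inflow_deriv:
  assumes u: "C1v u p q" and t: "t \<in> {0..T}"
  shows "((\<lambda>t. h t (exit_trace u t) $ i) has_real_derivative
    (ht t (exit_trace u t) + hz t (exit_trace u t) *v exit_trace q t) $ i) (at t within {0..T})"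
proof -
  have "((\<lambda>t. h t (exit_trace u t) $ i) has_real_derivative
      ht t (exit_trace u t) $ i + (hz t (exit_trace u t) *v exit_trace q t) $ i) (at t within {0..T})"
  proof (rule has_real_derivative_compose_vector[where w = "\<lambda>t y. h t y $ i" and wx = "\<lambda>t y. ht t y $ i"
        and \<eta> = "exit_trace u" and \<eta>' = "exit_trace q t" and D = "\<lambda>v. (hz t (exit_trace u t) *v v) $ i"])
    show "((\<lambda>t. h t y $ i) has_real_derivative ht t y $ i) (at t within {0..T})" if "t \<in> {0..T}" for t y
      using h_t[OF that] by (simp add: has_vector_derivative_components)
    show "continuous_on ({0..T} \<times> UNIV) (\<lambda>(t, y). ht t y $ i)"
      using ht_cont unfolding case_prod_unfold by (rule continuous_on_component)
    show "((\<lambda>y. h t y $ i) has_derivative (\<lambda>v. (hz t (exit_trace u t) *v v) $ i)) (at (exit_trace u t))"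
      using h_z[OF t] by (rule bounded_linear.has_derivative[OF bounded_linear_vec_nth])
    show "(exit_trace u has_vector_derivative exit_trace q t) (at t within {0..T})"
      by (rule exit_trace_deriv[OF u t])
  qed (use t in auto)
  then show ?thesis by simp
qed

lemma inflow_deriv_cont:
  assumes u: "C1v u p q"
  shows "continuous_on {0..T} (\<lambda>t. (ht t (exit_trace u t) + hz t (exit_trace u t) *v exit_trace q t) $ i)"
proof -
  note [continuous_intros] = exit_trace_cont[OF C1vD(2)[OF u]] exit_trace_cont[OF C1vD(4)[OF u]]
  have "continuous_on {0..T} (\<lambda>t. hz t (exit_trace u t) *v exit_trace q t)"
    unfolding matrix_vector_mult_def
    by (intro continuous_on_vec_lambda continuous_intros continuous_on_compose_Pair[OF hz_cont]) auto
  then show ?thesis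
    by (intro continuous_intros continuous_on_compose_Pair[OF ht_cont]) auto
qed

lemma iterate_exists:
  assumes compat0: "\<And>i. \<phi> (en i) $ i = h 0 v0 $ i"
    and compat1: "\<And>i. velocity (en i) $ i = (ht 0 v0 + hz 0 v0 *v v0') $ i"
    and adm: "admissible u p q"
  shows "\<exists>u' p' q'. admissible u' p' q' \<and> iterates u p q u' p' q'"
proof -
  have u: "C1v u p q" and u0: "\<And>x. x \<in> {0..1} \<Longrightarrow> u x 0 = \<phi> x" and q0: "exit_trace q 0 = v0'"
    using adm by (auto simp: admissible_def)
  have tr0: "exit_trace u 0 = v0" using u0 en_in by (simp add: exit_trace_def v0_def)
  define S where "S i ui pi \<longleftrightarrow> transport_solution T (\<lambda>x t. lam x t $ i) (\<lambda>x t. lamx x t $ i)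
        (\<lambda>x t. f x t (u x t) $ i) (\<lambda>x t. (fx x t (u x t) + fy x t (u x t) *v p x t) $ i) ui pi \<and>
      (\<forall>x\<in>{0..1}. ui x 0 = \<phi> x $ i) \<and> (\<forall>t\<in>{0..T}. ui (en i) t = h t (exit_trace u t) $ i)" for i ui pi
  have "\<exists>ui pi. S i ui pi" for i
    unfolding S_def
  proof (rule transport.transport_exists[OF transport source_C1_x[OF u] _ _ inflow_deriv[OF u] inflow_deriv_cont[OF u]])
    show "((\<lambda>x. \<phi> x $ i) has_real_derivative \<phi>' x $ i) (at x within {0..1})" if "x \<in> {0..1}" for x
      using \<phi>_x[OF that] by (simp add: has_vector_derivative_components)
    show "continuous_on {0..1} (\<lambda>x. \<phi>' x $ i)" using \<phi>'_cont by (rule continuous_on_component)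
    show "\<phi> (en i) $ i = h 0 (exit_trace u 0) $ i" using compat0 tr0 by simp
    show "(ht 0 (exit_trace u 0) + hz 0 (exit_trace u 0) *v exit_trace q 0) $ i =
        f (en i) 0 (u (en i) 0) $ i - lam (en i) 0 $ i * \<phi>' (en i) $ i"
      using compat1[of i] by (simp add: tr0 q0 u0[OF en_in(1)] velocity_def)
  qed
  then obtain ui pi where S: "\<And>i. S i (ui i) (pi i)" by metis
  have sol: "transport_solution T (\<lambda>x t. lam x t $ i) (\<lambda>x t. lamx x t $ i)
        (\<lambda>x t. f x t (u x t) $ i) (\<lambda>x t. (fx x t (u x t) + fy x t (u x t) *v p x t) $ i) (ui i) (pi i)"
    and ui0: "x \<in> {0..1} \<Longrightarrow> ui i x 0 = \<phi> x $ i"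
    and uib: "t \<in> {0..T} \<Longrightarrow> ui i (en i) t = h t (exit_trace u t) $ i" for i x t
    using S[of i] by (simp_all add: S_def)
  define u' where "u' x t = (\<chi> i. ui i x t)" for x t
  define p' where "p' x t = (\<chi> i. pi i x t)" for x t
  define q' where "q' x t = f x t (u x t) - (\<chi> i. lam x t $ i * p' x t $ i)" for x t
  have C: "C1_x T (\<lambda>x t. u' x t $ i) (\<lambda>x t. p' x t $ i)" for i
    using sol[of i] by (simp add: transport_solution_def u'_def p'_def)
  have p'c: "continuous_on ({0..1} \<times> {0..T}) (\<lambda>(x, t). p' x t)"
    by (rule continuous_on_vec_components) (use C in \<open>simp add: C1_x_def case_prod_unfold\<close>)
  have "continuous_on ({0..1} \<times> {0..T}) (\<lambda>(x, t). q' x t)"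
    using continuous_on_triple[OF f_cont C1vD(2)[OF u]] lam_cont p'c
    unfolding q'_def case_prod_unfold by (intro continuous_intros continuous_on_vec_lambda)
  moreover have u't: "((\<lambda>t. u' x t $ i) has_real_derivative q' x t $ i) (at t within {0..T})"
    if "x \<in> {0..1}" "t \<in> {0..T}" for i x t
    using sol[of i] that by (simp add: transport_solution_def q'_def u'_def p'_def)
  ultimately have C': "C1v u' p' q'" using C by (simp add: C1v_def)
  have u'0: "u' x 0 = \<phi> x" if "x \<in> {0..1}" for x using ui0[OF that] by (simp add: u'_def vec_eq_iff)
  have p'0: "p' x 0 = \<phi>' x" if x: "x \<in> {0..1}" for x
  proof (rule vec_eq_iff[THEN iffD2], rule)
    fix i
    have "((\<lambda>x. u' x 0 $ i) has_real_derivative p' x 0 $ i) (at x within {0..1})"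
      using C[of i] x T by (auto simp: C1_x_def)
    moreover have "((\<lambda>x. \<phi> x $ i) has_real_derivative \<phi>' x $ i) (at x within {0..1})"
      using \<phi>_x[OF x] by (simp add: has_vector_derivative_components)
    ultimately show "p' x 0 $ i = \<phi>' x $ i"
      by (rule has_real_derivative_unique_within_Icc) (use x u'0 in auto)
  qed
  \<comment> \<open>At time 0 the velocity of the new iterate depends on the initial data only, so
    the invariant is reproduced.\<close>
  have "exit_trace q' 0 = v0'"
    by (simp add: exit_trace_def v0'_def q'_def velocity_def p'0[OF en_in(2)] u0[OF en_in(2)])
  then have "admissible u' p' q'" using C' u'0 by (simp add: admissible_def)
  moreover have u'b: "u' (en i) t $ i = h t (exit_trace u t) $ i" if "t \<in> {0..T}" for i t
    using uib[OF that] by (simp add: u'_def)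
  moreover have "q' (en i) t $ i = (ht t (exit_trace u t) + hz t (exit_trace u t) *v exit_trace q t) $ i"
    if t: "t \<in> {0..T}" for i t
    by (rule has_real_derivative_unique_within_Icc[OF u't[OF en_in(1) t] inflow_deriv[OF u t]])
      (use u'b t T in auto)
  moreover have "q' x t $ i = f x t (u x t) $ i - lam x t $ i * p' x t $ i" for i x t
    by (simp add: q'_def)
  ultimately show ?thesis
    using sol p'0 unfolding iterates_def
    by (intro exI[of _ u'] exI[of _ p'] exI[of _ q']) (auto simp: u'_def p'_def)
qed

end

section \<open>Contraction in the weighted norm\<close>

lemma norm_matrix_vector_mult_le:
  fixes A :: "real ^ 'n ^ 'm"
  shows "norm (A *v x) \<le> norm A * norm x"
proof -
  have "norm (A *v x) \<le> L2_set (\<lambda>i. norm (A $ i) * norm x) UNIV"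
    unfolding norm_vec_def[of "A *v x"]
    by (rule L2_set_mono) (simp_all add: matrix_vector_mul_component Cauchy_Schwarz_ineq2)
  also have "\<dots> = norm A * norm x"
    by (simp add: norm_vec_def[of A] L2_set_left_distrib)
  finally show ?thesis .
qed

text \<open>\<open>close a b D\<close> plays the role of a distance bound by \<open>D\<close>. The
  step for the x-derivatives contracts only up to errors that vanish along the sequence, because its
  coefficients depend on the iterates. A tolerance of e / 4 per step leads to e / 2 in total, the
  fixed point of \<open>D \<mapsto> D / 2 + e / 4\<close>.\<close>

lemma eventually_contracting_imp_Cauchy:
  fixes close :: "nat \<Rightarrow> nat \<Rightarrow> real \<Rightarrow> bool"
  assumes mono: "\<And>a b D D'. close a b D \<Longrightarrow> D \<le> D' \<Longrightarrow> close a b D'"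
    and bounded: "\<And>a b. close a b D0" "0 \<le> D0"
    and contr: "\<And>e. e > 0 \<Longrightarrow> \<exists>n. \<forall>a\<ge>n. \<forall>b\<ge>n. \<forall>D\<ge>0. close a b D \<longrightarrow> close (Suc a) (Suc b) (D / 2 + e)"
    and e: "e > 0"
  shows "\<exists>n. \<forall>a\<ge>n. \<forall>b\<ge>n. close a b e"
proof -
  obtain n where n: "\<And>a b D. n \<le> a \<Longrightarrow> n \<le> b \<Longrightarrow> D \<ge> 0 \<Longrightarrow> close a b D \<Longrightarrow> close (Suc a) (Suc b) (D / 2 + e / 4)"
    using contr[of "e / 4"] e by auto
  have iter: "close a b (D0 / 2 ^ k + e / 2)" if "n + k \<le> a" "n + k \<le> b" for a b k
    using that
  proof (induction k arbitrary: a b)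
    case 0
    show ?case using e by (intro mono[OF bounded(1)]) auto
  next
    case (Suc k)
    obtain a' b' where ab: "a = Suc a'" "b = Suc b'" using Suc.prems by (cases a; cases b) auto
    have "close a' b' (D0 / 2 ^ k + e / 2)" using Suc.prems ab by (intro Suc.IH) auto
    then have "close a b ((D0 / 2 ^ k + e / 2) / 2 + e / 4)"
      unfolding ab using Suc.prems ab bounded(2) e by (intro n) auto
    moreover have "(D0 / 2 ^ k + e / 2) / 2 + e / 4 = D0 / 2 ^ Suc k + e / 2" by (simp add: add_divide_distrib)
    ultimately show ?case by (simp only:)
  qed
  have "(\<lambda>k. D0 * (1 / 2) ^ k) \<longlonglongrightarrow> D0 * 0" by (intro tendsto_intros) auto
  then have "(\<lambda>k. D0 * (1 / 2) ^ k) \<longlonglongrightarrow> 0" by simp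
  from order_tendstoD(2)[OF this, of "e / 2"] e
  have "\<forall>\<^sub>F k in sequentially. D0 * (1 / 2) ^ k < e / 2" by simp
  then obtain k where "D0 * (1 / 2) ^ k < e / 2" by (auto simp: eventually_sequentially)
  moreover have "D0 * (1 / 2) ^ k = D0 / 2 ^ k" by (simp add: power_one_over)
  ultimately have "D0 / 2 ^ k + e / 2 \<le> e" by linarith
  then have "close a b e" if "n + k \<le> a" "n + k \<le> b" for a b
    using mono[OF iter[OF that]] by simp
  then show ?thesis by blast
qed

text \<open>\<open>M\<close> bounds the gain of source and boundary map. At the exit the weight
  carries the factor \<open>exp (- r) = 1 / (2 * M)\<close>, so inflow data gain at most
  \<open>M * exp (- r) = 1 / 2\<close>. The source gains \<open>M\<close> against a depth factor
  that may be as small as \<open>1 / (2 * M)\<close>; the part \<open>4 * M\<^sup>2\<close> of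
  \<open>K\<close> turns this into 1 / 2 as well, while \<open>r * \<Lambda>\<close> pays for the
  drop of the weight along characteristics and \<open>L\<close> for the coefficient. \<epsilon>
  collects inhomogeneous terms: relative to the least weight \<open>1 / (2 * M)\<close> at time 0 an
  initial error \<open>M * \<epsilon>\<close> costs
  \<open>2 * M\<^sup>2 * \<epsilon>\<close>.\<close>

lemma (in transport) contraction:
  fixes r K L \<Lambda> M D \<epsilon> :: real
  assumes z: "\<And>\<xi> s t r. characteristic l T \<xi> s t \<Longrightarrow> r \<in> {s..t} \<Longrightarrow>
      ((\<lambda>r. z (\<xi> r) r) has_real_derivative G (\<xi> r) r - c (\<xi> r) r * z (\<xi> r) r) (at r within {s..t})"
    and c_cont: "continuous_on ({0..1} \<times> {0..T}) (\<lambda>(x, t). c x t)"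
    and c_bound: "\<And>x t. x \<in> {0..1} \<Longrightarrow> t \<in> {0..T} \<Longrightarrow> \<bar>c x t\<bar> \<le> L"
    and l_bound: "\<And>x t. x \<in> {0..1} \<Longrightarrow> t \<in> {0..T} \<Longrightarrow> \<bar>l x t\<bar> \<le> \<Lambda>"
    and M: "M \<ge> 1" and D: "D \<ge> 0" and \<epsilon>: "\<epsilon> \<ge> 0"
    and r: "r = ln (2 * M)" and K: "K = r * \<Lambda> + L + 4 * M\<^sup>2"
    and G: "\<And>x t. x \<in> {0..1} \<Longrightarrow> t \<in> {0..T} \<Longrightarrow> \<bar>G x t\<bar> \<le> M * (D * exp (K * t) + \<epsilon>)"
    and init: "\<And>x. x \<in> {0..1} \<Longrightarrow> \<bar>z x 0\<bar> \<le> M * \<epsilon>"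
    and inflow: "\<And>t. t \<in> {0..T} \<Longrightarrow> \<bar>z en t\<bar> \<le> M * (D * exp (K * t - r) + \<epsilon>)"
    and x: "x \<in> {0..1}" and t: "t \<in> {0..T}"
  shows "\<bar>z x t\<bar> \<le> (D / 2 + 2 * M\<^sup>2 * \<epsilon>) * exp (K * t - r * depth x)"
proof -
  define D' where "D' = D / 2 + 2 * M\<^sup>2 * \<epsilon>"
  have D'0: "D' \<ge> 0" using D \<epsilon> by (simp add: D'_def)
  have r0: "r \<ge> 0" using M by (simp add: r)
  have er: "exp (- r) = 1 / (2 * M)" using M by (simp add: r exp_minus inverse_eq_divide)
  have low: "exp (- r) \<le> exp (- r * depth x)" if "x \<in> {0..1}" for x
    using depth_bounds(2)[OF that] r0 by (simp add: mult_left_le)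
  have "0 \<le> \<Lambda>" "0 \<le> L" using l_bound[of 0 0] c_bound[of 0 0] T by (auto intro: order_trans[OF abs_ge_zero])
  then have K0: "K \<ge> 0" using r0 by (simp add: K)
  have "\<bar>z x t\<bar> \<le> D' * exp (K * t - r * depth x)"
  proof (rule comparison[OF z c_cont c_bound, where A' = "\<lambda>_. K" and R' = "\<lambda>_. 0"])
    show "((*) K has_real_derivative K) (at t within {0..T})" for t
      by (auto intro!: derivative_eq_intros)
    show "((\<lambda>_. r) has_real_derivative 0) (at t within {0..T})" for t by simp
    show "\<bar>G x t\<bar> \<le> (K - 0 * depth x - r * \<bar>l x t\<bar> - L) * (D' * exp (K * t - r * depth x))"
      if xt: "x \<in> {0..1}" "t \<in> {0..T}" for x t
    proof -
      have e1: "exp (K * t) \<ge> 1" using K0 xt by simp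
      have "M * \<epsilon> * 1 \<le> (4 * M ^ 3 * \<epsilon>) * exp (K * t)"
      proof (rule mult_mono)
        have "M * 1 \<le> M * (4 * M\<^sup>2)" using M by (intro mult_left_mono) (auto simp: one_le_power mult_ge1_I)
        then show "M * \<epsilon> \<le> 4 * M ^ 3 * \<epsilon>"
          using \<epsilon> by (intro mult_right_mono) (auto simp: power2_eq_square power3_eq_cube mult_ac)
      qed (use e1 M \<epsilon> in auto)
      then have "M * (D * exp (K * t) + \<epsilon>) \<le> (M * D + 4 * M ^ 3 * \<epsilon>) * exp (K * t)"
        by (simp add: algebra_simps)
      also have "\<dots> = 4 * M\<^sup>2 * (D' * (exp (K * t) * exp (- r)))"
        using M unfolding er D'_def by (simp add: field_simps power2_eq_square power3_eq_cube)
      also have "\<dots> \<le> (K - r * \<bar>l x t\<bar> - L) * (D' * (exp (K * t) * exp (- r * depth x)))"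
      proof (rule mult_mono)
        have "r * \<bar>l x t\<bar> \<le> r * \<Lambda>" using l_bound[OF xt] r0 by (rule mult_left_mono)
        then show "4 * M\<^sup>2 \<le> K - r * \<bar>l x t\<bar> - L" by (simp add: K)
        then show "0 \<le> K - r * \<bar>l x t\<bar> - L" by (rule order_trans[rotated]) simp
        show "D' * (exp (K * t) * exp (- r)) \<le> D' * (exp (K * t) * exp (- r * depth x))"
          using low[OF xt(1)] D'0 by (intro mult_left_mono) auto
      qed (use D'0 in auto)
      finally show ?thesis
        using G[OF xt] by (simp add: mult_exp_exp)
    qed
    show "\<bar>z x 0\<bar> \<le> D' * exp (K * 0 - r * depth x)" if "x \<in> {0..1}" for x
    proof -
      have "M * \<epsilon> \<le> D' * exp (- r)"
        using M D \<epsilon> unfolding er D'_def by (simp add: field_simps power2_eq_square)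
      also have "\<dots> \<le> D' * exp (- r * depth x)" using low[OF that] D'0 by (rule mult_left_mono)
      finally show ?thesis using init[OF that] by simp
    qed
    show "\<bar>z en t\<bar> \<le> D' * exp (K * t)" if t: "t \<in> {0..T}" for t
    proof -
      have "exp (K * t) \<ge> 1" using K0 t by simp
      have "M * \<epsilon> * 1 \<le> 2 * M\<^sup>2 * \<epsilon> * exp (K * t)"
      proof (rule mult_mono)
        have "M * 1 \<le> M * (2 * M)" using M by (intro mult_left_mono) auto
        then show "M * \<epsilon> \<le> 2 * M\<^sup>2 * \<epsilon>"
          using \<epsilon> by (intro mult_right_mono) (auto simp: power2_eq_square)
      qed (use \<open>exp (K * t) \<ge> 1\<close> M \<epsilon> in auto)
      moreover have "M * (D * exp (K * t - r)) = D / 2 * exp (K * t)"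
        using M er by (simp add: exp_diff exp_minus field_simps)
      ultimately show ?thesis
        using inflow[OF t] unfolding D'_def distrib_left distrib_right by linarith
    qed
  qed (use D'0 x t in auto)
  then show ?thesis by (simp add: D'_def)
qed

lemma norm_le_card_components:
  fixes v :: "real ^ 'n"
  assumes "\<And>i. \<bar>v $ i\<bar> \<le> C"
  shows "norm v \<le> real CARD('n) * C"
proof -
  have "norm v \<le> (\<Sum>i\<in>UNIV. \<bar>v $ i\<bar>)" by (rule norm_le_l1_cart)
  also have "\<dots> \<le> real CARD('n) * C"
    using sum_bounded_above[of UNIV "\<lambda>i. \<bar>v $ i\<bar>" C] assms by simp
  finally show ?thesis .
qed

lemma (in hyperbolic) C1v_along_characteristic:
  assumes u: "C1v u p q" and \<xi>: "characteristic (\<lambda>x t. lam x t $ i) T \<xi> s t" and r: "r \<in> {s..t}"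
  shows "((\<lambda>r. u (\<xi> r) r $ i) has_real_derivative
    p (\<xi> r) r $ i * lam (\<xi> r) r $ i + q (\<xi> r) r $ i * 1) (at r within {s..t})"
proof (rule has_real_derivative_compose_partials[where A = "{0..1}" and B = "{0..T}" and w = "\<lambda>x t. u x t $ i"
      and wx = "\<lambda>x t. p x t $ i" and wy = "\<lambda>x t. q x t $ i"])
  show "((\<lambda>x. u x t $ i) has_real_derivative p x t $ i) (at x within {0..1})" if "x \<in> {0..1}" "t \<in> {0..T}" for x t
    using C1vD(5)[OF u that] by (simp add: has_vector_derivative_components)
  show "((\<lambda>t. u x t $ i) has_real_derivative q x t $ i) (at t within {0..T})" if "x \<in> {0..1}" "t \<in> {0..T}" for x t
    using C1vD(6)[OF u that] by (simp add: has_vector_derivative_components)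
  show "continuous_on ({0..1} \<times> {0..T}) (\<lambda>(x, t). q x t $ i)"
    using C1vD(4)[OF u] unfolding case_prod_unfold by (rule continuous_on_component)
  have \<xi>': "0 \<le> s" "t \<le> T" "solves (\<lambda>x t. lam x t $ i) \<xi> s t" "\<xi> ` {s..t} \<subseteq> {0..1}"
    using \<xi> by (auto simp: characteristic_def)
  show "(\<xi> has_real_derivative lam (\<xi> r) r $ i) (at r within {s..t})"
    using solvesD[OF \<xi>'(3) r] .
  show "\<xi> ` {s..t} \<subseteq> {0..1}" "(\<lambda>r. r) ` {s..t} \<subseteq> {0..T}" using \<xi>' by auto
qed (use r in \<open>auto intro!: derivative_eq_intros\<close>)

text \<open>One constant \<open>M0\<close> for all bounds on the ball of radius \<rho> in which the
  iterates stay. The lower bound for \<open>lam\<close> serves to recover the x-derivative from the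
  time derivative at the inflow end.\<close>

locale bounded_hyperbolic = hyperbolic T en lam lamx f fx fy h ht hz \<phi> \<phi>'
  for T and en :: "'n::finite \<Rightarrow> real" and lam lamx f fx fy h ht hz \<phi> \<phi>' +
  fixes \<rho> M0 N :: real
  assumes N_def: "N = real CARD('n)" and M0: "1 \<le> M0"
    and lam_le: "\<And>x t i. x \<in> {0..1} \<Longrightarrow> t \<in> {0..T} \<Longrightarrow> \<bar>lam x t $ i\<bar> \<le> M0"
    and lam_ge: "\<And>x t i. x \<in> {0..1} \<Longrightarrow> t \<in> {0..T} \<Longrightarrow> 1 \<le> M0 * \<bar>lam x t $ i\<bar>"
    and lamx_le: "\<And>x t i. x \<in> {0..1} \<Longrightarrow> t \<in> {0..T} \<Longrightarrow> \<bar>lamx x t $ i\<bar> \<le> M0"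
    and f_le: "\<And>x t y. x \<in> {0..1} \<Longrightarrow> t \<in> {0..T} \<Longrightarrow> norm y \<le> \<rho> \<Longrightarrow> norm (f x t y) \<le> M0"
    and fx_le: "\<And>x t y. x \<in> {0..1} \<Longrightarrow> t \<in> {0..T} \<Longrightarrow> norm y \<le> \<rho> \<Longrightarrow> norm (fx x t y) \<le> M0"
    and fy_le: "\<And>x t y. x \<in> {0..1} \<Longrightarrow> t \<in> {0..T} \<Longrightarrow> norm y \<le> \<rho> \<Longrightarrow> norm (fy x t y) \<le> M0"
    and ht_le: "\<And>t z. t \<in> {0..T} \<Longrightarrow> norm z \<le> \<rho> \<Longrightarrow> norm (ht t z) \<le> M0"
    and hz_le: "\<And>t z. t \<in> {0..T} \<Longrightarrow> norm z \<le> \<rho> \<Longrightarrow> norm (hz t z) \<le> M0"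
    and \<phi>'_le: "\<And>x. x \<in> {0..1} \<Longrightarrow> norm (\<phi>' x) \<le> M0"
begin

text \<open>\<open>exp (- \<theta>) = 1 / (2 * M)\<close> compensates the Lipschitz constant of the boundary map, and \<open>K\<close> that of the
  source.\<close>

definition M :: real where "M = 3 * M0 ^ 3 * N"
definition \<theta> :: real where "\<theta> = ln (2 * M)"
definition K :: real where "K = \<theta> * M0 + M0 + 4 * M\<^sup>2"

definition weight :: "'n \<Rightarrow> real \<Rightarrow> real \<Rightarrow> real" where
  "weight i x t = exp (K * t - \<theta> * transport.depth (en i) x)"

text \<open>A relation in place of a weighted supremum norm, so that no finiteness of suprema has to
  be discussed.\<close>

definition close :: "(real \<Rightarrow> real \<Rightarrow> real ^ 'n) \<Rightarrow> (real \<Rightarrow> real \<Rightarrow> real ^ 'n) \<Rightarrow> real \<Rightarrow> bool" where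
  "close u w D \<longleftrightarrow> (\<forall>i. \<forall>x\<in>{0..1}. \<forall>t\<in>{0..T}. \<bar>u x t $ i - w x t $ i\<bar> \<le> D * weight i x t)"

text \<open>Componentwise, as the comparison principle delivers it; a bound by
  \<open>\<rho> / N\<close> per component puts the vector into the ball of radius \<rho>.\<close>

definition in_box :: "(real \<Rightarrow> real \<Rightarrow> real ^ 'n) \<Rightarrow> bool" where
  "in_box u \<longleftrightarrow> (\<forall>i. \<forall>x\<in>{0..1}. \<forall>t\<in>{0..T}. \<bar>u x t $ i\<bar> \<le> \<rho> / N)"

lemma N: "1 \<le> N"
proof -
  have "0 < CARD('n)" by simp
  then show ?thesis by (simp add: N_def Suc_le_eq)
qed

lemma M0_powers: "1 \<le> M0 ^ k" "M0 \<le> M0 ^ 3" "M0\<^sup>2 \<le> M0 ^ 3"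
proof -
  show "1 \<le> M0 ^ k" for k using M0 by simp
  show "M0 \<le> M0 ^ 3" using power_increasing[of 1 3 M0] M0 by simp
  show "M0\<^sup>2 \<le> M0 ^ 3" using M0 by (intro power_increasing) auto
qed

lemma M_ge: "1 \<le> M" "M0 * N \<le> M"
proof -
  have "1 * 1 \<le> M0 ^ 3 * N" using M0_powers(1)[of 3] N M0 by (intro mult_mono) auto
  then show "1 \<le> M" by (simp add: M_def)
  have "M0 * N \<le> M0 ^ 3 * N" using M0_powers N by (auto intro!: mult_right_mono)
  moreover have "0 \<le> M0 ^ 3 * N" using M0 N by simp
  ultimately show "M0 * N \<le> M" by (simp add: M_def)
qed

lemma \<theta>_nonneg: "0 \<le> \<theta>" using M_ge(1) by (simp add: \<theta>_def)

lemma K_nonneg: "0 \<le> K" using \<theta>_nonneg M0 by (simp add: K_def)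

lemma weight_le: "x \<in> {0..1} \<Longrightarrow> weight i x t \<le> exp (K * t)"
  using transport.depth_bounds(1)[OF transport[of i], of x] \<theta>_nonneg by (simp add: weight_def)

lemma weight_ge: "x \<in> {0..1} \<Longrightarrow> t \<in> {0..T} \<Longrightarrow> exp (- \<theta>) \<le> weight i x t"
proof -
  assume "x \<in> {0..1}" "t \<in> {0..T}"
  then have "\<theta> * transport.depth (en i) x \<le> \<theta>" "0 \<le> K * t"
    using transport.depth_bounds(2)[OF transport[of i], of x] \<theta>_nonneg K_nonneg by (auto simp: mult_left_le)
  then show ?thesis by (simp add: weight_def)
qed

lemma weight_pos: "0 < weight i x t" by (simp add: weight_def)

lemma weight_exit: "weight i (1 - en i) t = exp (K * t - \<theta>)"
  by (simp add: weight_def transport.depth_exit[OF transport])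

lemma closeD:
  assumes "close u w D" "x \<in> {0..1}" "t \<in> {0..T}"
  shows "\<bar>u x t $ i - w x t $ i\<bar> \<le> D * weight i x t"
  using assms by (simp add: close_def)

lemma close_mono: "close u w D \<Longrightarrow> D \<le> D' \<Longrightarrow> close u w D'"
  unfolding close_def
proof (intro allI ballI)
  fix i and x t :: real
  assume "\<forall>i. \<forall>x\<in>{0..1}. \<forall>t\<in>{0..T}. \<bar>u x t $ i - w x t $ i\<bar> \<le> D * weight i x t"
    and "D \<le> D'" "x \<in> {0..1}" "t \<in> {0..T}"
  then have "\<bar>u x t $ i - w x t $ i\<bar> \<le> D * weight i x t" "D * weight i x t \<le> D' * weight i x t"
    using weight_pos[of i x t] by (simp_all add: mult_right_mono)
  then show "\<bar>u x t $ i - w x t $ i\<bar> \<le> D' * weight i x t" by linarith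
qed

lemma norm_le_components:
  fixes v :: "real ^ 'n"
  assumes "\<And>i. \<bar>v $ i\<bar> \<le> C"
  shows "norm v \<le> N * C"
  unfolding N_def using assms by (rule norm_le_card_components)

lemma close_norm:
  assumes "close u w D" "0 \<le> D" "x \<in> {0..1}" "t \<in> {0..T}"
  shows "norm (u x t - w x t) \<le> N * (D * exp (K * t))"
proof (rule norm_le_components)
  fix i
  have "\<bar>u x t $ i - w x t $ i\<bar> \<le> D * weight i x t" by (rule closeD[OF assms(1,3,4)])
  also have "\<dots> \<le> D * exp (K * t)" using weight_le[OF assms(3)] assms(2) by (rule mult_left_mono)
  finally show "\<bar>(u x t - w x t) $ i\<bar> \<le> D * exp (K * t)" by simp
qed

lemma close_exit:
  assumes "close u w D" "t \<in> {0..T}"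
  shows "norm (exit_trace u t - exit_trace w t) \<le> N * (D * exp (K * t - \<theta>))"
proof (rule norm_le_components)
  fix i
  show "\<bar>(exit_trace u t - exit_trace w t) $ i\<bar> \<le> D * exp (K * t - \<theta>)"
    using closeD[OF assms(1) en_in(2) assms(2), of i i] by (simp add: exit_trace_def weight_exit)
qed

lemma in_boxD:
  assumes "in_box u" "t \<in> {0..T}"
  shows "x \<in> {0..1} \<Longrightarrow> norm (u x t) \<le> \<rho>" and "norm (exit_trace u t) \<le> \<rho>"
proof -
  have "N * (\<rho> / N) = \<rho>" using N by simp
  then show "norm (exit_trace u t) \<le> \<rho>" "x \<in> {0..1} \<Longrightarrow> norm (u x t) \<le> \<rho>"
    using norm_le_components[of "exit_trace u t" "\<rho> / N"] norm_le_components[of "u x t" "\<rho> / N"]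
      assms en_in unfolding in_box_def exit_trace_def by auto
qed

lemma f_lipschitz:
  assumes "x \<in> {0..1}" "t \<in> {0..T}" "norm y \<le> \<rho>" "norm y' \<le> \<rho>"
  shows "norm (f x t y - f x t y') \<le> M0 * norm (y - y')"
proof (rule differentiable_bound[where S = "cball 0 \<rho>" and f' = "\<lambda>y v. fy x t y *v v"])
  show "onorm (\<lambda>v. fy x t y *v v) \<le> M0" if "y \<in> cball 0 \<rho>" for y
  proof (rule onorm_le)
    fix v
    have "norm (fy x t y) \<le> M0" using that assms fy_le by simp
    then show "norm (fy x t y *v v) \<le> M0 * norm v"
      by (rule order_trans[OF norm_matrix_vector_mult_le mult_right_mono[OF _ norm_ge_zero]])
  qed
  show "(f x t has_derivative (\<lambda>v. fy x t y *v v)) (at y within cball 0 \<rho>)" for y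
    using f_y[OF assms(1,2)] by (rule has_derivative_at_withinI)
qed (use assms in auto)

lemma h_lipschitz:
  assumes "t \<in> {0..T}" "norm z \<le> \<rho>" "norm z' \<le> \<rho>"
  shows "norm (h t z - h t z') \<le> M0 * norm (z - z')"
proof (rule differentiable_bound[where S = "cball 0 \<rho>" and f' = "\<lambda>y v. hz t y *v v"])
  show "onorm (\<lambda>v. hz t y *v v) \<le> M0" if "y \<in> cball 0 \<rho>" for y
  proof (rule onorm_le)
    fix v
    have "norm (hz t y) \<le> M0" using that assms hz_le by simp
    then show "norm (hz t y *v v) \<le> M0 * norm v"
      by (rule order_trans[OF norm_matrix_vector_mult_le mult_right_mono[OF _ norm_ge_zero]])
  qed
  show "(h t has_derivative (\<lambda>v. hz t y *v v)) (at y within cball 0 \<rho>)" for y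
    using h_z[OF assms(1)] by (rule has_derivative_at_withinI)
qed (use assms in auto)

text \<open>Old and new functions are kept apart, so that the same estimate serves the iteration
  and, with \<open>u' = u\<close> and \<open>w' = w\<close>, uniqueness. The difference vanishes
  initially and the dependence on the state sits in the source difference, so \<epsilon> and the
  coefficient \<open>c\<close> are 0.\<close>

lemma u_contraction:
  assumes u: "C1v u' p' q'" and w: "C1v w' pw' qw'"
    and ueq: "\<And>x t i. x \<in> {0..1} \<Longrightarrow> t \<in> {0..T} \<Longrightarrow> q' x t $ i = f x t (u x t) $ i - lam x t $ i * p' x t $ i"
    and weq: "\<And>x t i. x \<in> {0..1} \<Longrightarrow> t \<in> {0..T} \<Longrightarrow> qw' x t $ i = f x t (w x t) $ i - lam x t $ i * pw' x t $ i"
    and ub: "\<And>t i. t \<in> {0..T} \<Longrightarrow> u' (en i) t $ i = h t (exit_trace u t) $ i"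
    and wb: "\<And>t i. t \<in> {0..T} \<Longrightarrow> w' (en i) t $ i = h t (exit_trace w t) $ i"
    and init: "\<And>x. x \<in> {0..1} \<Longrightarrow> u' x 0 = w' x 0"
    and box: "in_box u" "in_box w"
    and cl: "close u w D" and D: "0 \<le> D"
  shows "close u' w' (D / 2)"
  unfolding close_def
proof (intro allI ballI)
  fix i and x t :: real assume x: "x \<in> {0..1}" and t: "t \<in> {0..T}"
  have "\<bar>u' x t $ i - w' x t $ i\<bar> \<le> (D / 2 + 2 * M\<^sup>2 * 0) * exp (K * t - \<theta> * transport.depth (en i) x)"
  proof (rule transport.contraction[OF transport, where c = "\<lambda>_ _. 0" and L = M0 and \<Lambda> = M0
        and G = "\<lambda>x t. f x t (u x t) $ i - f x t (w x t) $ i"])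
    show "((\<lambda>r. u' (\<xi> r) r $ i - w' (\<xi> r) r $ i) has_real_derivative
        f (\<xi> r) r (u (\<xi> r) r) $ i - f (\<xi> r) r (w (\<xi> r) r) $ i - 0 * (u' (\<xi> r) r $ i - w' (\<xi> r) r $ i))
        (at r within {s..t})"
      if \<xi>: "characteristic (\<lambda>x t. lam x t $ i) T \<xi> s t" and r: "r \<in> {s..t}" for \<xi> s t r
    proof -
      have mem: "\<xi> r \<in> {0..1}" "r \<in> {0..T}" using \<xi> r by (auto simp: characteristic_def image_subset_iff)
      show ?thesis
        by (rule DERIV_cong[OF DERIV_diff[OF C1v_along_characteristic[OF u \<xi> r] C1v_along_characteristic[OF w \<xi> r]]])
          (simp add: ueq[OF mem] weq[OF mem])
    qed
    show "\<bar>f x t (u x t) $ i - f x t (w x t) $ i\<bar> \<le> M * (D * exp (K * t) + 0)"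
      if xt: "x \<in> {0..1}" "t \<in> {0..T}" for x t
    proof -
      have "\<bar>f x t (u x t) $ i - f x t (w x t) $ i\<bar> \<le> norm (f x t (u x t) - f x t (w x t))"
        using component_le_norm_cart[of "f x t (u x t) - f x t (w x t)" i] by simp
      also have "\<dots> \<le> M0 * norm (u x t - w x t)" using xt in_boxD box by (intro f_lipschitz) auto
      also have "\<dots> \<le> M0 * (N * (D * exp (K * t)))" using M0 close_norm[OF cl D xt] by (intro mult_left_mono) auto
      also have "\<dots> = (M0 * N) * (D * exp (K * t))" by simp
      also have "\<dots> \<le> M * (D * exp (K * t))" using M_ge D by (intro mult_right_mono) auto
      finally show ?thesis by simp
    qed
    show "\<bar>u' (en i) t $ i - w' (en i) t $ i\<bar> \<le> M * (D * exp (K * t - \<theta>) + 0)" if t: "t \<in> {0..T}" for t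
    proof -
      have "\<bar>u' (en i) t $ i - w' (en i) t $ i\<bar> \<le> norm (h t (exit_trace u t) - h t (exit_trace w t))"
        using component_le_norm_cart[of "h t (exit_trace u t) - h t (exit_trace w t)" i] ub[OF t] wb[OF t] by simp
      also have "\<dots> \<le> M0 * norm (exit_trace u t - exit_trace w t)"
        using t in_boxD box by (intro h_lipschitz) auto
      also have "\<dots> \<le> M0 * (N * (D * exp (K * t - \<theta>)))"
        using M0 close_exit[OF cl t] by (intro mult_left_mono) auto
      also have "\<dots> = (M0 * N) * (D * exp (K * t - \<theta>))" by simp
      also have "\<dots> \<le> M * (D * exp (K * t - \<theta>))" using M_ge D by (intro mult_right_mono) auto
      finally show ?thesis by simp
    qed
  qed (use M_ge D x t init lam_le M0 in \<open>auto simp: \<theta>_def K_def\<close>)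
  then show "\<bar>u' x t $ i - w' x t $ i\<bar> \<le> D / 2 * weight i x t" by (simp add: weight_def)
qed

end

section \<open>Limits, uniform continuity in the state, and the linear step for the
  x-derivatives\<close>

lemma has_real_derivative_uniform_limit:
  fixes f :: "nat \<Rightarrow> real \<Rightarrow> real"
  assumes f: "\<And>n x. x \<in> {a..b} \<Longrightarrow> (f n has_real_derivative f' n x) (at x within {a..b})"
    and f': "uniform_limit {a..b} f' g' sequentially"
    and g: "\<And>x. x \<in> {a..b} \<Longrightarrow> (\<lambda>n. f n x) \<longlonglongrightarrow> g x"
    and x: "x \<in> {a..b}"
  shows "(g has_real_derivative g' x) (at x within {a..b})"
proof -
  have "\<exists>h. \<forall>x\<in>{a..b}. (\<lambda>n. f n x) \<longlonglongrightarrow> h x \<and> (h has_derivative (*) (g' x)) (at x within {a..b})"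
  proof (rule has_derivative_sequence[where f' = "\<lambda>n x h. f' n x * h" and l = "g x", OF _ _ _ x])
    show "(\<lambda>n. f n x) \<longlonglongrightarrow> g x" by (rule g[OF x])
    show "(f n has_derivative (*) (f' n x)) (at x within {a..b})" if "x \<in> {a..b}" for n x
      using f[OF that] by (simp add: has_field_derivative_def)
    show "\<forall>\<^sub>F n in sequentially. \<forall>x\<in>{a..b}. \<forall>h. norm (f' n x * h - g' x * h) \<le> e * norm h"
      if "e > 0" for e
      using uniform_limitD[OF f' that]
    proof eventually_elim
      case (elim n)
      show ?case
      proof (intro ballI allI)
        fix x h assume "x \<in> {a..b}"
        then have "\<bar>f' n x - g' x\<bar> \<le> e" using elim by (force simp: dist_real_def intro: less_imp_le)
        then show "norm (f' n x * h - g' x * h) \<le> e * norm h"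
          by (simp add: abs_mult mult_right_mono flip: left_diff_distrib)
      qed
    qed
  qed auto
  then obtain h where h: "\<And>x. x \<in> {a..b} \<Longrightarrow> (\<lambda>n. f n x) \<longlonglongrightarrow> h x"
    "\<And>x. x \<in> {a..b} \<Longrightarrow> (h has_real_derivative g' x) (at x within {a..b})"
    unfolding has_field_derivative_def by blast
  have "h y = g y" if "y \<in> {a..b}" for y using h(1)[OF that] g[OF that] by (rule LIMSEQ_unique)
  then show ?thesis
    using has_field_derivative_transform_within[OF h(2)[OF x] zero_less_one x] by simp
qed

text \<open>The derivatives of f and h are only continuous, so their differences at two iterates are
  estimated by uniform continuity on a compact set and not by a Lipschitz bound.\<close>

lemma uniformly_continuous_in_state:
  fixes F :: "real \<Rightarrow> real \<Rightarrow> real ^ 'n \<Rightarrow> 'b::metric_space"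
  assumes F: "continuous_on ({0..1} \<times> {0..T} \<times> UNIV) (\<lambda>(x, t, y). F x t y)" and e: "e > 0"
  shows "\<exists>\<delta>>0. \<forall>x\<in>{0..1}. \<forall>t\<in>{0..T}. \<forall>y y'. norm y \<le> \<rho> \<longrightarrow> norm y' \<le> \<rho> \<longrightarrow> norm (y - y') < \<delta> \<longrightarrow>
    dist (F x t y) (F x t y') < e"
proof -
  have "compact ({0..1::real} \<times> {0..T} \<times> cball (0 :: real ^ 'n) \<rho>)" by (intro compact_Times) auto
  moreover have "continuous_on ({0..1} \<times> {0..T} \<times> cball 0 \<rho>) (\<lambda>(x, t, y). F x t y)"
    by (rule continuous_on_subset[OF F]) auto
  ultimately have "uniformly_continuous_on ({0..1} \<times> {0..T} \<times> cball 0 \<rho>) (\<lambda>(x, t, y). F x t y)"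
    by (intro compact_uniformly_continuous)
  then obtain \<delta> where \<delta>: "\<delta> > 0"
    and F': "\<And>p q. p \<in> {0..1} \<times> {0..T} \<times> cball 0 \<rho> \<Longrightarrow> q \<in> {0..1} \<times> {0..T} \<times> cball 0 \<rho> \<Longrightarrow> dist q p < \<delta> \<Longrightarrow>
      dist (case q of (x, t, y) \<Rightarrow> F x t y) (case p of (x, t, y) \<Rightarrow> F x t y) < e"
    using e unfolding uniformly_continuous_on_def by metis
  have "dist (F x t y) (F x t y') < e"
    if "x \<in> {0..1}" "t \<in> {0..T}" "norm y \<le> \<rho>" "norm y' \<le> \<rho>" "norm (y - y') < \<delta>" for x t y y'
    using F'[of "(x, t, y')" "(x, t, y)"] that by (simp add: dist_Pair_Pair dist_norm)
  then show ?thesis using \<delta> by blast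
qed

lemma (in hyperbolic) continuous_on_ignore_x:
  assumes "continuous_on ({0..T} \<times> UNIV) (\<lambda>(t, z). F t z)"
  shows "continuous_on ({0..1} \<times> {0..T} \<times> UNIV) (\<lambda>(x :: real, t, z). F t z)"
  unfolding case_prod_unfold
  by (intro continuous_on_compose_Pair[OF assms] continuous_intros) auto

definition (in hyperbolic) solution where
  "solution u p q \<longleftrightarrow> C1v u p q \<and> (\<forall>x\<in>{0..1}. u x 0 = \<phi> x) \<and>
     (\<forall>i. \<forall>x\<in>{0..1}. \<forall>t\<in>{0..T}. q x t $ i = f x t (u x t) $ i - lam x t $ i * p x t $ i) \<and>
     (\<forall>i. \<forall>t\<in>{0..T}. u (en i) t $ i = h t (exit_trace u t) $ i)"

context bounded_hyperbolic begin

text \<open>One step for the x-derivatives, with \<open>z\<close> a component of an iterate or of a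
  difference of two: \<open>d\<close> is the previous x-derivative and \<open>w\<close> the previous
  exit trace of the time derivative. At inflow there is one factor \<open>M0\<close> each for the
  division by the speed, for the boundary map and for the passage from x-derivative to time
  derivative. \<open>e\<close> collects the inhomogeneous terms.\<close>

lemma linear_step:
  assumes z: "\<And>\<xi> s t r. characteristic (\<lambda>x t. lam x t $ i) T \<xi> s t \<Longrightarrow> r \<in> {s..t} \<Longrightarrow>
      ((\<lambda>r. z (\<xi> r) r) has_real_derivative G (\<xi> r) r - lamx (\<xi> r) r $ i * z (\<xi> r) r) (at r within {s..t})"
    and d: "\<And>j x t. x \<in> {0..1} \<Longrightarrow> t \<in> {0..T} \<Longrightarrow> \<bar>d x t $ j\<bar> \<le> D * weight j x t"
    and D: "0 \<le> D" and e: "0 \<le> e"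
    and G: "\<And>x t. x \<in> {0..1} \<Longrightarrow> t \<in> {0..T} \<Longrightarrow> \<bar>G x t\<bar> \<le> e + M0 * norm (d x t)"
    and init: "\<And>x. x \<in> {0..1} \<Longrightarrow> \<bar>z x 0\<bar> \<le> e"
    and inflow: "\<And>t. t \<in> {0..T} \<Longrightarrow> \<bar>z (en i) t\<bar> \<le> M0 * (e + M0 * norm (w t))"
    and w: "\<And>j t. t \<in> {0..T} \<Longrightarrow> \<bar>w t $ j\<bar> \<le> e + M0 * \<bar>d (1 - en j) t $ j\<bar>"
    and x: "x \<in> {0..1}" and t: "t \<in> {0..T}"
  shows "\<bar>z x t\<bar> \<le> (D / 2 + 2 * M\<^sup>2 * e) * weight i x t"
  unfolding weight_def
proof (rule transport.contraction[OF transport z, where L = M0 and \<Lambda> = M0])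
  show "continuous_on ({0..1} \<times> {0..T}) (\<lambda>(x, t). lamx x t $ i)"
    using lam_C1_x[of i] by (simp add: C1_x_def)
  show "\<bar>G x t\<bar> \<le> M * (D * exp (K * t) + e)" if xt: "x \<in> {0..1}" "t \<in> {0..T}" for x t
  proof -
    have "\<bar>d x t $ j\<bar> \<le> D * exp (K * t)" for j
      using d[OF xt, of j] mult_left_mono[OF weight_le[OF xt(1), of j t] D] by linarith
    then have "norm (d x t) \<le> N * (D * exp (K * t))" by (rule norm_le_components)
    then have "M0 * norm (d x t) \<le> M0 * (N * (D * exp (K * t)))" using M0 by (intro mult_left_mono) auto
    also have "\<dots> = (M0 * N) * (D * exp (K * t))" by simp
    also have "\<dots> \<le> M * (D * exp (K * t))" using M_ge D by (intro mult_right_mono) auto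
    finally have "M0 * norm (d x t) \<le> M * (D * exp (K * t))" .
    moreover have "1 * e \<le> M * e" using M_ge e by (intro mult_right_mono) auto
    ultimately show ?thesis using G[OF xt] unfolding distrib_left by linarith
  qed
  show "\<bar>z x 0\<bar> \<le> M * e" if "x \<in> {0..1}" for x
    using init[OF that] mult_right_mono[OF M_ge(1) e] by simp
  show "\<bar>z (en i) t\<bar> \<le> M * (D * exp (K * t - \<theta>) + e)" if t: "t \<in> {0..T}" for t
  proof -
    let ?E = "D * exp (K * t - \<theta>)"
    have "\<bar>w t $ j\<bar> \<le> e + M0 * ?E" for j
      using w[OF t, of j] mult_left_mono[OF d[OF en_in(2) t, of j j], of M0] M0 unfolding weight_exit by linarith
    then have "norm (w t) \<le> N * (e + M0 * ?E)" by (rule norm_le_components)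
    then have "M0 * (e + M0 * norm (w t)) \<le> M0 * (e + M0 * (N * (e + M0 * ?E)))"
      using M0 by (intro mult_left_mono add_left_mono) auto
    \<comment> \<open>Each of the three terms is at most \<open>M0 ^ 3 * N\<close> times
      \<open>e\<close> or the weighted bound at the exit. This is the origin of
      \<open>M = 3 * M0 ^ 3 * N\<close>.\<close>
    also have "\<dots> = M0 * e + M0\<^sup>2 * N * e + M0 ^ 3 * N * ?E"
      by (simp add: algebra_simps power2_eq_square power3_eq_cube)
    also have "\<dots> \<le> M0 ^ 3 * N * e + M0 ^ 3 * N * e + M0 ^ 3 * N * ?E"
    proof (intro add_mono order_refl mult_right_mono e)
      have "M0 * 1 \<le> M0 ^ 3 * N" using M0_powers N M0 by (intro mult_mono) auto
      then show "M0 \<le> M0 ^ 3 * N" by simp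
    qed (use M0_powers N in auto)
    also have "\<dots> \<le> M * (?E + e)"
    proof -
      have "0 \<le> M0 ^ 3 * N * e" "0 \<le> M0 ^ 3 * N * ?E" using M0 N e D by simp_all
      then show ?thesis by (simp add: M_def algebra_simps)
    qed
    finally show ?thesis using inflow[OF t] by linarith
  qed
qed (use M_ge(1) D e x t lam_le lamx_le in \<open>auto simp: \<theta>_def K_def\<close>)

lemma in_box_close:
  assumes "in_box u" "in_box w"
  shows "close u w (2 * (\<rho> / N) * exp \<theta>)" and "0 \<le> 2 * (\<rho> / N) * exp \<theta>"
proof -
  have "\<bar>u 0 0 $ i\<bar> \<le> \<rho> / N" for i using assms(1) T by (auto simp: in_box_def)
  then have "0 \<le> \<rho> / N" using abs_ge_zero order_trans by blast
  then show D0: "0 \<le> 2 * (\<rho> / N) * exp \<theta>" by (intro mult_nonneg_nonneg) auto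
  show "close u w (2 * (\<rho> / N) * exp \<theta>)"
    unfolding close_def
  proof (intro allI ballI)
    fix i and x t :: real assume xt: "x \<in> {0..1}" "t \<in> {0..T}"
    have "\<bar>u x t $ i\<bar> \<le> \<rho> / N" "\<bar>w x t $ i\<bar> \<le> \<rho> / N" using assms xt unfolding in_box_def by blast+
    then have "\<bar>u x t $ i - w x t $ i\<bar> \<le> 2 * (\<rho> / N)" by simp
    \<comment> \<open>\<open>exp (- \<theta>)\<close> is the least value of the weight.\<close>
    also have "\<dots> = 2 * (\<rho> / N) * exp \<theta> * exp (- \<theta>)" by (simp add: exp_minus)
    also have "\<dots> \<le> 2 * (\<rho> / N) * exp \<theta> * weight i x t" using weight_ge[OF xt] D0 by (rule mult_left_mono)
    finally show "\<bar>u x t $ i - w x t $ i\<bar> \<le> 2 * (\<rho> / N) * exp \<theta> * weight i x t" .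
  qed
qed

text \<open>A solution is its own iterate, so every bound on the weighted distance of two solutions
  can be halved.\<close>

lemma solution_unique:
  assumes u: "solution u p q" and w: "solution w pw qw" and box: "in_box u" "in_box w"
    and x: "x \<in> {0..1}" and t: "t \<in> {0..T}"
  shows "u x t = w x t"
proof -
  have halve: "close u w (D / 2)" if "close u w D" "0 \<le> D" for D
    by (rule u_contraction[where u = u and w = w]) (use u w box that in \<open>auto simp: solution_def\<close>)
  define D0 where "D0 = 2 * (\<rho> / N) * exp \<theta>"
  have D0: "0 \<le> D0" and "close u w D0" unfolding D0_def using in_box_close[OF box] by simp_all
  then have pow: "close u w (D0 / 2 ^ k)" for k
  proof (induction k)
    case (Suc k)
    then have "close u w (D0 / 2 ^ k / 2)" using D0 by (intro halve) auto
    then show ?case by (simp add: mult.commute)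
  qed simp
  have "u x t $ i = w x t $ i" for i
  proof -
    have "(\<lambda>k. (D0 * (1 / 2) ^ k) * weight i x t) \<longlonglongrightarrow> (D0 * 0) * weight i x t"
      by (intro tendsto_intros) auto
    then have "(\<lambda>k. D0 / 2 ^ k * weight i x t) \<longlonglongrightarrow> 0" by (simp add: power_one_over)
    then have "\<bar>u x t $ i - w x t $ i\<bar> \<le> 0"
      by (rule Lim_bounded2) (use closeD[OF pow x t] in auto)
    then show ?thesis by simp
  qed
  then show ?thesis by (simp add: vec_eq_iff)
qed

end

section \<open>Convergence of the iteration\<close>

locale iteration = bounded_hyperbolic T en lam lamx f fx fy h ht hz \<phi> \<phi>' \<rho> M0 N
  for T and en :: "'n::finite \<Rightarrow> real" and lam lamx f fx fy h ht hz \<phi> \<phi>' \<rho> M0 N +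
  fixes U P Q :: "nat \<Rightarrow> real \<Rightarrow> real \<Rightarrow> real ^ 'n"
  assumes adm: "\<And>m. admissible (U m) (P m) (Q m)"
    and iter: "\<And>m. iterates (U m) (P m) (Q m) (U (Suc m)) (P (Suc m)) (Q (Suc m))"
    and box: "\<And>m. in_box (U m)"
begin

lemma U_C1v: "C1v (U m) (P m) (Q m)"
  using adm[of m] by (simp add: admissible_def)

lemma Q_eq: "x \<in> {0..1} \<Longrightarrow> t \<in> {0..T} \<Longrightarrow>
    Q (Suc m) x t $ i = f x t (U m x t) $ i - lam x t $ i * P (Suc m) x t $ i"
  using iter[of m] unfolding iterates_def by blast

lemma P_characteristic:
  assumes "characteristic (\<lambda>x t. lam x t $ i) T \<xi> s t" "r \<in> {s..t}"
  shows "((\<lambda>r. P (Suc m) (\<xi> r) r $ i) has_real_derivative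
     (fx (\<xi> r) r (U m (\<xi> r) r) + fy (\<xi> r) r (U m (\<xi> r) r) *v P m (\<xi> r) r) $ i -
     lamx (\<xi> r) r $ i * P (Suc m) (\<xi> r) r $ i) (at r within {s..t})"
proof -
  have "transport_solution T (\<lambda>x t. lam x t $ i) (\<lambda>x t. lamx x t $ i) (\<lambda>x t. f x t (U m x t) $ i)
      (\<lambda>x t. (fx x t (U m x t) + fy x t (U m x t) *v P m x t) $ i)
      (\<lambda>x t. U (Suc m) x t $ i) (\<lambda>x t. P (Suc m) x t $ i)"
    using iter[of m] unfolding iterates_def by blast
  then show ?thesis using assms unfolding transport_solution_def by blast
qed

lemma P_init: "x \<in> {0..1} \<Longrightarrow> P (Suc m) x 0 = \<phi>' x"
  using iter[of m] unfolding iterates_def by blast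

text \<open>The boundary condition for u_x: the equation is solved at the inflow end for
  \<open>lam\<close> times u_x, with the time derivative of the boundary datum in place of
  u_t.\<close>

lemma P_inflow:
  assumes t: "t \<in> {0..T}"
  shows "lam (en i) t $ i * P (Suc m) (en i) t $ i = f (en i) t (U m (en i) t) $ i -
    (ht t (exit_trace (U m) t) + hz t (exit_trace (U m) t) *v exit_trace (Q m) t) $ i"
proof -
  have "Q (Suc m) (en i) t $ i = (ht t (exit_trace (U m) t) + hz t (exit_trace (U m) t) *v exit_trace (Q m) t) $ i"
    using iter[of m] t unfolding iterates_def by blast
  then show ?thesis using Q_eq[OF en_in(1) t, where m = m and i = i] by simp
qed

lemma U_close:
  assumes e: "e > 0"
  shows "\<exists>n. \<forall>a\<ge>n. \<forall>b\<ge>n. close (U a) (U b) e"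
proof (rule eventually_contracting_imp_Cauchy[where close = "\<lambda>a b. close (U a) (U b)"])
  show "close (U a) (U b) (2 * (\<rho> / N) * exp \<theta>)" for a b by (rule in_box_close(1)[OF box box])
  show "0 \<le> 2 * (\<rho> / N) * exp \<theta>" by (rule in_box_close(2)[OF box box])
  fix e :: real assume e: "e > 0"
  have "close (U (Suc a)) (U (Suc b)) (D / 2 + e)" if "close (U a) (U b) D" "0 \<le> D" for a b D
  proof (rule close_mono)
    show "close (U (Suc a)) (U (Suc b)) (D / 2)"
      by (rule u_contraction[OF U_C1v U_C1v Q_eq Q_eq _ _ _ box box that])
        (use iter adm in \<open>simp_all add: iterates_def admissible_def\<close>)
  qed (use e in simp)
  then show "\<exists>n. \<forall>a\<ge>n. \<forall>b\<ge>n. \<forall>D\<ge>0. close (U a) (U b) D \<longrightarrow> close (U (Suc a)) (U (Suc b)) (D / 2 + e)"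
    by blast
next
  show "close (U a) (U b) D'" if "close (U a) (U b) D" "D \<le> D'" for a b D D'
    using that by (rule close_mono)
qed (rule e)

lemma close_imp_dist:
  assumes e: "e > 0"
    and cl: "\<And>e. e > 0 \<Longrightarrow> \<exists>n. \<forall>a\<ge>n. \<forall>b\<ge>n. close (V a) (V b) e"
  shows "\<exists>n. \<forall>a\<ge>n. \<forall>b\<ge>n. \<forall>t\<in>{0..T}. (\<forall>x\<in>{0..1}. norm (V a x t - V b x t) < e) \<and>
    norm (exit_trace (V a) t - exit_trace (V b) t) < e"
proof -
  \<comment> \<open>The weight is at most \<open>exp (K * T)\<close> and the norm costs a factor
    \<open>N\<close>; the 2 makes the inequality strict.\<close>
  define D where "D = e / (2 * N * exp (K * T))"
  have D: "D > 0" using e N by (simp add: D_def)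
  have small: "N * (D * exp s) < e" if "s \<le> K * T" for s
  proof -
    have "N * (D * exp s) \<le> N * (D * exp (K * T))" using that N D by (intro mult_left_mono) auto
    also have "\<dots> = e / 2" using N by (simp add: D_def)
    finally show ?thesis using e by simp
  qed
  obtain n where n: "\<And>a b. n \<le> a \<Longrightarrow> n \<le> b \<Longrightarrow> close (V a) (V b) D" using cl[OF D] by blast
  have "norm (V a x t - V b x t) < e" if "n \<le> a" "n \<le> b" "t \<in> {0..T}" "x \<in> {0..1}" for a b x t
    using close_norm[OF n[OF that(1,2)] _ that(4,3)] small[of "K * t"] D K_nonneg that(3)
    by (simp add: mult_left_mono)
  moreover have "norm (exit_trace (V a) t - exit_trace (V b) t) < e" if "n \<le> a" "n \<le> b" "t \<in> {0..T}" for a b t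
  proof -
    have "K * t \<le> K * T" using K_nonneg that(3) by (intro mult_left_mono) auto
    then have "K * t - \<theta> \<le> K * T" using \<theta>_nonneg by linarith
    from small[OF this] close_exit[OF n[OF that(1,2)] that(3)] show ?thesis by linarith
  qed
  ultimately show ?thesis by blast
qed

text \<open>Stated with the product filter, so that \<open>P_close\<close> can combine the smallness
  conditions for the several nonlinearities without tracking indices.\<close>

lemma state_small:
  fixes F :: "real \<Rightarrow> real \<Rightarrow> real ^ 'n \<Rightarrow> 'b::metric_space"
  assumes F: "continuous_on ({0..1} \<times> {0..T} \<times> UNIV) (\<lambda>(x, t, y). F x t y)" and e: "e > 0"
  shows "\<forall>\<^sub>F (a, b) in sequentially \<times>\<^sub>F sequentially. \<forall>x\<in>{0..1}. \<forall>t\<in>{0..T}.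
    dist (F x t (U a x t)) (F x t (U b x t)) < e"
proof -
  obtain \<delta> where \<delta>: "\<delta> > 0" and F': "\<And>x t y y'. x \<in> {0..1} \<Longrightarrow> t \<in> {0..T} \<Longrightarrow> norm y \<le> \<rho> \<Longrightarrow> norm y' \<le> \<rho> \<Longrightarrow>
      norm (y - y') < \<delta> \<Longrightarrow> dist (F x t y) (F x t y') < e"
    using uniformly_continuous_in_state[OF F e] by blast
  obtain n where "\<And>a b t x. n \<le> a \<Longrightarrow> n \<le> b \<Longrightarrow> t \<in> {0..T} \<Longrightarrow> x \<in> {0..1} \<Longrightarrow> norm (U a x t - U b x t) < \<delta>"
    using close_imp_dist[OF \<delta> U_close] by blast
  then have "dist (F x t (U a x t)) (F x t (U b x t)) < e"
    if "n \<le> a" "n \<le> b" "x \<in> {0..1}" "t \<in> {0..T}" for a b x t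
    using that by (intro F' in_boxD(1)[OF box])
  then show ?thesis unfolding eventually_prod_sequentially by (intro exI[of _ n]) simp
qed

lemma trace_small:
  fixes F :: "real \<Rightarrow> real ^ 'n \<Rightarrow> 'b::metric_space"
  assumes F: "continuous_on ({0..T} \<times> UNIV) (\<lambda>(t, y). F t y)" and e: "e > 0"
  shows "\<forall>\<^sub>F (a, b) in sequentially \<times>\<^sub>F sequentially. \<forall>t\<in>{0..T}.
    dist (F t (exit_trace (U a) t)) (F t (exit_trace (U b) t)) < e"
proof -
  obtain \<delta> where \<delta>: "\<delta> > 0" and F': "\<And>x t y y'. x \<in> {0..1::real} \<Longrightarrow> t \<in> {0..T} \<Longrightarrow> norm y \<le> \<rho> \<Longrightarrow> norm y' \<le> \<rho> \<Longrightarrow>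
      norm (y - y') < \<delta> \<Longrightarrow> dist (F t y) (F t y') < e"
    using uniformly_continuous_in_state[OF continuous_on_ignore_x[OF F] e] by blast
  obtain n where "\<And>a b t. n \<le> a \<Longrightarrow> n \<le> b \<Longrightarrow> t \<in> {0..T} \<Longrightarrow> norm (exit_trace (U a) t - exit_trace (U b) t) < \<delta>"
    using close_imp_dist[OF \<delta> U_close] by blast
  then have "dist (F t (exit_trace (U a) t)) (F t (exit_trace (U b) t)) < e"
    if "n \<le> a" "n \<le> b" "t \<in> {0..T}" for a b t
    using that in_boxD(2)[OF box] by (intro F'[of 0]) auto
  then show ?thesis unfolding eventually_prod_sequentially by (intro exI[of _ n]) simp
qed

lemma eventually_Suc_both:
  assumes "\<forall>\<^sub>F (a, b) in sequentially \<times>\<^sub>F sequentially. R a b"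
  shows "\<forall>\<^sub>F (a, b) in sequentially \<times>\<^sub>F sequentially. R (Suc a) (Suc b)"
proof -
  obtain n where "\<forall>a\<ge>n. \<forall>b\<ge>n. R b a" using assms unfolding eventually_prod_sequentially by auto
  then show ?thesis unfolding eventually_prod_sequentially by (intro exI[of _ n]) simp
qed

lemma divide_lam_le:
  assumes "x \<in> {0..1}" "t \<in> {0..T}" "\<bar>lam x t $ i * z\<bar> \<le> C"
  shows "\<bar>z\<bar> \<le> M0 * C"
proof -
  have "1 * \<bar>z\<bar> \<le> M0 * \<bar>lam x t $ i\<bar> * \<bar>z\<bar>" using lam_ge[OF assms(1,2)] by (intro mult_right_mono) auto
  also have "\<dots> = M0 * \<bar>lam x t $ i * z\<bar>" by (simp add: abs_mult)
  also have "\<dots> \<le> M0 * C" using assms(3) M0 by (intro mult_left_mono) auto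
  finally show ?thesis by simp
qed

lemma exit_Q_le:
  assumes t: "t \<in> {0..T}"
  shows "\<bar>exit_trace (Q (Suc m)) t $ j\<bar> \<le> M0 + M0 * \<bar>P (Suc m) (1 - en j) t $ j\<bar>"
proof -
  have "\<bar>f (1 - en j) t (U m (1 - en j) t) $ j\<bar> \<le> M0"
    by (rule order_trans[OF component_le_norm_cart f_le[OF en_in(2) t in_boxD(1)[OF box t en_in(2)]]])
  moreover have "\<bar>lam (1 - en j) t $ j * P (Suc m) (1 - en j) t $ j\<bar> \<le> M0 * \<bar>P (Suc m) (1 - en j) t $ j\<bar>"
    unfolding abs_mult by (intro mult_right_mono lam_le en_in t) simp
  ultimately show ?thesis
    by (simp add: exit_trace_def Q_eq[OF en_in(2) t])
qed

text \<open>The bounds start at index 1, because the derivatives of the initial iterate need not be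
  related by \<open>Q_eq\<close>, from which the exit trace of the time derivative is
  estimated.\<close>

lemma P_bounded: "\<exists>B\<ge>0. \<forall>m j. \<forall>x\<in>{0..1}. \<forall>t\<in>{0..T}. \<bar>P (Suc m) x t $ j\<bar> \<le> B * weight j x t"
proof -
  have "compact ((\<lambda>(x, t). P 1 x t) ` ({0..1} \<times> {0..T}))"
    by (intro compact_continuous_image C1vD(3)[OF U_C1v] compact_Times) auto
  then have "bounded ((\<lambda>(x, t). P 1 x t) ` ({0..1} \<times> {0..T}))" by (rule compact_imp_bounded)
  then obtain C where C: "C > 0" "\<forall>z\<in>(\<lambda>(x, t). P 1 x t) ` ({0..1} \<times> {0..T}). norm z \<le> C"
    unfolding bounded_pos by blast
  \<comment> \<open>The first entry dominates \<open>P 1\<close> against the least weight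
    \<open>exp (- \<theta>)\<close>. The second makes
    \<open>B / 2 + 4 * M\<^sup>2 * M0 \<le> B\<close>, so that \<open>linear_step\<close> with
    \<open>e = 2 * M0\<close> preserves the bound.\<close>
  define B where "B = max (C * exp \<theta>) (8 * M\<^sup>2 * M0)"
  have B: "0 \<le> B" "C * exp \<theta> \<le> B" "8 * M\<^sup>2 * M0 \<le> B" using C(1) M0 by (auto simp: B_def max_def)
  have "\<forall>j. \<forall>x\<in>{0..1}. \<forall>t\<in>{0..T}. \<bar>P (Suc m) x t $ j\<bar> \<le> B * weight j x t" for m
  proof (induction m)
    case 0
    show ?case
    proof (intro allI ballI)
      fix j and x t :: real assume xt: "x \<in> {0..1}" "t \<in> {0..T}"
      have "\<bar>P 1 x t $ j\<bar> \<le> norm (P 1 x t)" by (rule component_le_norm_cart)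
      also have "\<dots> \<le> C" using C(2) xt by force
      also have "\<dots> = C * exp \<theta> * exp (- \<theta>)" by (simp add: exp_minus)
      also have "\<dots> \<le> B * weight j x t" using B C(1) weight_ge[OF xt] by (intro mult_mono) auto
      finally show "\<bar>P (Suc 0) x t $ j\<bar> \<le> B * weight j x t" by simp
    qed
  next
    case (Suc m)
    show ?case
    proof (intro allI ballI)
      fix i and x t :: real assume xt: "x \<in> {0..1}" "t \<in> {0..T}"
      have "\<bar>P (Suc (Suc m)) x t $ i\<bar> \<le> (B / 2 + 2 * M\<^sup>2 * (2 * M0)) * weight i x t"
      proof (rule linear_step[OF P_characteristic, where d = "P (Suc m)" and w = "exit_trace (Q (Suc m))"])
        show "\<bar>(fx x t (U (Suc m) x t) + fy x t (U (Suc m) x t) *v P (Suc m) x t) $ i\<bar>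
            \<le> 2 * M0 + M0 * norm (P (Suc m) x t)" if xt: "x \<in> {0..1}" "t \<in> {0..T}" for x t
        proof -
          let ?u = "U (Suc m) x t"
          have u: "norm ?u \<le> \<rho>" by (rule in_boxD(1)[OF box xt(2,1)])
          have "\<bar>(fx x t ?u + fy x t ?u *v P (Suc m) x t) $ i\<bar> \<le> norm (fx x t ?u + fy x t ?u *v P (Suc m) x t)"
            by (rule component_le_norm_cart)
          also have "\<dots> \<le> norm (fx x t ?u) + norm (fy x t ?u) * norm (P (Suc m) x t)"
            by (intro norm_triangle_le add_left_mono norm_matrix_vector_mult_le)
          also have "\<dots> \<le> M0 + M0 * norm (P (Suc m) x t)"
            using fx_le[OF xt u] fy_le[OF xt u] by (intro add_mono mult_right_mono) auto
          finally show ?thesis using M0 by simp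
        qed
        show "\<bar>P (Suc (Suc m)) x 0 $ i\<bar> \<le> 2 * M0" if "x \<in> {0..1}" for x
        proof -
          have "\<bar>\<phi>' x $ i\<bar> \<le> M0" by (rule order_trans[OF component_le_norm_cart \<phi>'_le[OF that]])
          then show ?thesis using P_init[OF that] M0 by simp
        qed
        show "\<bar>P (Suc (Suc m)) (en i) t $ i\<bar> \<le> M0 * (2 * M0 + M0 * norm (exit_trace (Q (Suc m)) t))"
          if t: "t \<in> {0..T}" for t
        proof (rule divide_lam_le[OF en_in(1) t])
          let ?v = "exit_trace (U (Suc m)) t" and ?q = "exit_trace (Q (Suc m)) t"
          have v: "norm ?v \<le> \<rho>" by (rule in_boxD(2)[OF box t])
          have "\<bar>f (en i) t (U (Suc m) (en i) t) $ i\<bar> \<le> M0"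
            by (rule order_trans[OF component_le_norm_cart f_le[OF en_in(1) t in_boxD(1)[OF box t en_in(1)]]])
          moreover have "\<bar>(ht t ?v + hz t ?v *v ?q) $ i\<bar> \<le> M0 + M0 * norm ?q"
          proof -
            have "\<bar>(ht t ?v + hz t ?v *v ?q) $ i\<bar> \<le> norm (ht t ?v + hz t ?v *v ?q)"
              by (rule component_le_norm_cart)
            also have "\<dots> \<le> norm (ht t ?v) + norm (hz t ?v) * norm ?q"
              by (intro norm_triangle_le add_left_mono norm_matrix_vector_mult_le)
            also have "\<dots> \<le> M0 + M0 * norm ?q"
              using ht_le[OF t v] hz_le[OF t v] by (intro add_mono mult_right_mono) auto
            finally show ?thesis .
          qed
          ultimately show "\<bar>lam (en i) t $ i * P (Suc (Suc m)) (en i) t $ i\<bar> \<le> 2 * M0 + M0 * norm ?q"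
            unfolding P_inflow[OF t] by linarith
        qed
        show "\<bar>exit_trace (Q (Suc m)) t $ j\<bar> \<le> 2 * M0 + M0 * \<bar>P (Suc m) (1 - en j) t $ j\<bar>" if "t \<in> {0..T}" for j t
          using exit_Q_le[OF that, of m j] M0 by linarith
      qed (use Suc B M0 xt in auto)
      also have "\<dots> \<le> B * weight i x t"
        using B weight_pos[of i x t] by (intro mult_right_mono) auto
      finally show "\<bar>P (Suc (Suc m)) x t $ i\<bar> \<le> B * weight i x t" .
    qed
  qed
  then show ?thesis using B(1) by blast
qed

end

lemma norm_affine_diff_le:
  fixes A B :: "real ^ 'n ^ 'm"
  shows "norm ((a + A *v p) - (b + B *v q)) \<le> norm (a - b) + (norm (A - B) * norm q + norm A * norm (p - q))"
proof -
  have "(a + A *v p) - (b + B *v q) = (a - b) + ((A - B) *v q + A *v (p - q))"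
    by (simp add: matrix_vector_mult_diff_rdistrib matrix_vector_mult_diff_distrib)
  also have "norm \<dots> \<le> norm (a - b) + (norm ((A - B) *v q) + norm (A *v (p - q)))"
    by (intro norm_triangle_le add_left_mono norm_triangle_ineq)
  also have "\<dots> \<le> norm (a - b) + (norm (A - B) * norm q + norm A * norm (p - q))"
    by (intro add_left_mono add_mono norm_matrix_vector_mult_le)
  finally show ?thesis .
qed

section \<open>Convergence of the x-derivatives and passage to the limit\<close>

context iteration begin

text \<open>The difference of two x-derivatives solves a linear problem with the coefficients of one
  of them. The differences of the coefficients, multiplied by bounded x- and time derivatives, are
  errors that tend to zero, since the U are already known to converge uniformly.\<close>

lemma P_close:
  assumes e: "e > 0"
  shows "\<exists>n. \<forall>a\<ge>n. \<forall>b\<ge>n. close (P (Suc a)) (P (Suc b)) e"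
proof -
  obtain B where B: "B \<ge> 0"
    and PB: "\<And>m j x t. x \<in> {0..1} \<Longrightarrow> t \<in> {0..T} \<Longrightarrow> \<bar>P (Suc m) x t $ j\<bar> \<le> B * weight j x t"
    using P_bounded by blast
  \<comment> \<open>Bounds for the x-derivatives and for the exit traces of the time derivatives;
    the summand 1 makes them positive for the divisions below.\<close>
  define B1 where "B1 = N * (B * exp (K * T)) + 1"
  define B2 where "B2 = N * (M0 + M0 * (B * exp (K * T))) + 1"
  have B1: "B1 > 0" and B2: "B2 > 0" using N B M0 by (auto simp: B1_def B2_def intro!: add_nonneg_pos)
  have PBK: "\<bar>P (Suc m) x t $ j\<bar> \<le> B * exp (K * T)" if "x \<in> {0..1}" "t \<in> {0..T}" for m j x t
  proof -
    have "weight j x t \<le> exp (K * t)" by (rule weight_le[OF that(1)])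
    also have "\<dots> \<le> exp (K * T)" using that(2) K_nonneg by (simp add: mult_left_mono)
    finally have "B * weight j x t \<le> B * exp (K * T)" using B by (rule mult_left_mono)
    then show ?thesis using PB[OF that, of m j] by linarith
  qed
  have PB1: "norm (P (Suc m) x t) \<le> B1" if "x \<in> {0..1}" "t \<in> {0..T}" for m x t
    using norm_le_components[OF PBK[OF that]] by (simp add: B1_def add_increasing2)
  have QB2: "norm (exit_trace (Q (Suc m)) t) \<le> B2" if t: "t \<in> {0..T}" for m t
  proof -
    have "\<bar>exit_trace (Q (Suc m)) t $ j\<bar> \<le> M0 + M0 * (B * exp (K * T))" for j
    proof -
      have "M0 * \<bar>P (Suc m) (1 - en j) t $ j\<bar> \<le> M0 * (B * exp (K * T))"
        using PBK[OF en_in(2) t] M0 by (intro mult_left_mono) auto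
      then show ?thesis using exit_Q_le[OF t, of m j] by linarith
    qed
    from norm_le_components[OF this] show ?thesis by (simp add: B2_def add_increasing2)
  qed
  show ?thesis
  proof (rule eventually_contracting_imp_Cauchy[where close = "\<lambda>a b. close (P (Suc a)) (P (Suc b))"])
    show "close (P (Suc a)) (P (Suc b)) D'" if "close (P (Suc a)) (P (Suc b)) D" "D \<le> D'" for a b D D'
      using that by (rule close_mono)
    show "close (P (Suc a)) (P (Suc b)) (2 * B)" for a b
      unfolding close_def
    proof (intro allI ballI)
      fix i and x t :: real assume xt: "x \<in> {0..1}" "t \<in> {0..T}"
      show "\<bar>P (Suc a) x t $ i - P (Suc b) x t $ i\<bar> \<le> 2 * B * weight i x t"
        using PB[OF xt, of a i] PB[OF xt, of b i] by linarith
    qed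
    show "0 \<le> 2 * B" using B by simp
    fix e :: real assume e: "e > 0"
    \<comment> \<open>\<open>linear_step\<close> multiplies inhomogeneous terms by
      \<open>2 * M\<^sup>2\<close>.\<close>
    define e' where "e' = e / (2 * M\<^sup>2)"
    have e': "e' > 0" using e M_ge(1) by (simp add: e'_def)
    have small: "e' / 2 > 0" "e' / (2 * B1) > 0" "e' / 3 > 0" "e' / (3 * B2) > 0"
      using e' B1 B2 by simp_all
    have "\<forall>\<^sub>F (a, b) in sequentially \<times>\<^sub>F sequentially. \<forall>D\<ge>0. close (P (Suc a)) (P (Suc b)) D \<longrightarrow>
        close (P (Suc (Suc a))) (P (Suc (Suc b))) (D / 2 + e)"
      \<comment> \<open>f enters at two indices: the inflow relation for
        \<open>P (Suc (Suc a))\<close> contains f at \<open>U (Suc a)\<close>, while the time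
        derivative \<open>Q (Suc a)\<close> in its exit trace contains f at
        \<open>U a\<close>.\<close>
      using eventually_Suc_both[OF state_small[OF fx_cont small(1)]]
        eventually_Suc_both[OF state_small[OF fy_cont small(2)]]
        eventually_Suc_both[OF state_small[OF f_cont small(3)]] state_small[OF f_cont small(3)]
        eventually_Suc_both[OF trace_small[OF ht_cont small(3)]]
        eventually_Suc_both[OF trace_small[OF hz_cont small(4)]]
    proof (eventually_elim, clarify, goal_cases)
      case (1 a b D)
      let ?d = "\<lambda>x t. P (Suc a) x t - P (Suc b) x t"
      let ?w = "\<lambda>t. exit_trace (Q (Suc a)) t - exit_trace (Q (Suc b)) t"
      let ?G = "\<lambda>m x t. fx x t (U (Suc m) x t) + fy x t (U (Suc m) x t) *v P (Suc m) x t"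
      have D: "0 \<le> D" and cl: "close (P (Suc a)) (P (Suc b)) D"
        and fx: "\<And>x t. x \<in> {0..1} \<Longrightarrow> t \<in> {0..T} \<Longrightarrow> norm (fx x t (U (Suc a) x t) - fx x t (U (Suc b) x t)) < e' / 2"
        and fy: "\<And>x t. x \<in> {0..1} \<Longrightarrow> t \<in> {0..T} \<Longrightarrow> norm (fy x t (U (Suc a) x t) - fy x t (U (Suc b) x t)) < e' / (2 * B1)"
        and f1: "\<And>x t. x \<in> {0..1} \<Longrightarrow> t \<in> {0..T} \<Longrightarrow> norm (f x t (U (Suc a) x t) - f x t (U (Suc b) x t)) < e' / 3"
        and f0: "\<And>x t. x \<in> {0..1} \<Longrightarrow> t \<in> {0..T} \<Longrightarrow> norm (f x t (U a x t) - f x t (U b x t)) < e' / 3"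
        and hT: "\<And>t. t \<in> {0..T} \<Longrightarrow> norm (ht t (exit_trace (U (Suc a)) t) - ht t (exit_trace (U (Suc b)) t)) < e' / 3"
        and hZ: "\<And>t. t \<in> {0..T} \<Longrightarrow> norm (hz t (exit_trace (U (Suc a)) t) - hz t (exit_trace (U (Suc b)) t)) < e' / (3 * B2)"
        using 1 unfolding dist_norm by blast+
      show ?case
        unfolding close_def
      proof (intro allI ballI)
        fix i and x t :: real assume xt: "x \<in> {0..1}" "t \<in> {0..T}"
        have "\<bar>P (Suc (Suc a)) x t $ i - P (Suc (Suc b)) x t $ i\<bar> \<le> (D / 2 + 2 * M\<^sup>2 * e') * weight i x t"
        proof (rule linear_step[where d = ?d and w = ?w and G = "\<lambda>x t. (?G a x t - ?G b x t) $ i"])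
          fix \<xi> s t r assume \<xi>: "characteristic (\<lambda>x t. lam x t $ i) T \<xi> s t" and r: "r \<in> {s..t}"
          show "((\<lambda>r. P (Suc (Suc a)) (\<xi> r) r $ i - P (Suc (Suc b)) (\<xi> r) r $ i) has_real_derivative
              (?G a (\<xi> r) r - ?G b (\<xi> r) r) $ i -
              lamx (\<xi> r) r $ i * (P (Suc (Suc a)) (\<xi> r) r $ i - P (Suc (Suc b)) (\<xi> r) r $ i)) (at r within {s..t})"
            by (rule DERIV_cong[OF DERIV_diff[OF P_characteristic[OF \<xi> r] P_characteristic[OF \<xi> r]]])
              (simp add: algebra_simps)
        next
          show "\<bar>?d x t $ j\<bar> \<le> D * weight j x t" if "x \<in> {0..1}" "t \<in> {0..T}" for j x t
            using closeD[OF cl that] by simp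
          show "\<bar>(?G a x t - ?G b x t) $ i\<bar> \<le> e' + M0 * norm (?d x t)" if xt: "x \<in> {0..1}" "t \<in> {0..T}" for x t
          proof -
            let ?ua = "U (Suc a) x t" and ?ub = "U (Suc b) x t"
            have "norm (?G a x t - ?G b x t) \<le> norm (fx x t ?ua - fx x t ?ub) +
              (norm (fy x t ?ua - fy x t ?ub) * norm (P (Suc b) x t) + norm (fy x t ?ua) * norm (?d x t))"
              by (rule norm_affine_diff_le)
            also have "\<dots> \<le> e' / 2 + (e' / (2 * B1) * B1 + M0 * norm (?d x t))"
              using fx[OF xt] fy[OF xt] PB1[OF xt, of b] fy_le[OF xt in_boxD(1)[OF box xt(2,1)]] e' B1 M0
              by (intro add_mono mult_mono) auto
            also have "\<dots> = e' + M0 * norm (?d x t)" using B1 by simp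
            finally show ?thesis using component_le_norm_cart[of "?G a x t - ?G b x t" i] by linarith
          qed
          show "\<bar>P (Suc (Suc a)) x 0 $ i - P (Suc (Suc b)) x 0 $ i\<bar> \<le> e'" if "x \<in> {0..1}" for x
            using P_init[OF that] e' by simp
          show "\<bar>?w t $ j\<bar> \<le> e' + M0 * \<bar>?d (1 - en j) t $ j\<bar>" if t: "t \<in> {0..T}" for j t
          proof -
            let ?x = "1 - en j"
            have "\<bar>f ?x t (U a ?x t) $ j - f ?x t (U b ?x t) $ j\<bar> \<le> e' / 3"
              using component_le_norm_cart[of "f ?x t (U a ?x t) - f ?x t (U b ?x t)" j] f0[OF en_in(2) t, of j]
              by simp
            moreover have "\<bar>lam ?x t $ j * (P (Suc a) ?x t $ j - P (Suc b) ?x t $ j)\<bar> \<le> M0 * \<bar>?d ?x t $ j\<bar>"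
              unfolding abs_mult vector_minus_component by (intro mult_right_mono lam_le en_in t) simp
            moreover have "?w t $ j = (f ?x t (U a ?x t) $ j - f ?x t (U b ?x t) $ j) -
                lam ?x t $ j * (P (Suc a) ?x t $ j - P (Suc b) ?x t $ j)"
              by (simp add: exit_trace_def Q_eq[OF en_in(2) t] algebra_simps)
            ultimately show ?thesis using e' by linarith
          qed
          show "\<bar>P (Suc (Suc a)) (en i) t $ i - P (Suc (Suc b)) (en i) t $ i\<bar> \<le> M0 * (e' + M0 * norm (?w t))"
            if t: "t \<in> {0..T}" for t
          proof (rule divide_lam_le[OF en_in(1) t])
            let ?va = "exit_trace (U (Suc a)) t" and ?vb = "exit_trace (U (Suc b)) t"
            let ?qb = "exit_trace (Q (Suc b)) t"
            let ?Ha = "ht t ?va + hz t ?va *v exit_trace (Q (Suc a)) t"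
            let ?Hb = "ht t ?vb + hz t ?vb *v exit_trace (Q (Suc b)) t"
            let ?x = "en i"
            have "norm (?Ha - ?Hb) \<le> norm (ht t ?va - ht t ?vb) +
              (norm (hz t ?va - hz t ?vb) * norm ?qb + norm (hz t ?va) * norm (?w t))"
              by (rule norm_affine_diff_le)
            also have "\<dots> \<le> e' / 3 + (e' / (3 * B2) * B2 + M0 * norm (?w t))"
              using hT[OF t] hZ[OF t] QB2[OF t, of b] hz_le[OF t in_boxD(2)[OF box t]] e' B2 M0
              by (intro add_mono mult_mono) auto
            finally have H: "norm (?Ha - ?Hb) \<le> e' / 3 + e' / 3 + M0 * norm (?w t)" using B2 by simp
            have "\<bar>?Ha $ i - ?Hb $ i\<bar> \<le> norm (?Ha - ?Hb)"
              using component_le_norm_cart[of "?Ha - ?Hb" i] by simp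
            moreover have "\<bar>f ?x t (U (Suc a) ?x t) $ i - f ?x t (U (Suc b) ?x t) $ i\<bar> \<le> e' / 3"
              using component_le_norm_cart[of "f ?x t (U (Suc a) ?x t) - f ?x t (U (Suc b) ?x t)" i]
                f1[OF en_in(1) t, of i] by simp
            moreover have "lam ?x t $ i * (P (Suc (Suc a)) ?x t $ i - P (Suc (Suc b)) ?x t $ i) =
                (f ?x t (U (Suc a) ?x t) $ i - f ?x t (U (Suc b) ?x t) $ i) - (?Ha $ i - ?Hb $ i)"
              unfolding right_diff_distrib P_inflow[OF t] by simp
            ultimately show "\<bar>lam ?x t $ i * (P (Suc (Suc a)) ?x t $ i - P (Suc (Suc b)) ?x t $ i)\<bar> \<le> e' + M0 * norm (?w t)"
              using H by linarith
          qed
        qed (use D e' xt in auto)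
        moreover have "2 * M\<^sup>2 * e' = e" using M_ge(1) by (simp add: e'_def)
        ultimately show "\<bar>P (Suc (Suc a)) x t $ i - P (Suc (Suc b)) x t $ i\<bar> \<le> (D / 2 + e) * weight i x t"
          by simp
      qed
    qed
    then show "\<exists>n. \<forall>a\<ge>n. \<forall>b\<ge>n. \<forall>D\<ge>0. close (P (Suc a)) (P (Suc b)) D \<longrightarrow>
        close (P (Suc (Suc a))) (P (Suc (Suc b))) (D / 2 + e)"
      unfolding eventually_prod_sequentially by auto
  qed (rule e)
qed

lemma close_limit:
  assumes "\<And>e. e > 0 \<Longrightarrow> \<exists>n. \<forall>a\<ge>n. \<forall>b\<ge>n. close (V a) (V b) e"
  shows "\<exists>v. uniform_limit ({0..1} \<times> {0..T}) (\<lambda>m p. V m (fst p) (snd p)) (\<lambda>p. v (fst p) (snd p)) sequentially"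
proof -
  have "uniformly_Cauchy_on ({0..1} \<times> {0..T}) (\<lambda>m p. V m (fst p) (snd p))"
  proof (rule uniformly_Cauchy_onI)
    fix e :: real assume "e > 0"
    from close_imp_dist[OF this assms]
    obtain n where "\<And>a b t x. n \<le> a \<Longrightarrow> n \<le> b \<Longrightarrow> t \<in> {0..T} \<Longrightarrow> x \<in> {0..1} \<Longrightarrow> norm (V a x t - V b x t) < e"
      by blast
    then show "\<exists>M. \<forall>p\<in>{0..1} \<times> {0..T}. \<forall>m\<ge>M. \<forall>n\<ge>M. dist (V m (fst p) (snd p)) (V n (fst p) (snd p)) < e"
      by (intro exI[of _ n]) (auto simp: dist_norm)
  qed
  then obtain l where "uniform_limit ({0..1} \<times> {0..T}) (\<lambda>m p. V m (fst p) (snd p)) l sequentially"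
    unfolding uniformly_convergent_eq_Cauchy[symmetric] uniformly_convergent_on_def by blast
  then show ?thesis by (intro exI[of _ "\<lambda>x t. l (x, t)"]) simp
qed

text \<open>\<open>q\<close> is defined by the equation, which therefore holds trivially. What has
  to be shown is that it is the time derivative of the limit, and this follows from the uniform
  convergence of the \<open>Q (Suc m)\<close> to \<open>q\<close>.\<close>

lemma solution_exists: "\<exists>u p q. solution u p q"
proof -
  obtain u where Uu: "uniform_limit ({0..1} \<times> {0..T}) (\<lambda>m p. U m (fst p) (snd p)) (\<lambda>p. u (fst p) (snd p)) sequentially"
    using close_limit[of U, OF U_close] by blast
  obtain p where Pp: "uniform_limit ({0..1} \<times> {0..T}) (\<lambda>m z. P (Suc m) (fst z) (snd z)) (\<lambda>z. p (fst z) (snd z)) sequentially"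
    using close_limit[of "\<lambda>m. P (Suc m)", OF P_close] by blast
  define q where "q x t = f x t (u x t) - (\<chi> i. lam x t $ i * p x t $ i)" for x t
  have Ul: "(\<lambda>m. U m x t) \<longlonglongrightarrow> u x t" if "x \<in> {0..1}" "t \<in> {0..T}" for x t
    using tendsto_uniform_limitI[OF Uu, of "(x, t)"] that by simp
  have Uli: "(\<lambda>m. U m x t $ i) \<longlonglongrightarrow> u x t $ i" if "x \<in> {0..1}" "t \<in> {0..T}" for x t i
    using Ul[OF that] by (rule tendsto_vec_nth)
  have u_le: "norm (u x t) \<le> \<rho>" if "x \<in> {0..1}" "t \<in> {0..T}" for x t
    by (rule Lim_norm_ubound[OF _ Ul[OF that]]) (use in_boxD(1)[OF box that(2,1)] in auto)
  have Ue: "\<forall>\<^sub>F m in sequentially. \<forall>x\<in>{0..1}. \<forall>t\<in>{0..T}. dist (U m x t) (u x t) < e" if "e > 0" for e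
    using uniform_limitD[OF Uu that] by eventually_elim auto
  have Pe: "\<forall>\<^sub>F m in sequentially. \<forall>x\<in>{0..1}. \<forall>t\<in>{0..T}. dist (P (Suc m) x t) (p x t) < e" if "e > 0" for e
    using uniform_limitD[OF Pp that] by eventually_elim auto
  have fe: "\<forall>\<^sub>F m in sequentially. \<forall>x\<in>{0..1}. \<forall>t\<in>{0..T}. dist (f x t (U m x t)) (f x t (u x t)) < e" if e: "e > 0" for e
  proof -
    obtain \<delta> where \<delta>: "\<delta> > 0" and F: "\<And>x t y y'. x \<in> {0..1} \<Longrightarrow> t \<in> {0..T} \<Longrightarrow> norm y \<le> \<rho> \<Longrightarrow> norm y' \<le> \<rho> \<Longrightarrow>
        norm (y - y') < \<delta> \<Longrightarrow> dist (f x t y) (f x t y') < e"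
      using uniformly_continuous_in_state[OF f_cont e] by blast
    show ?thesis
      using Ue[OF \<delta>]
      by eventually_elim (use F in_boxD(1)[OF box] u_le in \<open>force simp: dist_norm\<close>)
  qed
  have Qe: "\<forall>\<^sub>F m in sequentially. \<forall>x\<in>{0..1}. \<forall>t\<in>{0..T}. \<forall>i. \<bar>Q (Suc m) x t $ i - q x t $ i\<bar> < e" if e: "e > 0" for e
  proof -
    have e': "e / 2 > 0" "e / (2 * M0) > 0" using e M0 by auto
    show ?thesis
      using fe[OF e'(1)] Pe[OF e'(2)]
    proof eventually_elim
      case (elim m)
      show ?case
      proof (intro ballI allI)
        fix i and x t :: real assume xt: "x \<in> {0..1}" "t \<in> {0..T}"
        have "\<bar>f x t (U m x t) $ i - f x t (u x t) $ i\<bar> < e / 2"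
          using component_le_norm_cart[of "f x t (U m x t) - f x t (u x t)" i] elim(1) xt
          by (force simp: dist_norm)
        moreover have "\<bar>lam x t $ i * (P (Suc m) x t $ i - p x t $ i)\<bar> \<le> M0 * (e / (2 * M0))"
          unfolding abs_mult
        proof (rule mult_mono)
          show "\<bar>P (Suc m) x t $ i - p x t $ i\<bar> \<le> e / (2 * M0)"
            using component_le_norm_cart[of "P (Suc m) x t - p x t" i] elim(2) xt
            by (force simp: dist_norm)
        qed (use lam_le[OF xt] M0 in auto)
        moreover have "M0 * (e / (2 * M0)) = e / 2" using M0 by simp
        moreover have "Q (Suc m) x t $ i - q x t $ i = (f x t (U m x t) $ i - f x t (u x t) $ i) -
            lam x t $ i * (P (Suc m) x t $ i - p x t $ i)"
          by (simp add: Q_eq[OF xt] q_def algebra_simps)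
        ultimately show "\<bar>Q (Suc m) x t $ i - q x t $ i\<bar> < e" by linarith
      qed
    qed
  qed
  have u_cont: "continuous_on ({0..1} \<times> {0..T}) (\<lambda>(x, t). u x t)"
    using uniform_limit_theorem[OF _ Uu] C1vD(2)[OF U_C1v] by (simp add: case_prod_unfold)
  have p_cont: "continuous_on ({0..1} \<times> {0..T}) (\<lambda>(x, t). p x t)"
    using uniform_limit_theorem[OF _ Pp] C1vD(3)[OF U_C1v] by (simp add: case_prod_unfold)
  have q_cont: "continuous_on ({0..1} \<times> {0..T}) (\<lambda>(x, t). q x t)"
    using continuous_on_triple[OF f_cont u_cont] lam_cont p_cont
    unfolding q_def case_prod_unfold by (intro continuous_intros continuous_on_vec_lambda)
  have u_x: "((\<lambda>x. u x t $ i) has_real_derivative p x t $ i) (at x within {0..1})"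
    if x: "x \<in> {0..1}" and t: "t \<in> {0..T}" for x t i
  proof (rule has_real_derivative_uniform_limit[where f = "\<lambda>m x. U (Suc m) x t $ i" and f' = "\<lambda>m x. P (Suc m) x t $ i"])
    show "((\<lambda>x. U (Suc m) x t $ i) has_real_derivative P (Suc m) x t $ i) (at x within {0..1})" if "x \<in> {0..1}" for m x
      using C1vD(5)[OF U_C1v that t] by (simp add: has_vector_derivative_components)
    show "uniform_limit {0..1} (\<lambda>m x. P (Suc m) x t $ i) (\<lambda>x. p x t $ i) sequentially"
    proof (rule uniform_limitI)
      fix e :: real assume "e > 0"
      from Pe[OF this] show "\<forall>\<^sub>F m in sequentially. \<forall>x\<in>{0..1}. dist (P (Suc m) x t $ i) (p x t $ i) < e"
        by eventually_elim (use t dist_vec_nth_le order.strict_trans1 in blast)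
    qed
    show "(\<lambda>m. U (Suc m) x t $ i) \<longlonglongrightarrow> u x t $ i" if "x \<in> {0..1}" for x
      using Uli[OF that t] by (rule LIMSEQ_Suc)
  qed (rule x)
  have u_t: "((\<lambda>t. u x t $ i) has_real_derivative q x t $ i) (at t within {0..T})"
    if x: "x \<in> {0..1}" and t: "t \<in> {0..T}" for x t i
  proof (rule has_real_derivative_uniform_limit[where f = "\<lambda>m t. U (Suc m) x t $ i" and f' = "\<lambda>m t. Q (Suc m) x t $ i"])
    show "((\<lambda>t. U (Suc m) x t $ i) has_real_derivative Q (Suc m) x t $ i) (at t within {0..T})" if "t \<in> {0..T}" for m t
      using C1vD(6)[OF U_C1v x that] by (simp add: has_vector_derivative_components)
    show "uniform_limit {0..T} (\<lambda>m t. Q (Suc m) x t $ i) (\<lambda>t. q x t $ i) sequentially"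
    proof (rule uniform_limitI)
      fix e :: real assume "e > 0"
      from Qe[OF this] show "\<forall>\<^sub>F m in sequentially. \<forall>t\<in>{0..T}. dist (Q (Suc m) x t $ i) (q x t $ i) < e"
        by eventually_elim (use x in \<open>simp add: dist_real_def\<close>)
    qed
    show "(\<lambda>m. U (Suc m) x t $ i) \<longlonglongrightarrow> u x t $ i" if "t \<in> {0..T}" for t
      using Uli[OF x that] by (rule LIMSEQ_Suc)
  qed (rule t)
  have C: "C1v u p q"
    unfolding C1v_def C1_x_def
    using u_x u_t q_cont continuous_on_component[OF u_cont] continuous_on_component[OF p_cont]
    by (auto simp: case_prod_unfold)
  have "u x 0 = \<phi> x" if x: "x \<in> {0..1}" for x
  proof -
    have "U m x 0 = \<phi> x" for m using adm[of m] x by (simp add: admissible_def)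
    then show ?thesis using Ul[OF x, of 0] T by (simp add: LIMSEQ_const_iff)
  qed
  moreover have "u (en i) t $ i = h t (exit_trace u t) $ i" if t: "t \<in> {0..T}" for i t
  proof (rule LIMSEQ_unique)
    show "(\<lambda>m. U (Suc m) (en i) t $ i) \<longlonglongrightarrow> u (en i) t $ i"
      using Uli[OF en_in(1) t] by (rule LIMSEQ_Suc)
    have "(\<lambda>m. exit_trace (U m) t) \<longlonglongrightarrow> exit_trace u t"
      by (rule vec_tendstoI) (simp add: exit_trace_def Uli[OF en_in(2) t])
    moreover have "isCont (h t) (exit_trace u t)"
      by (rule has_derivative_continuous[OF h_z[OF t]])
    ultimately have "(\<lambda>m. h t (exit_trace (U m) t)) \<longlonglongrightarrow> h t (exit_trace u t)"
      by (rule isCont_tendsto_compose[rotated])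
    moreover have "U (Suc m) (en i) t $ i = h t (exit_trace (U m) t) $ i" for m
      using iter[of m] t unfolding iterates_def by blast
    ultimately show "(\<lambda>m. U (Suc m) (en i) t $ i) \<longlonglongrightarrow> h t (exit_trace u t) $ i"
      by (simp add: tendsto_vec_nth)
  qed
  ultimately have "solution u p q" using C by (auto simp: solution_def q_def)
  then show ?thesis by blast
qed

end

section \<open>Existence and uniqueness on a bounded time interval\<close>

context hyperbolic begin

lemma state_bounded:
  fixes F :: "real \<Rightarrow> real \<Rightarrow> real ^ 'n \<Rightarrow> 'b::real_normed_vector"
  assumes F: "continuous_on ({0..1} \<times> {0..T} \<times> UNIV) (\<lambda>(x, t, y). F x t y)"
  shows "\<exists>C\<ge>0. \<forall>x\<in>{0..1}. \<forall>t\<in>{0..T}. \<forall>y. norm y \<le> \<rho> \<longrightarrow> norm (F x t y) \<le> C"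
proof -
  have "compact ({0..1::real} \<times> {0..T} \<times> cball (0 :: real ^ 'n) \<rho>)" by (intro compact_Times) auto
  then have "compact ((\<lambda>(x, t, y). F x t y) ` ({0..1} \<times> {0..T} \<times> cball 0 \<rho>))"
    by (intro compact_continuous_image continuous_on_subset[OF F]) auto
  then have "bounded ((\<lambda>(x, t, y). F x t y) ` ({0..1} \<times> {0..T} \<times> cball 0 \<rho>))" by (rule compact_imp_bounded)
  then obtain C where C: "C > 0" "\<forall>z\<in>(\<lambda>(x, t, y). F x t y) ` ({0..1} \<times> {0..T} \<times> cball 0 \<rho>). norm z \<le> C"
    unfolding bounded_pos by blast
  have "norm (F x t y) \<le> C" if "x \<in> {0..1}" "t \<in> {0..T}" "norm y \<le> \<rho>" for x t y
  proof -
    have "(x, t, y) \<in> {0..1} \<times> {0..T} \<times> cball 0 \<rho>" using that by simp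
    from imageI[OF this, of "\<lambda>(x, t, y). F x t y"] show ?thesis using C(2) by auto
  qed
  then show ?thesis using C(1) by (intro exI[of _ C]) auto
qed

lemma coefficient_bounded:
  fixes w :: "real \<Rightarrow> real \<Rightarrow> real ^ 'n"
  assumes "\<And>i. continuous_on ({0..1} \<times> {0..T}) (\<lambda>(x, t). w x t $ i)"
  shows "\<exists>C\<ge>0. \<forall>i. \<forall>x\<in>{0..1}. \<forall>t\<in>{0..T}. \<bar>w x t $ i\<bar> \<le> C"
proof -
  have wc: "continuous_on ({0..1} \<times> {0..T}) (\<lambda>(x, t). w x t)"
    by (rule continuous_on_vec_components) (use assms in \<open>simp add: case_prod_unfold\<close>)
  have "continuous_on ({0..1} \<times> {0..T} \<times> UNIV) (\<lambda>(x, t, y :: real ^ 'n). w x t)"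
    unfolding case_prod_unfold by (intro continuous_on_compose_Pair[OF wc] continuous_intros) auto
  from state_bounded[OF this, of 0] obtain C where C: "C \<ge> 0" "\<forall>x\<in>{0..1}. \<forall>t\<in>{0..T}. norm (w x t) \<le> C"
    by force
  then have "\<bar>w x t $ i\<bar> \<le> C" if "x \<in> {0..1}" "t \<in> {0..T}" for i x t
    using that component_le_norm_cart[of "w x t" i] by force
  then show ?thesis using C(1) by blast
qed

lemma bounded_hyperbolic_exists:
  "\<exists>M0. bounded_hyperbolic T en lam lamx f fx fy h ht hz \<phi> \<phi>' \<rho> M0 (real CARD('n))"
proof -
  obtain C1 where C1: "C1 \<ge> 0" "\<And>i x t. x \<in> {0..1} \<Longrightarrow> t \<in> {0..T} \<Longrightarrow> \<bar>lam x t $ i\<bar> \<le> C1"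
    using coefficient_bounded[of lam] lam_C1_x unfolding C1_x_def by blast
  obtain C2 where C2: "C2 \<ge> 0" "\<And>i x t. x \<in> {0..1} \<Longrightarrow> t \<in> {0..T} \<Longrightarrow> \<bar>lamx x t $ i\<bar> \<le> C2"
    using coefficient_bounded[of lamx] lam_C1_x unfolding C1_x_def by blast
  have "continuous_on ({0..1} \<times> {0..T}) (\<lambda>(x, t). (\<chi> i. 1 / lam x t $ i) $ i)" for i
    using lam_C1_x[of i] lam_nonzero unfolding C1_x_def case_prod_unfold
    by (auto intro!: continuous_on_divide)
  from coefficient_bounded[OF this] obtain C3
    where C3: "C3 \<ge> 0" "\<And>i x t. x \<in> {0..1} \<Longrightarrow> t \<in> {0..T} \<Longrightarrow> \<bar>1 / lam x t $ i\<bar> \<le> C3" by auto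
  obtain C4 where C4: "C4 \<ge> 0" "\<And>x t y. x \<in> {0..1} \<Longrightarrow> t \<in> {0..T} \<Longrightarrow> norm y \<le> \<rho> \<Longrightarrow> norm (f x t y) \<le> C4"
    using state_bounded[OF f_cont] by blast
  obtain C5 where C5: "C5 \<ge> 0" "\<And>x t y. x \<in> {0..1} \<Longrightarrow> t \<in> {0..T} \<Longrightarrow> norm y \<le> \<rho> \<Longrightarrow> norm (fx x t y) \<le> C5"
    using state_bounded[OF fx_cont] by blast
  obtain C6 where C6: "C6 \<ge> 0" "\<And>x t y. x \<in> {0..1} \<Longrightarrow> t \<in> {0..T} \<Longrightarrow> norm y \<le> \<rho> \<Longrightarrow> norm (fy x t y) \<le> C6"
    using state_bounded[OF fy_cont] by blast
  obtain C7 where C7: "C7 \<ge> 0" "\<And>x t y. x \<in> {0..1::real} \<Longrightarrow> t \<in> {0..T} \<Longrightarrow> norm y \<le> \<rho> \<Longrightarrow> norm (ht t y) \<le> C7"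
    using state_bounded[OF continuous_on_ignore_x[OF ht_cont]] by blast
  obtain C8 where C8: "C8 \<ge> 0" "\<And>x t y. x \<in> {0..1::real} \<Longrightarrow> t \<in> {0..T} \<Longrightarrow> norm y \<le> \<rho> \<Longrightarrow> norm (hz t y) \<le> C8"
    using state_bounded[OF continuous_on_ignore_x[OF hz_cont]] by blast
  have "bounded (\<phi>' ` {0..1})" by (intro compact_imp_bounded compact_continuous_image \<phi>'_cont) simp
  then obtain C9 where C9: "C9 \<ge> 0" "\<And>x. x \<in> {0..1} \<Longrightarrow> norm (\<phi>' x) \<le> C9"
    unfolding bounded_pos by (auto dest: less_imp_le)
  define M0 where "M0 = 1 + C1 + C2 + C3 + C4 + C5 + C6 + C7 + C8 + C9"
  note nonneg = C1(1) C2(1) C3(1) C4(1) C5(1) C6(1) C7(1) C8(1) C9(1)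
  have le: "1 \<le> M0" "C1 \<le> M0" "C2 \<le> M0" "C3 \<le> M0" "C4 \<le> M0" "C5 \<le> M0" "C6 \<le> M0" "C7 \<le> M0" "C8 \<le> M0" "C9 \<le> M0"
    unfolding M0_def using nonneg by linarith+
  have "bounded_hyperbolic T en lam lamx f fx fy h ht hz \<phi> \<phi>' \<rho> M0 (real CARD('n))"
  proof
    show "1 \<le> M0 * \<bar>lam x t $ i\<bar>" if "x \<in> {0..1}" "t \<in> {0..T}" for x t i
    proof -
      have "1 = \<bar>1 / lam x t $ i\<bar> * \<bar>lam x t $ i\<bar>" using lam_nonzero[OF that] by simp
      also have "\<dots> \<le> M0 * \<bar>lam x t $ i\<bar>" using C3(2)[OF that, of i] le by (intro mult_right_mono) auto
      finally show ?thesis .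
    qed
    show "\<bar>lam x t $ i\<bar> \<le> M0" if "x \<in> {0..1}" "t \<in> {0..T}" for x t i using C1(2)[OF that, of i] le by linarith
    show "\<bar>lamx x t $ i\<bar> \<le> M0" if "x \<in> {0..1}" "t \<in> {0..T}" for x t i using C2(2)[OF that, of i] le by linarith
    show "norm (f x t y) \<le> M0" if "x \<in> {0..1}" "t \<in> {0..T}" "norm y \<le> \<rho>" for x t y using C4(2)[OF that] le by linarith
    show "norm (fx x t y) \<le> M0" if "x \<in> {0..1}" "t \<in> {0..T}" "norm y \<le> \<rho>" for x t y using C5(2)[OF that] le by linarith
    show "norm (fy x t y) \<le> M0" if "x \<in> {0..1}" "t \<in> {0..T}" "norm y \<le> \<rho>" for x t y using C6(2)[OF that] le by linarith
    show "norm (ht t y) \<le> M0" if "t \<in> {0..T}" "norm y \<le> \<rho>" for t y using C7(2)[of 0, OF _ that] le by simp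
    show "norm (hz t y) \<le> M0" if "t \<in> {0..T}" "norm y \<le> \<rho>" for t y using C8(2)[of 0, OF _ that] le by simp
    show "norm (\<phi>' x) \<le> M0" if "x \<in> {0..1}" for x using C9(2)[OF that] le by linarith
  qed (use le in auto)
  then show ?thesis by blast
qed

text \<open>Both solutions are bounded on the compact strip, so the box can be fitted to the given
  pair.\<close>

lemma solutions_agree:
  assumes u: "solution u p q" and w: "solution w pw qw" and x: "x \<in> {0..1}" and t: "t \<in> {0..T}"
  shows "u x t = w x t"
proof -
  have C: "C1v u p q" "C1v w pw qw" using u w by (simp_all add: solution_def)
  obtain R1 where R1: "R1 \<ge> 0" "\<And>i x t. x \<in> {0..1} \<Longrightarrow> t \<in> {0..T} \<Longrightarrow> \<bar>u x t $ i\<bar> \<le> R1"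
    using coefficient_bounded[of u] C1vD(1)[OF C(1)] unfolding C1_x_def by blast
  obtain R2 where R2: "R2 \<ge> 0" "\<And>i x t. x \<in> {0..1} \<Longrightarrow> t \<in> {0..T} \<Longrightarrow> \<bar>w x t $ i\<bar> \<le> R2"
    using coefficient_bounded[of w] C1vD(1)[OF C(2)] unfolding C1_x_def by blast
  define \<rho> where "\<rho> = real CARD('n) * (R1 + R2)"
  obtain M0 where "bounded_hyperbolic T en lam lamx f fx fy h ht hz \<phi> \<phi>' \<rho> M0 (real CARD('n))"
    using bounded_hyperbolic_exists by blast
  then interpret bounded_hyperbolic T en lam lamx f fx fy h ht hz \<phi> \<phi>' \<rho> M0 "real CARD('n)" .
  have "\<rho> / real CARD('n) = R1 + R2" by (simp add: \<rho>_def)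
  then have "in_box u" "in_box w" unfolding in_box_def using R1 R2 by (auto intro: add_increasing add_increasing2)
  then show ?thesis by (rule solution_unique[OF u w _ _ x t])
qed

text \<open>The barrier \<open>exp (exp s - s / 2 * depth)\<close> with \<open>s = \<kappa> * t + c\<close> is larger at the inflow boundary than at
  the exit by the factor \<open>exp (s / 2)\<close>, the square root of the logarithm of its maximal value; this
  factor absorbs the superlinear growth of the boundary map, and choosing \<open>\<kappa>\<close> large
  absorbs that of the source.\<close>

lemma solution_exists_if_log_growth:
  assumes compat0: "\<And>i. \<phi> (en i) $ i = h 0 v0 $ i"
    and compat1: "\<And>i. velocity (en i) $ i = (ht 0 v0 + hz 0 v0 *v v0') $ i"
    and f_growth: "\<And>s x t y. 1 \<le> s \<Longrightarrow> x \<in> {0..1} \<Longrightarrow> t \<in> {0..T} \<Longrightarrow> norm y \<le> real CARD('n) * exp (exp s) \<Longrightarrow>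
      norm (f x t y) \<le> C * exp (exp s + s / 4)"
    and h_growth: "\<And>s t z. 1 \<le> s \<Longrightarrow> t \<in> {0..T} \<Longrightarrow> norm z \<le> real CARD('n) * exp (exp s - s / 2) \<Longrightarrow>
      norm (h t z) \<le> C * exp (exp s - s / 4)"
    and C: "1 \<le> C"
  shows "\<exists>u p q. solution u p q"
proof -
  obtain \<Lambda> where \<Lambda>: "\<Lambda> \<ge> 0" "\<And>i x t. x \<in> {0..1} \<Longrightarrow> t \<in> {0..T} \<Longrightarrow> \<bar>lam x t $ i\<bar> \<le> \<Lambda>"
    using coefficient_bounded[of lam] lam_C1_x unfolding C1_x_def by blast
  have \<phi>_cont: "continuous_on {0..1} \<phi>"
    by (rule continuous_on_vector_derivative[OF \<phi>_x])
  then have "bounded (\<phi> ` {0..1})" by (intro compact_imp_bounded compact_continuous_image) simp_all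
  then obtain C\<phi> where C\<phi>: "C\<phi> \<ge> 0" "\<And>x. x \<in> {0..1} \<Longrightarrow> norm (\<phi> x) \<le> C\<phi>"
    unfolding bounded_pos by (auto dest: less_imp_le)
  \<comment> \<open>Half of the growth \<open>\<kappa> * exp (s t)\<close> pays for the change in
    time of the slope \<open>s t / 2\<close> of the barrier. The other half consists of
    \<open>\<Lambda> / 2\<close> for the decay along characteristics and \<open>C\<close> for the
    source, each times \<open>exp (s t)\<close>.\<close>
  define \<kappa> where "\<kappa> = \<Lambda> + 2 * C"
  \<comment> \<open>The three summands ensure that s is at least 1, that \<open>C\<close> is at most
    \<open>exp (s t / 4)\<close>, and that the initial data and the initial iterate lie below the
    barrier.\<close>
  define c where "c = 1 + 4 * ln C + 2 * (C\<phi> + T * norm v0')"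
  define s where "s t = \<kappa> * t + c" for t
  define \<beta> where "\<beta> i x t = exp (exp (s t) - s t / 2 * transport.depth (en i) x)" for i x t
  define inv where "inv u \<longleftrightarrow> (\<forall>i. \<forall>x\<in>{0..1}. \<forall>t\<in>{0..T}. \<bar>u x t $ i\<bar> \<le> \<beta> i x t)" for u :: "real \<Rightarrow> real \<Rightarrow> real ^ 'n"
  have \<kappa>: "\<kappa> \<ge> 0" using \<Lambda> C by (simp add: \<kappa>_def)
  have c1: "1 \<le> c" "4 * ln C \<le> c" "2 * (C\<phi> + T * norm v0') \<le> c"
    using C C\<phi> T by (auto simp: c_def)
  have sc: "c \<le> s t" "1 \<le> s t" if "t \<in> {0..T}" for t
    using \<kappa> that c1 by (simp_all add: s_def add_increasing)
  have s_le: "s t \<le> exp (s t)" "1 \<le> exp (s t)" if "t \<in> {0..T}" for t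
    using exp_ge_add_one_self[of "s t"] sc[OF that] by linarith+
  have depth: "0 \<le> transport.depth (en i) x" "transport.depth (en i) x \<le> 1" if "x \<in> {0..1}" for i x
    using transport.depth_bounds[OF transport[of i] that] by auto
  have \<beta>_le: "\<beta> i x t \<le> exp (exp (s t))" if "x \<in> {0..1}" "t \<in> {0..T}" for i x t
    using depth(1)[OF that(1), of i] sc(2)[OF that(2)] by (simp add: \<beta>_def)
  have \<beta>_ge: "exp (exp (s t) - s t / 2) \<le> \<beta> i x t" if "x \<in> {0..1}" "t \<in> {0..T}" for i x t
  proof -
    have "s t / 2 * transport.depth (en i) x \<le> s t / 2 * 1"
      using depth(2)[OF that(1)] sc(2)[OF that(2)] by (intro mult_left_mono) auto
    then show ?thesis by (simp add: \<beta>_def)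
  qed
  have \<beta>_ge_c: "c / 2 \<le> \<beta> i x t" if "x \<in> {0..1}" "t \<in> {0..T}" for i x t
  proof -
    have "c / 2 \<le> 1 + (exp (s t) - s t / 2)" using exp_ge_add_one_self[of "s t"] sc[OF that(2)] by linarith
    also have "\<dots> \<le> exp (exp (s t) - s t / 2)" by (rule exp_ge_add_one_self)
    also have "\<dots> \<le> \<beta> i x t" by (rule \<beta>_ge[OF that])
    finally show ?thesis .
  qed
  have \<beta>_exit: "\<beta> i (1 - en i) t = exp (exp (s t) - s t / 2)" for i t
    by (simp add: \<beta>_def transport.depth_exit[OF transport])
  have inv_step: "inv u'" if adm: "admissible u p q" and adm': "admissible u' p' q'"
    and it: "iterates u p q u' p' q'" and u: "inv u" for u p q u' p' q'
    unfolding inv_def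
  proof (intro allI ballI)
    fix i and x t :: real assume x: "x \<in> {0..1}" and t: "t \<in> {0..T}"
    have "\<bar>u' x t $ i\<bar> \<le> 1 * exp (exp (s t) - s t / 2 * transport.depth (en i) x)"
    proof (rule transport.comparison[OF transport, where c = "\<lambda>_ _. 0" and L = 0 and G = "\<lambda>x t. f x t (u x t) $ i"
          and z = "\<lambda>x t. u' x t $ i" and A = "\<lambda>t. exp (s t)" and R = "\<lambda>t. s t / 2" and D = 1
          and A' = "\<lambda>t. \<kappa> * exp (s t)" and R' = "\<lambda>t. \<kappa> / 2"])
      show "((\<lambda>r. u' (\<xi> r) r $ i) has_real_derivative f (\<xi> r) r (u (\<xi> r) r) $ i - 0 * u' (\<xi> r) r $ i) (at r within {s..t})"
        if \<xi>: "characteristic (\<lambda>x t. lam x t $ i) T \<xi> s t" and r: "r \<in> {s..t}" for \<xi> s t r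
      proof -
        have mem: "\<xi> r \<in> {0..1}" "r \<in> {0..T}" using \<xi> r by (auto simp: characteristic_def image_subset_iff)
        have "q' (\<xi> r) r $ i = f (\<xi> r) r (u (\<xi> r) r) $ i - lam (\<xi> r) r $ i * p' (\<xi> r) r $ i"
          using it mem unfolding iterates_def by blast
        then show ?thesis
          using C1v_along_characteristic[OF _ \<xi> r, of u' p' q'] adm' by (simp add: admissible_def mult.commute)
      qed
      show "((\<lambda>t. exp (s t)) has_real_derivative \<kappa> * exp (s t)) (at t within {0..T})" for t
        unfolding s_def by (auto intro!: derivative_eq_intros)
      show "((\<lambda>t. s t / 2) has_real_derivative \<kappa> / 2) (at t within {0..T})" for t
        unfolding s_def by (auto intro!: derivative_eq_intros)
      show "\<bar>f x t (u x t) $ i\<bar> \<le> (\<kappa> * exp (s t) - \<kappa> / 2 * transport.depth (en i) x - s t / 2 * \<bar>lam x t $ i\<bar> - 0) *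
          (1 * exp (exp (s t) - s t / 2 * transport.depth (en i) x))"
        if xt: "x \<in> {0..1}" "t \<in> {0..T}" for x t
      proof -
        have "\<bar>u x t $ j\<bar> \<le> exp (exp (s t))" for j 
          by (rule order_trans[OF _ \<beta>_le[OF xt, of j]]) (use u xt in \<open>simp add: inv_def\<close>)
        then have "norm (u x t) \<le> real CARD('n) * exp (exp (s t))" by (rule norm_le_card_components)
        then have "\<bar>f x t (u x t) $ i\<bar> \<le> C * exp (exp (s t) + s t / 4)"
          by (rule order_trans[OF component_le_norm_cart f_growth[OF sc(2)[OF xt(2)] xt]])
        \<comment> \<open>The quarter in the exponent is enlarged to a half, so that
          \<open>C * exp (s t)\<close> remains as factor of the least value
          \<open>exp (exp (s t) - s t / 2)\<close> of the barrier.\<close>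
        also have "\<dots> \<le> C * exp (s t + (exp (s t) - s t / 2))"
          using C sc[OF xt(2)] by (intro mult_left_mono) auto
        also have "\<dots> = C * exp (s t) * exp (exp (s t) - s t / 2)" by (simp only: exp_add mult.assoc)
        also have "\<dots> \<le> (\<kappa> * exp (s t) - \<kappa> / 2 * transport.depth (en i) x - s t / 2 * \<bar>lam x t $ i\<bar>) * \<beta> i x t"
        proof (rule mult_mono[OF _ \<beta>_ge[OF xt]])
          have "\<kappa> / 2 * transport.depth (en i) x \<le> \<kappa> / 2 * exp (s t)"
            using \<kappa> by (intro mult_left_mono order_trans[OF depth(2)[OF xt(1)] s_le(2)[OF xt(2)]]) simp
          moreover have "s t / 2 * \<bar>lam x t $ i\<bar> \<le> exp (s t) / 2 * \<Lambda>"
            using s_le[OF xt(2)] sc[OF xt(2)] \<Lambda>(2)[OF xt] by (intro mult_mono) auto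
          moreover have "\<kappa> * exp (s t) = \<kappa> / 2 * exp (s t) + (exp (s t) / 2 * \<Lambda> + C * exp (s t))"
            by (simp add: \<kappa>_def field_simps)
          ultimately show le: "C * exp (s t) \<le> \<kappa> * exp (s t) - \<kappa> / 2 * transport.depth (en i) x - s t / 2 * \<bar>lam x t $ i\<bar>"
            by linarith
          show "0 \<le> \<kappa> * exp (s t) - \<kappa> / 2 * transport.depth (en i) x - s t / 2 * \<bar>lam x t $ i\<bar>"
            by (rule order_trans[OF _ le]) (use C in simp)
        qed simp
        finally show ?thesis by (simp add: \<beta>_def)
      qed
      show "\<bar>u' x 0 $ i\<bar> \<le> 1 * exp (exp (s 0) - s 0 / 2 * transport.depth (en i) x)" if x: "x \<in> {0..1}" for x
      proof -
        have "\<bar>u' x 0 $ i\<bar> \<le> norm (\<phi> x)"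
          using adm' x component_le_norm_cart[of "\<phi> x" i] by (simp add: admissible_def)
        also have "\<dots> \<le> c / 2" 
        proof -
          have "0 \<le> T * norm v0'" using T by simp
          then show ?thesis using C\<phi>(2)[OF x] c1(3) by simp
        qed
        also have "\<dots> \<le> \<beta> i x 0" using T by (intro \<beta>_ge_c x) simp
        finally show ?thesis by (simp add: \<beta>_def)
      qed
      show "\<bar>u' (en i) t $ i\<bar> \<le> 1 * exp (exp (s t))" if t: "t \<in> {0..T}" for t
      proof -
        have "\<bar>exit_trace u t $ j\<bar> \<le> exp (exp (s t) - s t / 2)" for j
          using u t en_in(2)[of j] unfolding inv_def \<beta>_exit[symmetric, of _ j] by (simp add: exit_trace_def)
        then have "norm (exit_trace u t) \<le> real CARD('n) * exp (exp (s t) - s t / 2)"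
          by (rule norm_le_card_components)
        then have "norm (h t (exit_trace u t)) \<le> C * exp (exp (s t) - s t / 4)"
          by (rule h_growth[OF sc(2)[OF t] t])
        \<comment> \<open>Here the drop of the barrier pays: of the gain
          \<open>exp (- s t / 2)\<close> at the exit a factor \<open>exp (- s t / 4)\<close> is left
          after the boundary map, and it absorbs \<open>C\<close>.\<close>
        also have "\<dots> \<le> exp (s t / 4) * exp (exp (s t) - s t / 4)"
        proof (rule mult_right_mono)
          have "exp (ln C) \<le> exp (s t / 4)" using c1(2) sc(1)[OF t] by simp
          then show "C \<le> exp (s t / 4)" using C by simp
        qed simp
        also have "\<dots> = exp (exp (s t))" by (simp add: mult_exp_exp)
        finally have "norm (h t (exit_trace u t)) \<le> exp (exp (s t))" .
        moreover have "u' (en i) t $ i = h t (exit_trace u t) $ i"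
          using it t unfolding iterates_def by blast
        ultimately show ?thesis using component_le_norm_cart[of "h t (exit_trace u t)" i] by simp
      qed
    qed (use x t in \<open>auto intro: continuous_intros\<close>)
    then show "\<bar>u' x t $ i\<bar> \<le> \<beta> i x t" by (simp add: \<beta>_def)
  qed
  \<comment> \<open>Affine in t with slope \<open>v0'\<close>: the simplest function with the
    initial values \<phi> and the prescribed exit velocity, hence admissible.\<close>
  define u0 where "u0 x t = \<phi> x + t *\<^sub>R v0'" for x t
  have adm0: "admissible u0 (\<lambda>x t. \<phi>' x) (\<lambda>x t. v0')"
    unfolding admissible_def C1v_def C1_x_def
  proof (intro conjI allI ballI)
    fix i and x t :: real assume x: "x \<in> {0..1}"
    have "((\<lambda>x. \<phi> x $ i) has_real_derivative \<phi>' x $ i) (at x within {0..1})"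
      using \<phi>_x[OF x] by (simp add: has_vector_derivative_components)
    then show "((\<lambda>x. u0 x t $ i) has_real_derivative \<phi>' x $ i) (at x within {0..1})"
      unfolding u0_def by (auto intro!: derivative_eq_intros)
    show "((\<lambda>t. u0 x t $ i) has_real_derivative v0' $ i) (at t within {0..T})"
      unfolding u0_def by (auto intro!: derivative_eq_intros)
  next
    fix i
    show "continuous_on ({0..1} \<times> {0..T}) (\<lambda>(x, t). u0 x t $ i)"
      unfolding u0_def case_prod_unfold
      by (intro continuous_intros continuous_on_compose2[OF \<phi>_cont]) auto
    show "continuous_on ({0..1} \<times> {0..T}) (\<lambda>(x, t). \<phi>' x $ i)"
      unfolding case_prod_unfold by (intro continuous_intros continuous_on_compose2[OF \<phi>'_cont]) auto
  qed (auto simp: u0_def exit_trace_def v0'_def)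
  have inv0: "inv u0"
    unfolding inv_def
  proof (intro allI ballI)
    fix i and x t :: real assume xt: "x \<in> {0..1}" "t \<in> {0..T}"
    have "\<bar>u0 x t $ i\<bar> \<le> norm (\<phi> x) + norm (t *\<^sub>R v0')"
      unfolding u0_def by (rule order_trans[OF component_le_norm_cart norm_triangle_ineq])
    also have "\<dots> \<le> C\<phi> + T * norm v0'"
      using C\<phi>(2)[OF xt(1)] xt(2) by (auto intro!: add_mono mult_right_mono)
    also have "\<dots> \<le> c / 2" using c1(3) by simp
    also have "\<dots> \<le> \<beta> i x t" by (rule \<beta>_ge_c[OF xt])
    finally show "\<bar>u0 x t $ i\<bar> \<le> \<beta> i x t" .
  qed
  define ok where "ok S \<longleftrightarrow> admissible (fst S) (fst (snd S)) (snd (snd S)) \<and> inv (fst S)" for S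
  define step where "step S S' \<longleftrightarrow>
    iterates (fst S) (fst (snd S)) (snd (snd S)) (fst S') (fst (snd S')) (snd (snd S'))" for S S'
  have "\<exists>S. \<forall>m. ok (S m) \<and> step (S m) (S (Suc m))"
  proof (rule dependent_nat_choice)
    show "\<exists>S. ok S" using adm0 inv0 unfolding ok_def by (intro exI[of _ "(u0, \<lambda>x t. \<phi>' x, \<lambda>x t. v0')"]) simp
    fix S and n :: nat assume S: "ok S"
    then obtain u' p' q' where "admissible u' p' q'" "iterates (fst S) (fst (snd S)) (snd (snd S)) u' p' q'"
      using iterate_exists[OF compat0 compat1] unfolding ok_def by blast
    then show "\<exists>S'. ok S' \<and> step S S'"
      using S inv_step unfolding ok_def step_def by (intro exI[of _ "(u', p', q')"]) auto
  qed
  then obtain S where S: "\<And>m. ok (S m)" "\<And>m. step (S m) (S (Suc m))" by blast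
  define U where "U m = fst (S m)" for m
  define P where "P m = fst (snd (S m))" for m
  define Q where "Q m = snd (snd (S m))" for m
  \<comment> \<open>The barrier is largest at the inflow end at time T; the factor passes from
    components to the norm.\<close>
  define \<rho> where "\<rho> = real CARD('n) * exp (exp (s T))"
  obtain M0 where "bounded_hyperbolic T en lam lamx f fx fy h ht hz \<phi> \<phi>' \<rho> M0 (real CARD('n))"
    using bounded_hyperbolic_exists by blast
  then interpret bounded_hyperbolic T en lam lamx f fx fy h ht hz \<phi> \<phi>' \<rho> M0 "real CARD('n)" .
  interpret iteration T en lam lamx f fx fy h ht hz \<phi> \<phi>' \<rho> M0 "real CARD('n)" U P Q
  proof
    show "admissible (U m) (P m) (Q m)" for m using S(1)[of m] by (simp add: U_def P_def Q_def ok_def)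
    show "iterates (U m) (P m) (Q m) (U (Suc m)) (P (Suc m)) (Q (Suc m))" for m
      using S(2)[of m] by (simp add: U_def P_def Q_def step_def)
    show "in_box (U m)" for m
      unfolding in_box_def
    proof (intro allI ballI)
      fix i and x t :: real assume xt: "x \<in> {0..1}" "t \<in> {0..T}"
      have "\<bar>U m x t $ i\<bar> \<le> \<beta> i x t"
        using S(1)[of m] xt by (simp add: U_def ok_def inv_def)
      also have "\<dots> \<le> exp (exp (s t))" by (rule \<beta>_le[OF xt])
      also have "\<dots> \<le> exp (exp (s T))" using \<kappa> xt by (simp add: s_def mult_left_mono)
      also have "\<dots> = \<rho> / real CARD('n)" by (simp add: \<rho>_def)
      finally show "\<bar>U m x t $ i\<bar> \<le> \<rho> / real CARD('n)" .
    qed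
  qed
  show ?thesis by (rule solution_exists)
qed

end

section \<open>The growth condition\<close>

text \<open>The increment \<open>v\<close> is built up one coordinate at a time;
  \<open>part S\<close> is \<open>v\<close> with the coordinates outside \<open>S\<close> set to
  zero. Adding coordinate \<open>k\<close> moves along a segment whose points stay within
  \<open>norm v\<close> of \<open>y\<close>, so continuity of the k-th partial derivative at
  \<open>y\<close> bounds the error of that step by \<open>e' * norm v\<close>.\<close>

lemma has_derivative_continuous_partials:
  fixes g :: "real ^ 'n \<Rightarrow> 'b::real_normed_vector" and D :: "'n \<Rightarrow> real ^ 'n \<Rightarrow> 'b"
  assumes D: "\<And>j y. ((\<lambda>s. g (y + s *\<^sub>R axis j 1)) has_vector_derivative D j y) (at 0)"
    and D_cont: "\<And>j. isCont (D j) y"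
  shows "(g has_derivative (\<lambda>v. \<Sum>j\<in>UNIV. v $ j *\<^sub>R D j y)) (at y)"
  unfolding has_derivative_at_alt
proof (intro conjI allI impI)
  show "bounded_linear (\<lambda>v. \<Sum>j\<in>UNIV. v $ j *\<^sub>R D j y)"
    by (intro bounded_linear_sum bounded_linear_compose[OF bounded_linear_scaleR_left bounded_linear_vec_nth])
  fix e :: real assume e: "e > 0"
  define e' where "e' = e / real CARD('n)"
  have e': "e' > 0" using e by (simp add: e'_def)
  have "\<exists>\<delta>>0. \<forall>z. dist z y < \<delta> \<longrightarrow> dist (D j z) (D j y) < e'" for j
    using D_cont[of j] e' unfolding continuous_at_eps_delta by blast
  then obtain \<delta> where \<delta>: "\<And>j. \<delta> j > 0" "\<And>j z. dist z y < \<delta> j \<Longrightarrow> dist (D j z) (D j y) < e'"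
    by metis
  define d where "d = Min (range \<delta>)"
  have d: "d > 0" and d_le: "d \<le> \<delta> j" for j using \<delta>(1) by (auto simp: d_def)
  have "norm (g z - g y - (\<Sum>j\<in>UNIV. (z - y) $ j *\<^sub>R D j y)) \<le> e * norm (z - y)" if z: "norm (z - y) < d" for z
  proof -
    define v where "v = z - y"
    define part where "part S = (\<chi> j. if j \<in> S then v $ j else 0)" for S
    have "norm (g (y + part S) - g y - (\<Sum>j\<in>S. v $ j *\<^sub>R D j y)) \<le> real (card S) * (e' * norm v)"
      if "finite S" for S
      using that
    proof (induction S)
      case empty
      have "part {} = 0" by (simp add: part_def vec_eq_iff)
      then show ?case by simp
    next
      case (insert k S)
      define w where "w = y + part S"
      define F where "F s = g (w + s *\<^sub>R axis k 1) - s *\<^sub>R D k y" for s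
      have seg: "dist (w + s *\<^sub>R axis k 1) y < \<delta> k" if s: "s \<in> closed_segment 0 (v $ k)" for s
      proof -
        have s': "\<bar>s\<bar> \<le> \<bar>v $ k\<bar>" using s by (auto simp: closed_segment_eq_real_ivl split: if_splits)
        have "norm (part S + s *\<^sub>R axis k 1) \<le> norm v"
          by (rule norm_le_componentwise_cart) (use s' insert.hyps in \<open>auto simp: part_def axis_def\<close>)
        then show ?thesis using z d_le[of k] by (simp add: w_def v_def dist_norm add.assoc)
      qed
      have "norm (F (v $ k) - F 0) \<le> e' * norm (v $ k - 0)"
      proof (rule differentiable_bound[where S = "closed_segment 0 (v $ k)"
            and f' = "\<lambda>s h. h *\<^sub>R (D k (w + s *\<^sub>R axis k 1) - D k y)"])
        fix s assume s: "s \<in> closed_segment 0 (v $ k)"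
        have "((\<lambda>r. g ((w + s *\<^sub>R axis k 1) + r *\<^sub>R axis k 1)) has_vector_derivative D k (w + s *\<^sub>R axis k 1)) (at (s - s))"
          using D[of "w + s *\<^sub>R axis k 1" k] by simp
        moreover have "((\<lambda>r. r - s) has_vector_derivative 1) (at s)"
          by (auto intro!: derivative_eq_intros)
        ultimately have "(((\<lambda>r. g ((w + s *\<^sub>R axis k 1) + r *\<^sub>R axis k 1)) \<circ> (\<lambda>r. r - s)) has_vector_derivative
            1 *\<^sub>R D k (w + s *\<^sub>R axis k 1)) (at s)"
          by (intro vector_diff_chain_at)
        then have "((\<lambda>r. g (w + r *\<^sub>R axis k 1)) has_vector_derivative D k (w + s *\<^sub>R axis k 1)) (at s)"
          by (simp add: o_def algebra_simps)
        moreover have "((\<lambda>r. r *\<^sub>R D k y) has_vector_derivative D k y) (at s)"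
          by (auto intro!: derivative_eq_intros)
        ultimately have "(F has_vector_derivative D k (w + s *\<^sub>R axis k 1) - D k y) (at s)"
          unfolding F_def by (rule has_vector_derivative_diff)
        then show "(F has_derivative (\<lambda>h. h *\<^sub>R (D k (w + s *\<^sub>R axis k 1) - D k y))) (at s within closed_segment 0 (v $ k))"
          unfolding has_vector_derivative_def by (rule has_derivative_at_withinI)
        show "onorm (\<lambda>h. h *\<^sub>R (D k (w + s *\<^sub>R axis k 1) - D k y)) \<le> e'"
        proof (rule onorm_le)
          fix h :: real
          have "norm (D k (w + s *\<^sub>R axis k 1) - D k y) \<le> e'"
            using \<delta>(2)[OF seg[OF s]] by (simp add: dist_norm)
          from mult_left_mono[OF this, of "\<bar>h\<bar>"]
          show "norm (h *\<^sub>R (D k (w + s *\<^sub>R axis k 1) - D k y)) \<le> e' * norm h"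
            by (simp add: mult.commute)
        qed
      qed auto
      also have "\<dots> \<le> e' * norm v" using e' component_le_norm_cart[of v k] by (simp add: mult_left_mono)
      finally have k: "norm (F (v $ k) - F 0) \<le> e' * norm v" .
      have pk: "y + part (insert k S) = w + (v $ k) *\<^sub>R axis k 1"
        using insert.hyps by (auto simp: w_def part_def axis_def vec_eq_iff)
      have "g (y + part (insert k S)) - g y - (\<Sum>j\<in>insert k S. v $ j *\<^sub>R D j y) =
          (F (v $ k) - F 0) + (g (y + part S) - g y - (\<Sum>j\<in>S. v $ j *\<^sub>R D j y))"
        unfolding pk F_def using insert.hyps by (simp add: w_def algebra_simps)
      also have "norm \<dots> \<le> e' * norm v + real (card S) * (e' * norm v)"
        by (intro norm_triangle_le add_mono k insert.IH)
      also have "\<dots> = real (card (insert k S)) * (e' * norm v)"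
        using insert.hyps by (simp add: algebra_simps)
      finally show ?case .
    qed
    from this[of UNIV] have "norm (g (y + part UNIV) - g y - (\<Sum>j\<in>UNIV. v $ j *\<^sub>R D j y)) \<le> e * norm v"
      by (simp add: e'_def)
    moreover have "y + part UNIV = z" by (simp add: part_def v_def vec_eq_iff)
    ultimately show ?thesis by (simp add: v_def)
  qed
  then show "\<exists>d>0. \<forall>z. norm (z - y) < d \<longrightarrow>
      norm (g z - g y - (\<Sum>j\<in>UNIV. (z - y) $ j *\<^sub>R D j y)) \<le> e * norm (z - y)"
    using d by blast
qed

lemma C1_in_vector_jacobian:
  fixes g :: "'b::topological_space \<Rightarrow> real ^ 'n \<Rightarrow> real ^ 'm"
  assumes g: "C1_in_vector P g"
  shows "\<And>p y. p \<in> P \<Longrightarrow> (g p has_derivative (\<lambda>v. jacobian (g p) (at y) *v v)) (at y)"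
    and "continuous_on (P \<times> UNIV) (\<lambda>(p, y). jacobian (g p) (at y))"
proof -
  define J where "J p y = (\<chi> i j. partial_deriv j (g p) y $ i)" for p y
  have Jmul: "J p y *v v = (\<Sum>j\<in>UNIV. v $ j *\<^sub>R partial_deriv j (g p) y)" for p y v
    by (simp add: J_def matrix_vector_mult_def vec_eq_iff mult.commute)
  have cont: "continuous_on (P \<times> UNIV) (\<lambda>(p, y). partial_deriv j (g p) y)" for j
    using g by (simp add: C1_in_vector_def)
  have D: "(g p has_derivative (\<lambda>v. J p y *v v)) (at y)" if p: "p \<in> P" for p y
    unfolding Jmul
  proof (rule has_derivative_continuous_partials)
    show "((\<lambda>s. g p (y + s *\<^sub>R axis j 1)) has_vector_derivative partial_deriv j (g p) y) (at 0)" for j y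
      using g p unfolding C1_in_vector_def partial_deriv_def vector_derivative_works[symmetric] by blast
    have "continuous_on UNIV (\<lambda>y. partial_deriv j (g p) y)" for j
      by (rule continuous_on_compose_Pair[OF cont]) (use p in \<open>auto intro: continuous_intros\<close>)
    then show "isCont (partial_deriv j (g p)) y" for j
      by (simp add: continuous_on_eq_continuous_at)
  qed
  have J: "jacobian (g p) (at y) = J p y" if "p \<in> P" for p y
    unfolding jacobian_def frechet_derivative_at[OF D[OF that], symmetric]
    by (rule matrix_of_matrix_vector_mul)
  show "(g p has_derivative (\<lambda>v. jacobian (g p) (at y) *v v)) (at y)" if "p \<in> P" for p y
    using D[OF that] J[OF that] by simp
  have "continuous_on (P \<times> UNIV) (\<lambda>q. J (fst q) (snd q))"
    unfolding J_def using cont unfolding case_prod_unfold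
    by (intro continuous_on_vec_lambda continuous_on_component)
  then show "continuous_on (P \<times> UNIV) (\<lambda>(p, y). jacobian (g p) (at y))"
    by (rule continuous_on_eq) (auto simp: J)
qed

text \<open>The summand 1 keeps the constant at least 1, so that its logarithm is nonnegative in
  \<open>log_growth_bound\<close>.\<close>

lemma polynomial_bound:
  fixes a c :: "nat \<Rightarrow> real" and s :: real
  assumes c: "\<And>j. j \<le> m \<Longrightarrow> \<bar>a j\<bar> \<le> c j" and s: "0 \<le> s"
  shows "(\<Sum>j\<le>m. a j * s ^ j) \<le> (1 + (\<Sum>j\<le>m. c j)) * (1 + s) ^ m" (is "?P \<le> _")
proof -
  have "?P \<le> (\<Sum>j\<le>m. c j * (1 + s) ^ m)"
  proof (rule sum_mono)
    fix j assume j: "j \<in> {..m}"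
    have "a j * s ^ j \<le> \<bar>a j\<bar> * s ^ j" using s by (intro mult_right_mono) auto
    also have "\<dots> \<le> c j * (1 + s) ^ m"
    proof (rule mult_mono)
      have "s ^ j \<le> (1 + s) ^ j" using s by (intro power_mono) auto
      also have "\<dots> \<le> (1 + s) ^ m" using j s by (intro power_increasing) auto
      finally show "s ^ j \<le> (1 + s) ^ m" .
      show "0 \<le> c j" using c[of j] j by simp
    qed (use c[of j] j s in auto)
    finally show "a j * s ^ j \<le> c j * (1 + s) ^ m" .
  qed
  also have "\<dots> = (\<Sum>j\<le>m. c j) * (1 + s) ^ m" by (simp add: sum_distrib_right)
  also have "\<dots> \<le> (1 + (\<Sum>j\<le>m. c j)) * (1 + s) ^ m" using s by (intro mult_right_mono) auto
  finally show ?thesis .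
qed

text \<open>On the ball of radius \<open>N * exp (exp s)\<close> a polynomial has a logarithm of
  order \<open>exp s\<close>, so the fourth root leaves a gradient of order
  \<open>exp (s / 4)\<close>, and the mean value inequality finishes. \<open>R\<close> may be
  smaller than that radius: the boundary map is applied to exit values, which the barrier keeps of
  order \<open>exp (exp s - s / 2)\<close>.\<close>

lemma log_growth_bound:
  fixes g :: "real ^ 'n \<Rightarrow> real ^ 'n" and J :: "real ^ 'n \<Rightarrow> real ^ 'n ^ 'n"
  assumes g: "\<And>z. (g has_derivative (\<lambda>v. J z *v v)) (at z)"
    and J: "\<And>z. norm (J z) \<le> C * ln (ln (P (norm z))) powr (1 / 4)"
    and P_ge: "\<And>z :: real ^ 'n. exp 1 \<le> P (norm z)"
    and P_le: "\<And>s. 0 \<le> s \<Longrightarrow> P s \<le> A * (1 + s) ^ m"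
    and A: "1 \<le> A" and C: "0 \<le> C" and N: "0 \<le> N" and s: "1 \<le> s"
    and y: "norm y \<le> R" and R: "R \<le> N * exp (exp s)"
  shows "norm (g y) \<le> norm (g 0) + C * (ln A + m * (1 + ln (1 + N))) powr (1 / 4) * exp (s / 4) * R"
proof -
  define B where "B = ln A + m * (1 + ln (1 + N))"
  have B: "0 \<le> B" using A N by (simp add: B_def)
  have es: "1 \<le> exp s" "1 \<le> exp (exp s)" using s by simp_all
  have Jz: "norm (J z) \<le> C * B powr (1 / 4) * exp (s / 4)" if z: "norm z \<le> R" for z
  proof -
    have lnP: "1 \<le> ln (P (norm z))" using P_ge[of z] by (simp add: ln_ge_iff order_less_le_trans[OF exp_gt_zero])
    have P0: "0 < P (norm z)" using P_ge[of z] by (rule order_less_le_trans[OF exp_gt_zero])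
    \<comment> \<open>The iterated logarithm is compared with the simple one, which is of order
      \<open>exp s\<close>, the scale that the barrier tolerates.\<close>
    have "ln (ln (P (norm z))) \<le> ln (P (norm z)) - 1" using lnP by (intro ln_le_minus_one) simp
    also have "\<dots> \<le> ln (P (norm z))" by simp
    also have "\<dots> \<le> ln (A * (1 + norm z) ^ m)" using P_le[of "norm z"] P0 by (subst ln_le_cancel_iff) auto
    also have "\<dots> = ln A + m * ln (1 + norm z)"
    proof -
      have pz: "0 < 1 + norm z" by (rule add_pos_nonneg) auto
      then have "1 + norm z \<noteq> 0" by simp
      then show ?thesis using A pz by (simp add: ln_mult ln_realpow)
    qed
    also have "\<dots> \<le> ln A + m * (1 + ln (1 + N)) * exp s"
    proof -
      have "1 + norm z \<le> exp (exp s) + N * exp (exp s)" using z R es by linarith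
      then have "ln (1 + norm z) \<le> ln ((1 + N) * exp (exp s))"
        using N by (subst ln_le_cancel_iff) (auto simp: algebra_simps intro: add_pos_nonneg)
      also have "\<dots> = ln (1 + N) + exp s" using N by (simp add: ln_mult)
      also have "\<dots> \<le> ln (1 + N) * exp s + 1 * exp s"
        using N es mult_left_mono[of 1 "exp s" "ln (1 + N)"] by simp
      finally have "m * ln (1 + norm z) \<le> m * ((1 + ln (1 + N)) * exp s)"
        by (intro mult_left_mono) (simp_all add: algebra_simps)
      then show ?thesis by (simp add: mult.assoc)
    qed
    also have "\<dots> \<le> B * exp s"
      using A es mult_left_mono[of 1 "exp s" "ln A"] by (simp add: B_def algebra_simps)
    finally have "ln (ln (P (norm z))) powr (1 / 4) \<le> (B * exp s) powr (1 / 4)"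
      using lnP by (intro powr_mono2) auto
    also have "\<dots> = B powr (1 / 4) * exp (s / 4)"
      using B by (simp add: powr_mult powr_def[of "exp s"])
    finally show ?thesis using J[of z] C mult_left_mono by fastforce
  qed
  have "norm (g y - g 0) \<le> (C * B powr (1 / 4) * exp (s / 4)) * norm (y - 0)"
  proof (rule differentiable_bound[where S = "cball 0 R" and f' = "\<lambda>z v. J z *v v"])
    show "(g has_derivative (\<lambda>v. J z *v v)) (at z within cball 0 R)" for z
      using g by (rule has_derivative_at_withinI)
    fix z assume "z \<in> cball (0 :: real ^ 'n) R"
    then have z: "norm z \<le> R" by simp
    show "onorm (\<lambda>v. J z *v v) \<le> C * B powr (1 / 4) * exp (s / 4)"
      by (rule onorm_le) (rule order_trans[OF norm_matrix_vector_mult_le mult_right_mono[OF Jz[OF z] norm_ge_zero]])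
  qed (use y order_trans[OF norm_ge_zero y] in auto)
  also have "\<dots> \<le> (C * B powr (1 / 4) * exp (s / 4)) * R" using y C by (intro mult_left_mono) auto
  finally show ?thesis
    using norm_triangle_sub[of "g y" "g 0"] unfolding B_def by linarith
qed

section \<open>The initial-boundary value problem\<close>

lemma C1_polynomial_xt_bound:
  assumes "C1_polynomial_xt T F"
  shows "\<exists>A\<ge>1. \<exists>m. \<forall>x\<in>{0..1}. \<forall>t\<in>{0..T}. \<forall>s\<ge>0. F x t s \<le> A * (1 + s) ^ m"
proof -
  obtain m a where a: "\<And>j. j \<le> m \<Longrightarrow> C1_both {0..1} {0..T} (a j)"
    and F: "\<And>x t s. x \<in> {0..1} \<Longrightarrow> t \<in> {0..T} \<Longrightarrow> s \<ge> 0 \<Longrightarrow> F x t s = (\<Sum>j\<le>(m::nat). a j x t * s ^ j)"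
    using assms unfolding C1_polynomial_xt_def by blast
  have "\<exists>c. \<forall>x\<in>{0..1}. \<forall>t\<in>{0..T}. \<bar>a j x t\<bar> \<le> c" if "j \<le> m" for j
  proof -
    have "continuous_on ({0..1} \<times> {0..T}) (\<lambda>(x, t). a j x t)"
    proof (rule continuous_on_rectangle_if_C1[where wx = "deriv1 {0..1} (a j)"])
      show "((\<lambda>x. a j x t) has_real_derivative deriv1 {0..1} (a j) x t) (at x within {0..1})"
        if "x \<in> {0..1}" "t \<in> {0..T}" for x t
        using a[OF \<open>j \<le> m\<close>] that
        unfolding C1_both_def C1_in_1st_def deriv1_def has_real_derivative_iff_has_vector_derivative
          vector_derivative_works[symmetric] by blast
      show "continuous_on ({0..1} \<times> {0..T}) (\<lambda>(x, t). deriv1 {0..1} (a j) x t)"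
        using a[OF \<open>j \<le> m\<close>] by (simp add: C1_both_def C1_in_1st_def)
      show "continuous_on {0..T} (a j x)" if "x \<in> {0..1}" for x
      proof -
        have "a j x differentiable (at t within {0..T})" if "t \<in> {0..T}" for t
          using a[OF \<open>j \<le> m\<close>] that \<open>x \<in> {0..1}\<close> unfolding C1_both_def C1_in_2nd_def by blast
        then show ?thesis
          by (intro differentiable_imp_continuous_on) (simp add: differentiable_on_def)
      qed
    qed
    from compact_bounded_real[OF this] show ?thesis by blast
  qed
  then obtain c where c: "\<And>j x t. j \<le> m \<Longrightarrow> x \<in> {0..1} \<Longrightarrow> t \<in> {0..T} \<Longrightarrow> \<bar>a j x t\<bar> \<le> c j" by metis
  define A where "A = 1 + (\<Sum>j\<le>m. max 0 (c j))"
  have "1 \<le> A" by (simp add: A_def sum_nonneg)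
  moreover have "F x t s \<le> A * (1 + s) ^ m" if "x \<in> {0..1}" "t \<in> {0..T}" "s \<ge> 0" for x t s
    unfolding F[OF that] A_def
    by (rule polynomial_bound) (use c[OF _ that(1,2)] that in \<open>auto intro: max.coboundedI2\<close>)
  ultimately show ?thesis by blast
qed

lemma C1_polynomial_t_bound:
  assumes "C1_polynomial_t T H"
  shows "\<exists>A\<ge>1. \<exists>m. \<forall>t\<in>{0..T}. \<forall>s\<ge>0. H t s \<le> A * (1 + s) ^ m"
proof -
  obtain m a where a: "\<And>j. j \<le> m \<Longrightarrow> C1_within {0..T} (a j)"
    and H: "\<And>t s. t \<in> {0..T} \<Longrightarrow> s \<ge> 0 \<Longrightarrow> H t s = (\<Sum>j\<le>(m::nat). a j t * s ^ j)"
    using assms unfolding C1_polynomial_t_def by blast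
  have "\<exists>c. \<forall>t\<in>{0..T}. \<bar>a j t\<bar> \<le> c" if "j \<le> m" for j
  proof -
    have "continuous_on {0..T} (a j)"
      using a[OF that] by (intro differentiable_imp_continuous_on) (auto simp: differentiable_on_def C1_within_def)
    then have "bounded (a j ` {0..T})" by (intro compact_imp_bounded compact_continuous_image) simp_all
    then show ?thesis unfolding bounded_iff by auto
  qed
  then obtain c where c: "\<And>j t. j \<le> m \<Longrightarrow> t \<in> {0..T} \<Longrightarrow> \<bar>a j t\<bar> \<le> c j" by metis
  define A where "A = 1 + (\<Sum>j\<le>m. max 0 (c j))"
  have "1 \<le> A" by (simp add: A_def sum_nonneg)
  moreover have "H t s \<le> A * (1 + s) ^ m" if "t \<in> {0..T}" "s \<ge> 0" for t s
    unfolding H[OF that] A_def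
    by (rule polynomial_bound) (use c[OF _ that(1)] that in \<open>auto intro: max.coboundedI2\<close>)
  ultimately show ?thesis by blast
qed

locale ibvp =
  fixes k :: nat
    and lam :: "real \<Rightarrow> real \<Rightarrow> real ^ 'n::{finite,linorder}"
    and f :: "real \<Rightarrow> real \<Rightarrow> real ^ 'n::_ \<Rightarrow> real ^ 'n::_"
    and \<phi> :: "real \<Rightarrow> real ^ 'n::_"
    and h :: "real \<Rightarrow> real ^ 'n::_ \<Rightarrow> real ^ 'n::_"
  assumes lam_neg: "\<And>x t i. x \<in> {0..1} \<Longrightarrow> t \<ge> 0 \<Longrightarrow> idx i \<le> k \<Longrightarrow> lam x t $ i < 0"
    and lam_pos: "\<And>x t i. x \<in> {0..1} \<Longrightarrow> t \<ge> 0 \<Longrightarrow> k + 1 \<le> idx i \<Longrightarrow> lam x t $ i > 0"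
    and lam_cont: "continuous_on ({0..1} \<times> {0..}) (\<lambda>(x, t). lam x t)"
    and lam_C1: "C1_in_1st {0..1} {0..} lam"
    and f_cont: "continuous_on ({0..1} \<times> {0..} \<times> UNIV) (\<lambda>(x, t, y). f x t y)"
    and f_C1_x: "C1_in_1st {0..1} ({0..} \<times> UNIV) (\<lambda>x (t, y). f x t y)"
    and f_C1_u: "C1_in_vector ({0..1} \<times> {0..}) (\<lambda>(x, t). f x t)"
    and \<phi>_C1: "C1_within {0..1} \<phi>"
    and h_C1_t: "C1_in_1st {0..} UNIV h"
    and h_C1_v: "C1_in_vector {0..} h"
    and compat0: "zero_order_compatible k \<phi> h"
    and compat1: "first_order_compatible k lam f \<phi> h"
begin

text \<open>Components with negative speed enter the strip at x = 1.\<close>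

definition en :: "'n \<Rightarrow> real" where "en i = (if idx i \<le> k then 1 else 0)"
definition lamx where "lamx = deriv1 {0..1} lam"
definition fx where "fx x t y = deriv1 {0..1} (\<lambda>x (t, y). f x t y) x (t, y)"
definition fy where "fy x t y = jacobian (f x t) (at y)"
definition ht where "ht = deriv1 {0..} h"
definition hz where "hz t z = jacobian (h t) (at z)"
definition \<phi>' where "\<phi>' x = vector_derivative \<phi> (at x within {0..1})"

lemma hyperbolic:
  assumes T: "0 < T"
  shows "hyperbolic T en lam lamx f fx fy h ht hz \<phi> \<phi>'"
proof (rule hyperbolic.intro)
  show "transport T (en i) (\<lambda>x t. lam x t $ i) (\<lambda>x t. lamx x t $ i)" for i
  proof (rule transport.intro)
    show "0 < T" by (rule T)
    show "en i = 0 \<or> en i = 1" by (simp add: en_def)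
    show "0 < (1 - 2 * en i) * lam x t $ i" if "x \<in> {0..1}" "t \<in> {0..T}" for x t
      using lam_neg[of x t i] lam_pos[of x t i] that by (auto simp: en_def)
    show "C1_x T (\<lambda>x t. lam x t $ i) (\<lambda>x t. lamx x t $ i)"
      unfolding C1_x_def
    proof (intro conjI ballI)
      have "continuous_on ({0..1} \<times> {0..T}) (\<lambda>p. lam (fst p) (snd p))"
        using lam_cont unfolding case_prod_unfold by (rule continuous_on_subset) auto
      then show "continuous_on ({0..1} \<times> {0..T}) (\<lambda>(x, t). lam x t $ i)"
        unfolding case_prod_unfold by (rule continuous_on_component)
      have "continuous_on ({0..1} \<times> {0..T}) (\<lambda>p. lamx (fst p) (snd p))"
        using lam_C1 unfolding C1_in_1st_def lamx_def case_prod_unfold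
        by (auto elim: continuous_on_subset)
      then show "continuous_on ({0..1} \<times> {0..T}) (\<lambda>(x, t). lamx x t $ i)"
        unfolding case_prod_unfold by (rule continuous_on_component)
      fix x t assume "x \<in> {0..1::real}" "t \<in> {0..T}"
      then have "((\<lambda>x. lam x t) has_vector_derivative lamx x t) (at x within {0..1})"
        using lam_C1 unfolding C1_in_1st_def lamx_def deriv1_def vector_derivative_works[symmetric] by auto
      then show "((\<lambda>x. lam x t $ i) has_real_derivative lamx x t $ i) (at x within {0..1})"
        by (simp add: has_vector_derivative_components)
    qed
  qed
next
  show "continuous_on ({0..1} \<times> {0..T} \<times> UNIV) (\<lambda>(x, t, y). f x t y)"
    by (rule continuous_on_subset[OF f_cont]) auto
  have "continuous_on ({0..1} \<times> ({0..} \<times> UNIV)) (\<lambda>(x, p). deriv1 {0..1} (\<lambda>x (t, y). f x t y) x p)"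
    using f_C1_x unfolding C1_in_1st_def by blast
  then have "continuous_on ({0..1} \<times> {0..T} \<times> UNIV) (\<lambda>(x, p). deriv1 {0..1} (\<lambda>x (t, y). f x t y) x p)"
    by (rule continuous_on_subset) auto
  then show "continuous_on ({0..1} \<times> {0..T} \<times> UNIV) (\<lambda>(x, t, y). fx x t y)"
    by (simp add: fx_def case_prod_unfold)
  have J: "continuous_on (({0..1} \<times> {0..}) \<times> UNIV) (\<lambda>(p, y). jacobian ((\<lambda>(x, t). f x t) p) (at y))"
    by (rule C1_in_vector_jacobian(2)[OF f_C1_u])
  have "continuous_on ({0..1} \<times> {0..T} \<times> UNIV)
      (\<lambda>q. (\<lambda>(p, y). jacobian ((\<lambda>(x, t). f x t) p) (at y)) ((fst q, fst (snd q)), snd (snd q)))"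
    by (rule continuous_on_compose2[OF J]) (auto intro!: continuous_intros)
  then show "continuous_on ({0..1} \<times> {0..T} \<times> UNIV) (\<lambda>(x, t, y). fy x t y)"
    by (simp add: fy_def case_prod_unfold)
  show "((\<lambda>x. f x t y) has_vector_derivative fx x t y) (at x within {0..1})" if "x \<in> {0..1}" "t \<in> {0..T}" for x t y
    using f_C1_x that unfolding C1_in_1st_def fx_def deriv1_def split_conv vector_derivative_works[symmetric] by fastforce
  show "(f x t has_derivative (\<lambda>v. fy x t y *v v)) (at y)" if "x \<in> {0..1}" "t \<in> {0..T}" for x t y
    using C1_in_vector_jacobian(1)[OF f_C1_u, of "(x, t)" y] that by (simp add: fy_def)
next
  have "continuous_on ({0..} \<times> UNIV) (\<lambda>(t, z). ht t z)"
    using h_C1_t unfolding C1_in_1st_def ht_def by blast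
  then show "continuous_on ({0..T} \<times> UNIV) (\<lambda>(t, z). ht t z)" by (rule continuous_on_subset) auto
  show "continuous_on ({0..T} \<times> UNIV) (\<lambda>(t, z). hz t z)"
    unfolding hz_def by (rule continuous_on_subset[OF C1_in_vector_jacobian(2)[OF h_C1_v]]) auto
  show "((\<lambda>t. h t z) has_vector_derivative ht t z) (at t within {0..T})" if "t \<in> {0..T}" for t z
  proof -
    have "((\<lambda>t. h t z) has_vector_derivative ht t z) (at t within {0..})"
      using h_C1_t that unfolding C1_in_1st_def ht_def deriv1_def vector_derivative_works[symmetric] by auto
    then show ?thesis by (rule has_vector_derivative_within_subset) auto
  qed
  show "(h t has_derivative (\<lambda>v. hz t z *v v)) (at z)" if "t \<in> {0..T}" for t z
    unfolding hz_def using that by (intro C1_in_vector_jacobian(1)[OF h_C1_v]) simp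
  show "(\<phi> has_vector_derivative \<phi>' x) (at x within {0..1})" if "x \<in> {0..1}" for x
    using \<phi>_C1 that unfolding C1_within_def \<phi>'_def vector_derivative_works[symmetric] by blast
  show "continuous_on {0..1} \<phi>'"
    using \<phi>_C1 unfolding C1_within_def \<phi>'_def by blast
qed

abbreviation sol where
  "sol T u p q \<equiv> hyperbolic.solution T en lam f h \<phi> u p q"

lemma exit_trace_eq: "hyperbolic.exit_trace en u t = outgoing k (u 0 t) (u 1 t)"
  by (simp add: hyperbolic.exit_trace_def[OF hyperbolic[OF zero_less_one]] outgoing_def en_def vec_eq_iff)

lemma compatibility:
  shows "\<phi> (en i) $ i = h 0 (hyperbolic.v0 en \<phi>) $ i"
    and "hyperbolic.velocity lam f \<phi> \<phi>' (en i) $ i =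
      (ht 0 (hyperbolic.v0 en \<phi>) + hz 0 (hyperbolic.v0 en \<phi>) *v hyperbolic.v0' en lam f \<phi> \<phi>') $ i"
proof -
  note H = hyperbolic[OF zero_less_one]
  have v0: "hyperbolic.v0 en \<phi> = outgoing k (\<phi> 0) (\<phi> 1)"
    unfolding hyperbolic.v0_def[OF H] by (rule exit_trace_eq)
  have vel: "hyperbolic.velocity lam f \<phi> \<phi>' x = initial_velocity lam f \<phi> x" for x
    unfolding hyperbolic.velocity_def[OF H] initial_velocity_def
    by (simp add: diag_def \<phi>'_def matrix_vector_mult_def vec_eq_iff if_distrib[of "\<lambda>z. z * _"] cong: if_cong)
  have v0': "hyperbolic.v0' en lam f \<phi> \<phi>' = outgoing k (initial_velocity lam f \<phi> 0) (initial_velocity lam f \<phi> 1)"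
    unfolding hyperbolic.v0'_def[OF H] vel by (rule exit_trace_eq)
  have row: "row i A \<bullet> v = (A *v v) $ i" for A :: "real ^ 'n::_ ^ 'n::_" and v
    by (simp add: matrix_vector_mul_component row_def vec_lambda_eta)
  show "\<phi> (en i) $ i = h 0 (hyperbolic.v0 en \<phi>) $ i"
    using compat0 unfolding zero_order_compatible_def Let_def v0 en_def by auto
  show "hyperbolic.velocity lam f \<phi> \<phi>' (en i) $ i =
      (ht 0 (hyperbolic.v0 en \<phi>) + hz 0 (hyperbolic.v0 en \<phi>) *v hyperbolic.v0' en lam f \<phi> \<phi>') $ i"
    using compat1 unfolding first_order_compatible_def Let_def vel v0 v0' en_def ht_def hz_def by (auto simp: row)
qed

end

text \<open>Each [0, T) is relatively open in the half-line, so continuity can be checked there;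
  with [0, T] the filters would differ at t = T.\<close>

lemma continuous_on_half_strip:
  fixes g :: "real \<times> real \<Rightarrow> 'a::topological_space"
  assumes "\<And>T. T > 0 \<Longrightarrow> continuous_on ({0..1} \<times> {0..<T}) g"
  shows "continuous_on ({0..1} \<times> {0..}) g"
  unfolding continuous_on_def
proof
  fix p :: "real \<times> real" assume p: "p \<in> {0..1} \<times> {0..}"
  define T where "T = snd p + 1"
  have T: "T > 0" "snd p < T" using p by (auto simp: T_def)
  have "at p within {0..1} \<times> {0..} = at p within {0..1} \<times> {0..<T}"
    by (rule at_within_nhd[of p "UNIV \<times> {..<T}"]) (use p T in \<open>auto simp: mem_Times_iff intro: open_Times\<close>)
  moreover have "p \<in> {0..1} \<times> {0..<T}" using p T by (auto simp: mem_Times_iff)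
  then have "(g \<longlongrightarrow> g p) (at p within {0..1} \<times> {0..<T})"
    using assms[OF T(1)] unfolding continuous_on_def by blast
  ultimately show "(g \<longlongrightarrow> g p) (at p within {0..1} \<times> {0..})" by (simp only:)
qed

section \<open>From bounded time intervals to all times\<close>

context ibvp begin

lemma solution_exists:
  assumes T: "0 < T"
    and Cf: "0 < Cf" and Ch: "0 < Ch"
    and F: "C1_polynomial_xt T F" and H: "C1_polynomial_t T H"
    and F_ge: "\<And>x t y. x \<in> {0..1} \<Longrightarrow> t \<in> {0..T} \<Longrightarrow> exp 1 \<le> F x t (norm (y :: real ^ 'n::_))"
    and H_ge: "\<And>t z. t \<in> {0..T} \<Longrightarrow> exp 1 \<le> H t (norm (z :: real ^ 'n::_))"
    and f_le: "\<And>x t y. x \<in> {0..1} \<Longrightarrow> t \<in> {0..T} \<Longrightarrow>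
      norm (jacobian (f x t) (at y)) \<le> Cf * ln (ln (F x t (norm y))) powr (1 / 4)"
    and h_le: "\<And>t z. t \<in> {0..T} \<Longrightarrow>
      norm (jacobian (h t) (at z)) \<le> Ch * ln (ln (H t (norm z))) powr (1 / 4)"
  shows "\<exists>u p q. sol T u p q"
proof -
  interpret S: hyperbolic T en lam lamx f fx fy h ht hz \<phi> \<phi>' by (rule hyperbolic[OF T])
  obtain A m where A: "1 \<le> A"
    and F_le: "\<And>x t s. x \<in> {0..1} \<Longrightarrow> t \<in> {0..T} \<Longrightarrow> s \<ge> 0 \<Longrightarrow> F x t s \<le> A * (1 + s) ^ m"
    using C1_polynomial_xt_bound[OF F] by blast
  obtain A' m' where A': "1 \<le> A'" and H_le: "\<And>t s. t \<in> {0..T} \<Longrightarrow> s \<ge> 0 \<Longrightarrow> H t s \<le> A' * (1 + s) ^ m'"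
    using C1_polynomial_t_bound[OF H] by blast
  define N where "N = real CARD('n)"
  have N: "0 \<le> N" by (simp add: N_def)
  obtain f0 where f0: "0 \<le> f0" "\<And>x t. x \<in> {0..1} \<Longrightarrow> t \<in> {0..T} \<Longrightarrow> norm (f x t 0) \<le> f0"
    using S.state_bounded[OF S.f_cont, of 0] by auto
  have "continuous_on {0..T} (\<lambda>t. h t 0)"
    by (rule continuous_on_vector_derivative[OF S.h_t])
  then have "bounded ((\<lambda>t. h t 0) ` {0..T})" by (intro compact_imp_bounded compact_continuous_image) simp_all
  then obtain h0 where h0: "0 \<le> h0" "\<And>t. t \<in> {0..T} \<Longrightarrow> norm (h t 0) \<le> h0"
    unfolding bounded_pos by (auto dest: less_imp_le)
  define Bf where "Bf = Cf * (ln A + m * (1 + ln (1 + N))) powr (1 / 4) * N"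
  define Bh where "Bh = Ch * (ln A' + m' * (1 + ln (1 + N))) powr (1 / 4) * N"
  have B: "0 \<le> Bf" "0 \<le> Bh" using Cf Ch N by (auto simp: Bf_def Bh_def)
  \<comment> \<open>One constant for the values of f and h at the zero state and for both gradient
    bounds.\<close>
  define C where "C = 1 + f0 + h0 + Bf + Bh"
  show ?thesis
  proof (rule S.solution_exists_if_log_growth[where C = C])
    show "\<phi> (en i) $ i = h 0 S.v0 $ i" for i by (rule compatibility(1))
    show "S.velocity (en i) $ i = (ht 0 S.v0 + hz 0 S.v0 *v S.v0') $ i" for i
      by (rule compatibility(2))
    show "1 \<le> C" using f0 h0 B by (simp add: C_def)
    show "norm (f x t y) \<le> C * exp (exp s + s / 4)"
      if s: "1 \<le> s" and xt: "x \<in> {0..1}" "t \<in> {0..T}" and y: "norm y \<le> real CARD('n) * exp (exp s)" for s x t y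
    proof -
      have "norm (f x t y) \<le> norm (f x t 0) +
          Cf * (ln A + m * (1 + ln (1 + N))) powr (1 / 4) * exp (s / 4) * (N * exp (exp s))"
        by (rule log_growth_bound[where J = "fy x t" and P = "F x t"])
          (use S.f_y[OF xt] f_le[OF xt] F_ge[OF xt] F_le[OF xt] A Cf N s y in \<open>simp_all add: fy_def N_def\<close>)
      also have "\<dots> = norm (f x t 0) + Bf * exp (exp s + s / 4)" by (simp add: Bf_def exp_add)
      also have "\<dots> \<le> (f0 + Bf) * exp (exp s + s / 4)"
      proof -
        have "0 \<le> exp s + s / 4" using s by (intro add_nonneg_nonneg) auto
        then have "norm (f x t 0) * 1 \<le> f0 * exp (exp s + s / 4)"
          using f0(2)[OF xt] f0(1) by (intro mult_mono) auto
        then show ?thesis by (simp add: distrib_right)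
      qed
      also have "\<dots> \<le> C * exp (exp s + s / 4)" using h0 B by (intro mult_right_mono) (auto simp: C_def)
      finally show ?thesis .
    qed
    show "norm (h t z) \<le> C * exp (exp s - s / 4)"
      if s: "1 \<le> s" and t: "t \<in> {0..T}" and z: "norm z \<le> real CARD('n) * exp (exp s - s / 2)" for s t z
    proof -
      have "norm (h t z) \<le> norm (h t 0) +
          Ch * (ln A' + m' * (1 + ln (1 + N))) powr (1 / 4) * exp (s / 4) * (N * exp (exp s - s / 2))"
        by (rule log_growth_bound[where J = "hz t" and P = "H t"])
          (use S.h_z[OF t] h_le[OF t] H_ge[OF t] H_le[OF t] A' Ch N s z in
            \<open>simp_all add: hz_def N_def mult_left_mono\<close>)
      also have "\<dots> = norm (h t 0) + Bh * (exp (s / 4) * exp (exp s - s / 2))" by (simp add: Bh_def)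
      also have "exp (s / 4) * exp (exp s - s / 2) = exp (exp s - s / 4)" by (simp add: mult_exp_exp)
      also have "norm (h t 0) + Bh * exp (exp s - s / 4) \<le> (h0 + Bh) * exp (exp s - s / 4)"
      proof -
        \<comment> \<open>The exponential of this is at least 1 and can therefore absorb the
          constant part \<open>h t 0\<close>.\<close>
        have "0 \<le> exp s - s / 4" using exp_ge_add_one_self[of s] s by linarith
        then have "norm (h t 0) * 1 \<le> h0 * exp (exp s - s / 4)"
          using h0(2)[OF t] h0(1) by (intro mult_mono) auto
        then show ?thesis by (simp add: distrib_right)
      qed
      also have "\<dots> \<le> C * exp (exp s - s / 4)" using f0 B by (intro mult_right_mono) (auto simp: C_def)
      finally show ?thesis .
    qed
  qed
qed

lemma sol_restrict:
  assumes T: "0 < T'" "T' \<le> T" and u: "sol T u p q"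
  shows "sol T' u p q"
proof -
  have T0: "0 < T" using T by simp
  interpret S: hyperbolic T en lam lamx f fx fy h ht hz \<phi> \<phi>' by (rule hyperbolic[OF T0])
  interpret S': hyperbolic T' en lam lamx f fx fy h ht hz \<phi> \<phi>' by (rule hyperbolic[OF T(1)])
  have sub: "{0..1} \<times> {0..T'} \<subseteq> {0..1::real} \<times> {0..T}" "{0..T'} \<subseteq> {0..T}" using T by auto
  have C: "S.C1v u p q" using u by (simp add: S.solution_def)
  have "S'.C1v u p q"
    unfolding S'.C1v_def C1_x_def
  proof (intro conjI allI ballI)
    fix i
    have Ci: "C1_x T (\<lambda>x t. u x t $ i) (\<lambda>x t. p x t $ i)" by (rule S.C1vD(1)[OF C])
    then show "continuous_on ({0..1} \<times> {0..T'}) (\<lambda>(x, t). u x t $ i)"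
      "continuous_on ({0..1} \<times> {0..T'}) (\<lambda>(x, t). p x t $ i)"
      unfolding C1_x_def by (blast intro: continuous_on_subset[OF _ sub(1)])+
    fix x t :: real assume x: "x \<in> {0..1}" and t: "t \<in> {0..T'}"
    then have t': "t \<in> {0..T}" using sub by blast
    show "((\<lambda>x. u x t $ i) has_real_derivative p x t $ i) (at x within {0..1})"
      using Ci x t' unfolding C1_x_def by blast
    have "((\<lambda>t. u x t $ i) has_real_derivative q x t $ i) (at t within {0..T})"
      using C x t' unfolding S.C1v_def by blast
    then show "((\<lambda>t. u x t $ i) has_real_derivative q x t $ i) (at t within {0..T'})"
      by (rule DERIV_subset[OF _ sub(2)])
  qed (rule continuous_on_subset[OF S.C1vD(4)[OF C] sub(1)])
  then show ?thesis using u sub(2) unfolding S.solution_def S'.solution_def by blast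
qed

lemma sol_agree:
  assumes "sol T u p q" "sol T w p' q'" "0 < T" "x \<in> {0..1}" "t \<in> {0..T}"
  shows "u x t = w x t"
  by (rule hyperbolic.solutions_agree[OF hyperbolic[OF assms(3)] assms(1,2,4,5)])

text \<open>The equation and the initial condition are given on open sets only; both extend to the
  closed strip by continuity. The boundary conditions at t = 0 come from zero-order
  compatibility.\<close>

lemma classical_solution_imp_sol:
  assumes u: "classical_solution k lam f \<phi> h u" and T: "0 < T"
  shows "sol T u (deriv1 {0..1} u) (deriv2 {0..} u)"
proof -
  interpret S: hyperbolic T en lam lamx f fx fy h ht hz \<phi> \<phi>' by (rule hyperbolic[OF T])
  let ?p = "deriv1 {0..1} u" and ?q = "deriv2 {0..} u"
  have C: "C1_in_1st {0..1} {0..} u" "C1_in_2nd {0..1} {0..} u"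
    using u by (simp_all add: classical_solution_def C1_both_def)
  have ux: "((\<lambda>x. u x t) has_vector_derivative ?p x t) (at x within {0..1})" if "x \<in> {0..1}" "t \<in> {0..T}" for x t
    using C(1) that unfolding C1_in_1st_def deriv1_def vector_derivative_works[symmetric] by auto
  have ut': "((\<lambda>t. u x t) has_vector_derivative ?q x t) (at t within {0..})" if "x \<in> {0..1}" "t \<ge> 0" for x t
    using C(2) that unfolding C1_in_2nd_def deriv2_def vector_derivative_works[symmetric] by auto
  have ut: "((\<lambda>t. u x t) has_vector_derivative ?q x t) (at t within {0..T})" if "x \<in> {0..1}" "t \<in> {0..T}" for x t
    by (rule has_vector_derivative_within_subset[OF ut']) (use that in auto)
  have p_cont: "continuous_on ({0..1} \<times> {0..T}) (\<lambda>(x, t). ?p x t)"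
    by (rule continuous_on_subset[of "{0..1} \<times> {0..}"]) (use C(1) in \<open>auto simp: C1_in_1st_def\<close>)
  have q_cont: "continuous_on ({0..1} \<times> {0..T}) (\<lambda>(x, t). ?q x t)"
    by (rule continuous_on_subset[of "{0..1} \<times> {0..}"]) (use C(2) in \<open>auto simp: C1_in_2nd_def\<close>)
  have ut_cont: "continuous_on {0..T} (\<lambda>t. u x t)" if "x \<in> {0..1}" for x
    by (rule continuous_on_vector_derivative[OF ut[OF that]])
  have ux_cont: "continuous_on {0..1} (\<lambda>x. u x t)" if "t \<in> {0..T}" for t
    by (rule continuous_on_vector_derivative[OF ux[OF _ that]])
  have C1v: "S.C1v u ?p ?q"
    unfolding S.C1v_def C1_x_def
  proof (intro conjI allI ballI)
    fix i
    show pi: "continuous_on ({0..1} \<times> {0..T}) (\<lambda>(x, t). ?p x t $ i)"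
      using p_cont unfolding case_prod_unfold by (rule continuous_on_component)
    show ux_i: "((\<lambda>x. u x t $ i) has_real_derivative ?p x t $ i) (at x within {0..1})"
      if "x \<in> {0..1}" "t \<in> {0..T}" for x t
      using ux[OF that] by (simp add: has_vector_derivative_components)
    show "((\<lambda>t. u x t $ i) has_real_derivative ?q x t $ i) (at t within {0..T})"
      if "x \<in> {0..1}" "t \<in> {0..T}" for x t
      using ut[OF that] by (simp add: has_vector_derivative_components)
    show "continuous_on ({0..1} \<times> {0..T}) (\<lambda>(x, t). u x t $ i)"
      by (rule continuous_on_rectangle_if_C1[OF ux_i pi continuous_on_component[OF ut_cont]])
  qed (rule q_cont)
  have u_cont: "continuous_on ({0..1} \<times> {0..T}) (\<lambda>(x, t). u x t)" by (rule S.C1vD(2)[OF C1v])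
  have cl: "closure ({0<..<1::real} \<times> {0<..<T}) = {0..1} \<times> {0..T}"
    using T by (simp add: closure_Times)
  have pde: "?q x t $ i = f x t (u x t) $ i - lam x t $ i * ?p x t $ i" if "x \<in> {0..1}" "t \<in> {0..T}" for x t i
  proof -
    define g where "g z = ?q (fst z) (snd z) $ i -
      (f (fst z) (snd z) (u (fst z) (snd z)) $ i - lam (fst z) (snd z) $ i * ?p (fst z) (snd z) $ i)" for z
    have "continuous_on ({0..1} \<times> {0..T}) g"
      unfolding g_def
      using q_cont p_cont S.lam_cont S.continuous_on_triple[OF S.f_cont u_cont] unfolding case_prod_unfold
      by (intro continuous_intros)
    then have "continuous_on (closure ({0<..<1} \<times> {0<..<T})) g" by (simp only: cl)
    moreover have "g z = 0" if "z \<in> {0<..<1} \<times> {0<..<T}" for z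
    proof -
      have "?q (fst z) (snd z) + diag (lam (fst z) (snd z)) *v ?p (fst z) (snd z) = f (fst z) (snd z) (u (fst z) (snd z))"
        using u that unfolding classical_solution_def by auto
      from arg_cong[OF this, of "\<lambda>v. v $ i"]
      have "?q (fst z) (snd z) $ i + (diag (lam (fst z) (snd z)) *v ?p (fst z) (snd z)) $ i =
          f (fst z) (snd z) (u (fst z) (snd z)) $ i"
        by simp
      moreover have "(diag (lam (fst z) (snd z)) *v ?p (fst z) (snd z)) $ i = lam (fst z) (snd z) $ i * ?p (fst z) (snd z) $ i"
        by (simp add: diag_def matrix_vector_mult_def if_distrib[of "\<lambda>z. z * _"] cong: if_cong)
      ultimately show ?thesis by (simp add: g_def)
    qed
    moreover have "(x, t) \<in> closure ({0<..<1} \<times> {0<..<T})" using that by (simp add: cl)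
    ultimately have "g (x, t) = 0" by (rule continuous_constant_on_closure)
    then show ?thesis by (simp add: g_def)
  qed
  have init: "u x 0 = \<phi> x" if "x \<in> {0..1}" for x
  proof -
    have "continuous_on {0..1} (\<lambda>x. u x 0 - \<phi> x)"
      by (intro continuous_on_diff ux_cont continuous_on_vector_derivative[OF S.\<phi>_x]) (use T in auto)
    then have "continuous_on (closure {0<..<1}) (\<lambda>x. u x 0 - \<phi> x)" by simp
    moreover have "u x 0 - \<phi> x = 0" if "x \<in> {0<..<1}" for x
      using u that by (simp add: classical_solution_def)
    moreover have "x \<in> closure {0<..<1}" using that by simp
    ultimately have "u x 0 - \<phi> x = 0" by (rule continuous_constant_on_closure)
    then show ?thesis by simp
  qed
  have "u (en i) t $ i = h t (S.exit_trace u t) $ i" if t: "t \<in> {0..T}" for i t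
  proof (cases "t = 0")
    case True
    have "S.exit_trace u 0 = S.v0"
      using init by (simp add: exit_trace_eq S.v0_def outgoing_def vec_eq_iff)
    then show ?thesis using True init[OF S.en_in(1)] compatibility(1) by simp
  next
    case False
    then show ?thesis
      using u t by (auto simp: classical_solution_def exit_trace_eq en_def)
  qed
  then show ?thesis using C1v init pde by (simp add: S.solution_def)
qed

lemma sols_imp_classical_solution:
  assumes sols: "\<And>T. 0 < T \<Longrightarrow> \<exists>p q. sol T u p q"
  shows "classical_solution k lam f \<phi> h u"
proof -
  have "\<exists>p q. (\<forall>x\<in>{0..1}. \<forall>t\<in>{0..<T}. ((\<lambda>x. u x t) has_vector_derivative p x t) (at x within {0..1}) \<and>
        ((\<lambda>t. u x t) has_vector_derivative q x t) (at t within {0..}) \<and>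
        deriv1 {0..1} u x t = p x t \<and> deriv2 {0..} u x t = q x t) \<and>
      continuous_on ({0..1} \<times> {0..<T}) (\<lambda>(x, t). p x t) \<and> continuous_on ({0..1} \<times> {0..<T}) (\<lambda>(x, t). q x t) \<and> sol T u p q"
    if T: "0 < T" for T
  proof -
    interpret S: hyperbolic T en lam lamx f fx fy h ht hz \<phi> \<phi>' by (rule hyperbolic[OF T])
    obtain p q where u: "sol T u p q" using sols[OF T] by blast
    then have C: "S.C1v u p q" by (simp add: S.solution_def)
    have sub: "{0..1} \<times> {0..<T} \<subseteq> {0..1::real} \<times> {0..T}" by auto
    have "((\<lambda>x. u x t) has_vector_derivative p x t) (at x within {0..1}) \<and>
        ((\<lambda>t. u x t) has_vector_derivative q x t) (at t within {0..}) \<and>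
        deriv1 {0..1} u x t = p x t \<and> deriv2 {0..} u x t = q x t"
      if x: "x \<in> {0..1}" and t: "t \<in> {0..<T}" for x t
    proof -
      have t': "t \<in> {0..T}" using t by simp
      \<comment> \<open>True because t < T; hence the half-open time interval here and the choice
        \<open>t + 1\<close> in \<open>sol_at\<close>.\<close>
      have at: "at t within {0..} = at t within {0..T}"
        by (rule at_within_nhd[of t "{..<T}"]) (use t in auto)
      have "deriv1 {0..1} u x t = p x t"
        unfolding deriv1_def
        by (rule vector_derivative_within_closed_interval[OF _ x S.C1vD(5)[OF C x t']]) simp
      moreover have "deriv2 {0..} u x t = q x t"
        unfolding deriv2_def at
        by (rule vector_derivative_within_closed_interval[OF T t' S.C1vD(6)[OF C x t']])
      ultimately show ?thesis using S.C1vD(5,6)[OF C x t'] unfolding at by blast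
    qed
    then show ?thesis
      using u continuous_on_subset[OF S.C1vD(3)[OF C] sub] continuous_on_subset[OF S.C1vD(4)[OF C] sub] by blast
  qed
  note local = this
  have sol_at: "\<exists>p q. ((\<lambda>x. u x t) has_vector_derivative p x t) (at x within {0..1}) \<and>
        ((\<lambda>t. u x t) has_vector_derivative q x t) (at t within {0..}) \<and>
        deriv1 {0..1} u x t = p x t \<and> deriv2 {0..} u x t = q x t \<and> sol (t + 1) u p q"
    if "x \<in> {0..1}" "0 \<le> t" for x t
    using local[of "t + 1"] that by fastforce
  have "C1_in_1st {0..1} {0..} u"
    unfolding C1_in_1st_def
  proof (intro conjI ballI continuous_on_half_strip)
    show "(\<lambda>x. u x t) differentiable at x within {0..1}" if "x \<in> {0..1}" "t \<in> {0..}" for x t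
      using sol_at[of x t] that by (auto intro: differentiableI_vector)
    show "continuous_on ({0..1} \<times> {0..<T}) (\<lambda>(x, t). deriv1 {0..1} u x t)" if T: "T > 0" for T
    proof -
      obtain p where c: "continuous_on ({0..1} \<times> {0..<T}) (\<lambda>(x, t). p x t)"
        and eq: "\<And>x t. x \<in> {0..1} \<Longrightarrow> t \<in> {0..<T} \<Longrightarrow> deriv1 {0..1} u x t = p x t"
        using local[OF T] by blast
      show ?thesis by (rule continuous_on_eq[OF c]) (auto simp: eq)
    qed
  qed
  moreover have "C1_in_2nd {0..1} {0..} u"
    unfolding C1_in_2nd_def
  proof (intro conjI ballI continuous_on_half_strip)
    show "(\<lambda>t. u x t) differentiable at t within {0..}" if "x \<in> {0..1}" "t \<in> {0..}" for x t
      using sol_at[of x t] that by (auto intro: differentiableI_vector)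
    show "continuous_on ({0..1} \<times> {0..<T}) (\<lambda>(x, t). deriv2 {0..} u x t)" if T: "T > 0" for T
    proof -
      obtain q where c: "continuous_on ({0..1} \<times> {0..<T}) (\<lambda>(x, t). q x t)"
        and eq: "\<And>x t. x \<in> {0..1} \<Longrightarrow> t \<in> {0..<T} \<Longrightarrow> deriv2 {0..} u x t = q x t"
        using local[OF T] by blast
      show ?thesis by (rule continuous_on_eq[OF c]) (auto simp: eq)
    qed
  qed
  moreover have "deriv2 {0..} u x t + diag (lam x t) *v deriv1 {0..1} u x t = f x t (u x t)"
    if x: "x \<in> {0..1}" and t: "0 \<le> t" for x t
  proof -
    obtain p q where pq: "deriv1 {0..1} u x t = p x t" "deriv2 {0..} u x t = q x t" "sol (t + 1) u p q"
      using sol_at[OF x t] by blast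
    have T: "0 < t + 1" using t by simp
    have "q x t $ i = f x t (u x t) $ i - lam x t $ i * p x t $ i" for i
      using pq(3) x t unfolding hyperbolic.solution_def[OF hyperbolic[OF T]] by simp
    moreover have "(diag (lam x t) *v p x t) $ i = lam x t $ i * p x t $ i" for i
      by (simp add: diag_def matrix_vector_mult_def if_distrib[of "\<lambda>z. z * _"] cong: if_cong)
    ultimately show ?thesis unfolding pq(1,2) by (simp add: vec_eq_iff)
  qed
  moreover have "u x 0 = \<phi> x" if "x \<in> {0..1}" for x
  proof -
    obtain p q where "sol 1 u p q" using sols[of 1] by auto
    then show ?thesis using that unfolding hyperbolic.solution_def[OF hyperbolic[OF zero_less_one]] by blast
  qed
  moreover
  have "u (en i) t $ i = h t (outgoing k (u 0 t) (u 1 t)) $ i" if t: "t > 0" for i t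
  proof -
    obtain p q where "sol t u p q" using sols[OF t] by auto
    then show ?thesis using t unfolding hyperbolic.solution_def[OF hyperbolic[OF t]] exit_trace_eq by auto
  qed
  note bc = this
  have "u 0 t $ i = h t (outgoing k (u 0 t) (u 1 t)) $ i" if "t > 0" "k + 1 \<le> idx i" for i t
    using bc[OF that(1), of i] that(2) by (simp add: en_def)
  moreover have "u 1 t $ i = h t (outgoing k (u 0 t) (u 1 t)) $ i" if "t > 0" "idx i \<le> k" for i t
    using bc[OF that(1), of i] that(2) by (simp add: en_def)
  ultimately show ?thesis
    unfolding classical_solution_def C1_both_def by simp
qed

text \<open>By uniqueness solutions on different intervals agree where both are defined, so they fit
  together; any classical solution restricts to a solution on each bounded interval and is therefore
  equal to the glued one.\<close>

lemma classical_solution_exists_unique: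
  assumes ex: "\<And>T. 0 < T \<Longrightarrow> \<exists>u p q. sol T u p q"
  shows "\<exists>u. classical_solution k lam f \<phi> h u \<and>
    (\<forall>w. classical_solution k lam f \<phi> h w \<longrightarrow> (\<forall>x\<in>{0..1}. \<forall>t\<ge>0. w x t = u x t))"
proof -
  have "\<forall>m. \<exists>u. \<exists>p q. sol (real (Suc m)) u p q" using ex by simp
  then obtain U where U: "\<And>m. \<exists>p q. sol (real (Suc m)) (U m) p q" by metis
  \<comment> \<open>\<open>U m\<close> lives on [0, m + 1], so t is strictly inside the time
    interval of the function that is used for it.\<close>
  define u where "u x t = U (nat \<lceil>t\<rceil>) x t" for x t
  have u_eq: "u x t = U m x t" if "x \<in> {0..1}" "t \<in> {0..real (Suc m)}" for m x t
  proof -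
    define T where "T = min (real (Suc m)) (real (Suc (nat \<lceil>t\<rceil>)))"
    have T: "0 < T" "T \<le> real (Suc m)" "T \<le> real (Suc (nat \<lceil>t\<rceil>))" by (auto simp: T_def)
    have "t \<le> real (nat \<lceil>t\<rceil>)" by (rule real_nat_ceiling_ge)
    then have "t \<le> real (Suc (nat \<lceil>t\<rceil>))" by simp
    then have t: "t \<in> {0..T}" using that by (auto simp: T_def)
    obtain p q p' q' where "sol (real (Suc m)) (U m) p q" "sol (real (Suc (nat \<lceil>t\<rceil>))) (U (nat \<lceil>t\<rceil>)) p' q'"
      using U by blast
    then have "sol T (U m) p q" "sol T (U (nat \<lceil>t\<rceil>)) p' q'" using sol_restrict T by blast+
    then show ?thesis unfolding u_def by (rule sol_agree[OF _ _ T(1) that(1) t, symmetric])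
  qed
  have "\<exists>p q. sol T u p q" if T: "0 < T" for T
  proof -
    define m where "m = nat \<lceil>T\<rceil>"
    have m: "T \<le> real (Suc m)" using real_nat_ceiling_ge[of T] by (simp add: m_def)
    obtain p q where "sol (real (Suc m)) (U m) p q" using U by blast
    then have sol: "sol T (U m) p q" using sol_restrict[OF T m] by blast
    have eq: "u x t = U m x t" if "x \<in> {0..1}" "t \<in> {0..T}" for x t
      using u_eq[of x t m] that m by simp
    interpret S: hyperbolic T en lam lamx f fx fy h ht hz \<phi> \<phi>' by (rule hyperbolic[OF T])
    have C: "S.C1v (U m) p q" using sol by (simp add: S.solution_def)
    have "S.C1v u p q"
      unfolding S.C1v_def C1_x_def
    proof (intro conjI allI ballI)
      fix i
      have "continuous_on ({0..1} \<times> {0..T}) (\<lambda>(x, t). U m x t $ i)"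
        using C by (simp add: S.C1v_def C1_x_def)
      then show "continuous_on ({0..1} \<times> {0..T}) (\<lambda>(x, t). u x t $ i)"
        by (rule continuous_on_eq) (auto simp: eq)
      show "continuous_on ({0..1} \<times> {0..T}) (\<lambda>(x, t). p x t $ i)"
        using C by (simp add: S.C1v_def C1_x_def)
      fix x t :: real assume x: "x \<in> {0..1}" and t: "t \<in> {0..T}"
      show "((\<lambda>x. u x t $ i) has_real_derivative p x t $ i) (at x within {0..1})"
        by (rule has_field_derivative_transform_within[where f = "\<lambda>x. U m x t $ i" and d = 1])
          (use C x t eq in \<open>auto simp: S.C1v_def C1_x_def\<close>)
      show "((\<lambda>t. u x t $ i) has_real_derivative q x t $ i) (at t within {0..T})"
        by (rule has_field_derivative_transform_within[where f = "\<lambda>t. U m x t $ i" and d = 1])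
          (use C x t eq in \<open>auto simp: S.C1v_def\<close>)
    qed (rule S.C1vD(4)[OF C])
    moreover have "S.exit_trace u t = S.exit_trace (U m) t" if "t \<in> {0..T}" for t
      using eq[OF _ that] S.en_in by (simp add: S.exit_trace_def vec_eq_iff)
    ultimately have "sol T u p q"
      using sol eq S.en_in T by (simp add: S.solution_def)
    then show ?thesis by blast
  qed
  note sol_u = this
  have "classical_solution k lam f \<phi> h u" by (rule sols_imp_classical_solution[OF sol_u])
  moreover have "w x t = u x t" if w: "classical_solution k lam f \<phi> h w" and xt: "x \<in> {0..1}" "t \<ge> 0" for w x t
  proof -
    have T: "0 < t + 1" using xt by simp
    obtain p q where "sol (t + 1) u p q" using sol_u[OF T] by blast
    then show ?thesis
      using sol_agree[OF classical_solution_imp_sol[OF w T] _ T xt(1)] xt(2) by simp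
  qed
  ultimately show ?thesis by blast
qed

end

theorem theorem3p1:
  fixes k :: nat
    and lam :: "real \<Rightarrow> real \<Rightarrow> real ^ 'n::{finite,linorder}"
    and f :: "real \<Rightarrow> real \<Rightarrow> real ^ 'n::_ \<Rightarrow> real ^ 'n::_"
    and \<phi> :: "real \<Rightarrow> real ^ 'n::_"
    and h :: "real \<Rightarrow> real ^ 'n::_ \<Rightarrow> real ^ 'n::_"
  assumes k: "1 \<le> k" "k \<le> CARD('n)"
    and lam_neg: "\<And>x t i. x \<in> {0..1} \<Longrightarrow> t \<ge> 0 \<Longrightarrow> idx i \<le> k \<Longrightarrow> lam x t $ i < 0"
    and lam_pos: "\<And>x t i. x \<in> {0..1} \<Longrightarrow> t \<ge> 0 \<Longrightarrow> k + 1 \<le> idx i \<Longrightarrow> lam x t $ i > 0"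
    and lam_cont: "continuous_on ({0..1} \<times> {0..}) (\<lambda>(x, t). lam x t)"
    and lam_C1: "C1_in_1st {0..1} {0..} lam"
    and f_cont: "continuous_on ({0..1} \<times> {0..} \<times> UNIV) (\<lambda>(x, t, y). f x t y)"
    and f_C1_x: "C1_in_1st {0..1} ({0..} \<times> UNIV) (\<lambda>x (t, y). f x t y)"
    and f_C1_u: "C1_in_vector ({0..1} \<times> {0..}) (\<lambda>(x, t). f x t)"
    and \<phi>_C1: "C1_within {0..1} \<phi>"
    and h_C1_t: "C1_in_1st {0..} UNIV h"
    and h_C1_v: "C1_in_vector {0..} h"
    and growth: "\<And>T. T > 0 \<Longrightarrow>
      \<exists>C\<^sub>f>0. \<exists>C\<^sub>h>0. \<exists>F H.
        C1_polynomial_xt T F \<and> C1_polynomial_t T H \<and>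
        (\<forall>x\<in>{0..1}. \<forall>t\<in>{0..T}. \<forall>y. F x t (norm (y :: real ^ 'n::_)) \<ge> exp 1) \<and>
        (\<forall>t\<in>{0..T}. \<forall>z. H t (norm (z :: real ^ 'n::_)) \<ge> exp 1) \<and>
        (\<forall>x\<in>{0..1}. \<forall>t\<in>{0..T}. \<forall>y.
           norm (jacobian (f x t) (at y)) \<le> C\<^sub>f * ln (ln (F x t (norm y))) powr (1 / 4)) \<and>
        (\<forall>t\<in>{0..T}. \<forall>z.
           norm (jacobian (h t) (at z)) \<le> C\<^sub>h * ln (ln (H t (norm z))) powr (1 / 4))"
    and compat0: "zero_order_compatible k \<phi> h"
    and compat1: "first_order_compatible k lam f \<phi> h"
  shows "\<exists>u. classical_solution k lam f \<phi> h u \<and>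
           (\<forall>w. classical_solution k lam f \<phi> h w \<longrightarrow>
              (\<forall>x\<in>{0..1}. \<forall>t\<ge>0. w x t = u x t))"
proof -
  interpret ibvp k lam f \<phi> h
    by (rule ibvp.intro) (fact lam_neg lam_pos lam_cont lam_C1 f_cont f_C1_x f_C1_u \<phi>_C1 h_C1_t h_C1_v compat0 compat1)+
  show ?thesis
  proof (rule classical_solution_exists_unique)
    fix T :: real assume T: "0 < T"
    obtain Cf Ch F H where "Cf > 0" "Ch > 0" "C1_polynomial_xt T F" "C1_polynomial_t T H"
      and "\<forall>x\<in>{0..1}. \<forall>t\<in>{0..T}. \<forall>y. F x t (norm (y :: real ^ 'n::_)) \<ge> exp 1"
      and "\<forall>t\<in>{0..T}. \<forall>z. H t (norm (z :: real ^ 'n::_)) \<ge> exp 1"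
      and "\<forall>x\<in>{0..1}. \<forall>t\<in>{0..T}. \<forall>y. norm (jacobian (f x t) (at y)) \<le> Cf * ln (ln (F x t (norm y))) powr (1 / 4)"
      and "\<forall>t\<in>{0..T}. \<forall>z. norm (jacobian (h t) (at z)) \<le> Ch * ln (ln (H t (norm z))) powr (1 / 4)"
      using growth[OF T] by blast
    then show "\<exists>u p q. sol T u p q" by (intro solution_exists[OF T, of Cf Ch F H]) blast+
  qed
qed

end
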